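(* Over the base system $\mathsf{RCA}_0$: for every (standard) $n\ge 1$, $\mathsf{WKL}_0$ is equivalent to $\mathsf{DBi}_n$, and $\mathsf{WKL}_0$ is equivalent to $\mathsf{DBc}_n$. Moreover, over $\mathsf{RCA}_0$, $\mathsf{WKL}_0$ is equivalent to $\forall n\,\mathsf{DBi}_n$ and also to $\forall n\,\mathsf{DBc}_n$.
   Context: We work in second order arithmetic. $\mathsf{RCA}_0$ consists of the axioms of ordered semirings, $\Sigma^0_1$ induction and $\Delta^0_1$ comprehension; $\mathsf{WKL}_0$ is $\mathsf{RCA}_0$ plus weak König's lemma (every infinite binary tree has an infinite path). All posets have domain a subset of $\mathbb N$. A poset $(P,\preceq)$ is a set with a reflexive, transitive, antisymmetric relation; $x\mid y$ means $x\not\preceq y$ and $y\not\preceq x$. A chain in $P$ is a (possibly empty) subset linearly ordered by $\preceq$. Subsets $Y,Z\subseteq P$ are incomparable if $y\mid z$ for all $y\in Y$, $z\in Z$. A linearization of $(P,\preceq)$ is a linear order $\trianglelefteq$ on $P$ with ${\preceq}\subseteq{\trianglelefteq}$. A realization of $(P,\preceq)$ with $m\geq 1$ linearizations is an indexed family $(\trianglelefteq_i)_{i<m}$ (repetitions allowed) of linearizations with $\bigcap_{i<m}{\trianglelefteq_i}={\preceq}$. The inequality $\dim(P,\preceq)\le\dim(Q,\preceq)+k$ abbreviates: for every $m\ge1$ and every realization of $Q$ with $m$ linearizations there is a realization of $P$ with $m+k$ linearizations. $\mathsf{DBi}_n$: for each poset $(P,\preceq)$ and each family of pairwise incomparable chains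 $C_i\subseteq P$, $i<n$, $\dim(P,\preceq)\le\dim(P\setminus\bigcup_{i<n}C_i,\preceq)+\max\{2,n\}$. $\mathsf{DBc}_n$: for each poset $(P,\preceq)$ and each family of chains $C_i\subseteq P$, $i<n$, $\dim(P,\preceq)\le\dim(P\setminus\bigcup_{i<n}C_i,\preceq)+2n$. *)

theory Defs
  imports Main
begin

text \<open>
  Provability over \<open>RCA\<^sub>0\<close> is rendered as truth in all models of \<open>RCA\<^sub>0\<close>, for the two-sorted
  (Henkin) semantics of second order arithmetic.  The number variables of a structure \<open>M\<close> range
  over the whole type \<open>'a\<close>, which may well contain nonstandard elements; the set variables range
  over \<open>Sets M\<close> only.  A principle such as weak Koenig's lemma is a predicate on structures,
  obtained by writing out its satisfaction: all number quantifiers below range over \<open>'a\<close>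
  and all set quantifiers over \<open>Sets M\<close>.
\<close>

record 'a l2_structure =
  Zero :: 'a  ("\<zero>\<index>")
  One :: 'a  ("\<one>\<index>")
  Plus :: "'a \<Rightarrow> 'a \<Rightarrow> 'a"  (infixl "\<oplus>\<index>" 65)
  Times :: "'a \<Rightarrow> 'a \<Rightarrow> 'a"  (infixl "\<otimes>\<index>" 70)
  Less :: "'a \<Rightarrow> 'a \<Rightarrow> bool"  (infix "\<sqsubset>\<index>" 50)
  Sets :: "'a set set"


section \<open>The axioms of \<open>RCA\<^sub>0\<close>\<close>

text \<open>The axioms of (discretely) ordered semirings, often called \<open>PA\<^sup>-\<close>.\<close>

definition ordered_semiring :: "'a l2_structure \<Rightarrow> bool"
  where "ordered_semiring M \<longleftrightarrow>
    (\<forall>x y z. (x \<oplus>\<^bsub>M\<^esub> y) \<oplus>\<^bsub>M\<^esub> z = x \<oplus>\<^bsub>M\<^esub> (y \<oplus>\<^bsub>M\<^esub> z)) \<and>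
    (\<forall>x y. x \<oplus>\<^bsub>M\<^esub> y = y \<oplus>\<^bsub>M\<^esub> x) \<and>
    (\<forall>x y z. (x \<otimes>\<^bsub>M\<^esub> y) \<otimes>\<^bsub>M\<^esub> z = x \<otimes>\<^bsub>M\<^esub> (y \<otimes>\<^bsub>M\<^esub> z)) \<and>
    (\<forall>x y. x \<otimes>\<^bsub>M\<^esub> y = y \<otimes>\<^bsub>M\<^esub> x) \<and>
    (\<forall>x y z. x \<otimes>\<^bsub>M\<^esub> (y \<oplus>\<^bsub>M\<^esub> z) = x \<otimes>\<^bsub>M\<^esub> y \<oplus>\<^bsub>M\<^esub> x \<otimes>\<^bsub>M\<^esub> z) \<and>
    (\<forall>x. x \<oplus>\<^bsub>M\<^esub> \<zero>\<^bsub>M\<^esub> = x) \<and>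
    (\<forall>x. x \<otimes>\<^bsub>M\<^esub> \<zero>\<^bsub>M\<^esub> = \<zero>\<^bsub>M\<^esub>) \<and>
    (\<forall>x. x \<otimes>\<^bsub>M\<^esub> \<one>\<^bsub>M\<^esub> = x) \<and>
    (\<forall>x. \<not> x \<sqsubset>\<^bsub>M\<^esub> x) \<and>
    (\<forall>x y z. x \<sqsubset>\<^bsub>M\<^esub> y \<longrightarrow> y \<sqsubset>\<^bsub>M\<^esub> z \<longrightarrow> x \<sqsubset>\<^bsub>M\<^esub> z) \<and>
    (\<forall>x y. x \<sqsubset>\<^bsub>M\<^esub> y \<or> x = y \<or> y \<sqsubset>\<^bsub>M\<^esub> x) \<and>
    (\<forall>x y z. x \<sqsubset>\<^bsub>M\<^esub> y \<longrightarrow> x \<oplus>\<^bsub>M\<^esub> z \<sqsubset>\<^bsub>M\<^esub> y \<oplus>\<^bsub>M\<^esub> z) \<and>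
    (\<forall>x y z. \<zero>\<^bsub>M\<^esub> \<sqsubset>\<^bsub>M\<^esub> z \<longrightarrow> x \<sqsubset>\<^bsub>M\<^esub> y \<longrightarrow> x \<otimes>\<^bsub>M\<^esub> z \<sqsubset>\<^bsub>M\<^esub> y \<otimes>\<^bsub>M\<^esub> z) \<and>
    (\<forall>x y. x \<sqsubset>\<^bsub>M\<^esub> y \<longrightarrow> (\<exists>z. x \<oplus>\<^bsub>M\<^esub> z = y)) \<and>
    \<zero>\<^bsub>M\<^esub> \<sqsubset>\<^bsub>M\<^esub> \<one>\<^bsub>M\<^esub> \<and>
    (\<forall>x. \<zero>\<^bsub>M\<^esub> \<sqsubset>\<^bsub>M\<^esub> x \<longrightarrow> x = \<one>\<^bsub>M\<^esub> \<or> \<one>\<^bsub>M\<^esub> \<sqsubset>\<^bsub>M\<^esub> x) \<and>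
    (\<forall>x. x = \<zero>\<^bsub>M\<^esub> \<or> \<zero>\<^bsub>M\<^esub> \<sqsubset>\<^bsub>M\<^esub> x)"

datatype l2_term = TVar nat | TZero | TOne | TPlus l2_term l2_term | TTimes l2_term l2_term

primrec eval :: "'a l2_structure \<Rightarrow> (nat \<Rightarrow> 'a) \<Rightarrow> l2_term \<Rightarrow> 'a"
  where
    "eval M e (TVar i) = e i"
  | "eval M e TZero = \<zero>\<^bsub>M\<^esub>"
  | "eval M e TOne = \<one>\<^bsub>M\<^esub>"
  | "eval M e (TPlus s t) = eval M e s \<oplus>\<^bsub>M\<^esub> eval M e t"
  | "eval M e (TTimes s t) = eval M e s \<otimes>\<^bsub>M\<^esub> eval M e t"

text \<open>
  The \<open>\<Sigma>\<^sup>0\<^sub>0\<close> formulas of second order arithmetic: \<open>FMem t i\<close> says that the value of \<open>t\<close> is a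
  member of the \<open>i\<close>-th set variable, and \<open>FAll i t \<phi>\<close> is the bounded quantification
  \<open>\<forall>x\<^sub>i < t. \<phi>\<close>, whose bound \<open>t\<close> is evaluated outside the scope of the quantifier.
\<close>

datatype bounded_fm =
    FEq l2_term l2_term
  | FLess l2_term l2_term
  | FMem l2_term nat
  | FNot bounded_fm
  | FAnd bounded_fm bounded_fm
  | FAll nat l2_term bounded_fm

primrec sat :: "'a l2_structure \<Rightarrow> (nat \<Rightarrow> 'a) \<Rightarrow> (nat \<Rightarrow> 'a set) \<Rightarrow> bounded_fm \<Rightarrow> bool"
  where
    "sat M e E (FEq s t) \<longleftrightarrow> eval M e s = eval M e t"
  | "sat M e E (FLess s t) \<longleftrightarrow> eval M e s \<sqsubset>\<^bsub>M\<^esub> eval M e t"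
  | "sat M e E (FMem t i) \<longleftrightarrow> eval M e t \<in> E i"
  | "sat M e E (FNot \<phi>) \<longleftrightarrow> \<not> sat M e E \<phi>"
  | "sat M e E (FAnd \<phi> \<psi>) \<longleftrightarrow> sat M e E \<phi> \<and> sat M e E \<psi>"
  | "sat M e E (FAll i t \<phi>) \<longleftrightarrow> (\<forall>a. a \<sqsubset>\<^bsub>M\<^esub> eval M e t \<longrightarrow> sat M (e(i := a)) E \<phi>)"

text \<open>Satisfaction of the \<open>\<Sigma>\<^sup>0\<^sub>1\<close> formula \<open>\<exists>x\<^sub>i. \<phi>\<close> and of the \<open>\<Pi>\<^sup>0\<^sub>1\<close> formula \<open>\<forall>x\<^sub>i. \<phi>\<close>.\<close>

definition sat_Sigma1 ::
    "'a l2_structure \<Rightarrow> (nat \<Rightarrow> 'a) \<Rightarrow> (nat \<Rightarrow> 'a set) \<Rightarrow> nat \<Rightarrow> bounded_fm \<Rightarrow> bool"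
  where "sat_Sigma1 M e E i \<phi> \<longleftrightarrow> (\<exists>a. sat M (e(i := a)) E \<phi>)"

definition sat_Pi1 ::
    "'a l2_structure \<Rightarrow> (nat \<Rightarrow> 'a) \<Rightarrow> (nat \<Rightarrow> 'a set) \<Rightarrow> nat \<Rightarrow> bounded_fm \<Rightarrow> bool"
  where "sat_Pi1 M e E i \<phi> \<longleftrightarrow> (\<forall>a. sat M (e(i := a)) E \<phi>)"

text \<open>The environments \<open>e\<close> and \<open>E\<close> supply the number and set parameters of the two schemes.\<close>

definition Sigma1_induction :: "'a l2_structure \<Rightarrow> bool"
  where "Sigma1_induction M \<longleftrightarrow>
    (\<forall>e E x i \<phi>. range E \<subseteq> Sets M \<longrightarrow>
      sat_Sigma1 M (e(x := \<zero>\<^bsub>M\<^esub>)) E i \<phi> \<longrightarrow>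
      (\<forall>a. sat_Sigma1 M (e(x := a)) E i \<phi> \<longrightarrow> sat_Sigma1 M (e(x := a \<oplus>\<^bsub>M\<^esub> \<one>\<^bsub>M\<^esub>)) E i \<phi>) \<longrightarrow>
      (\<forall>a. sat_Sigma1 M (e(x := a)) E i \<phi>))"

definition Delta1_comprehension :: "'a l2_structure \<Rightarrow> bool"
  where "Delta1_comprehension M \<longleftrightarrow>
    (\<forall>e E x i \<phi> j \<psi>. range E \<subseteq> Sets M \<longrightarrow>
      (\<forall>a. sat_Sigma1 M (e(x := a)) E i \<phi> \<longleftrightarrow> sat_Pi1 M (e(x := a)) E j \<psi>) \<longrightarrow>
      (\<exists>X\<in>Sets M. \<forall>a. a \<in> X \<longleftrightarrow> sat_Sigma1 M (e(x := a)) E i \<phi>))"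

text \<open>As usual in first-order semantics, the range of the set variables must be nonempty.\<close>

definition RCA0 :: "'a l2_structure \<Rightarrow> bool"
  where "RCA0 M \<longleftrightarrow>
    Sets M \<noteq> {} \<and> ordered_semiring M \<and> Sigma1_induction M \<and> Delta1_comprehension M"

primrec numeral_of :: "'a l2_structure \<Rightarrow> nat \<Rightarrow> 'a"
  where
    "numeral_of M 0 = \<zero>\<^bsub>M\<^esub>"
  | "numeral_of M (Suc n) = numeral_of M n \<oplus>\<^bsub>M\<^esub> \<one>\<^bsub>M\<^esub>"


section \<open>Coding of pairs, relations, families and finite sequences\<close>

text \<open>Simpson's pairing \<open>(x, y) = (x + y)\<^sup>2 + x\<close>, injective but not surjective.\<close>

definition pair :: "'a l2_structure \<Rightarrow> 'a \<Rightarrow> 'a \<Rightarrow> 'a"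
  where "pair M x y = (x \<oplus>\<^bsub>M\<^esub> y) \<otimes>\<^bsub>M\<^esub> (x \<oplus>\<^bsub>M\<^esub> y) \<oplus>\<^bsub>M\<^esub> x"

definition rel :: "'a l2_structure \<Rightarrow> 'a set \<Rightarrow> 'a rel"
  where "rel M R = {(x, y). pair M x y \<in> R}"

text \<open>A family of sets (indexed by numbers of \<open>M\<close>) is coded by a single set of \<open>M\<close>.\<close>

definition fiber :: "'a l2_structure \<Rightarrow> 'a set \<Rightarrow> 'a \<Rightarrow> 'a set"
  where "fiber M F i = {x. pair M i x \<in> F}"

definition divides :: "'a l2_structure \<Rightarrow> 'a \<Rightarrow> 'a \<Rightarrow> bool"
  where "divides M a b \<longleftrightarrow> (\<exists>c. b = a \<otimes>\<^bsub>M\<^esub> c)"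

text \<open>
  Simpson's coding of finite sets: the triple \<open>(k, (m, n))\<close> represents
  \<open>{x. x < k \<and> m (x + 1) + 1 divides n}\<close>, and the code of a finite set is its least
  representative.  Numbers that are not triples represent the empty set here; they are not
  codes, since \<open>0 = (0, (0, 0))\<close> also does.
\<close>

definition fset :: "'a l2_structure \<Rightarrow> 'a \<Rightarrow> 'a set"
  where "fset M s = {x. \<exists>k m n. s = pair M k (pair M m n) \<and> x \<sqsubset>\<^bsub>M\<^esub> k \<and>
    divides M (m \<otimes>\<^bsub>M\<^esub> (x \<oplus>\<^bsub>M\<^esub> \<one>\<^bsub>M\<^esub>) \<oplus>\<^bsub>M\<^esub> \<one>\<^bsub>M\<^esub>) n}"

definition fset_code :: "'a l2_structure \<Rightarrow> 'a \<Rightarrow> bool"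
  where "fset_code M s \<longleftrightarrow> (\<forall>t. t \<sqsubset>\<^bsub>M\<^esub> s \<longrightarrow> fset M t \<noteq> fset M s)"

text \<open>\<open>s\<close> codes (the graph of) a function from \<open>{i. i < l}\<close> to \<open>{0, 1}\<close>.\<close>

definition binary_seq :: "'a l2_structure \<Rightarrow> 'a \<Rightarrow> 'a \<Rightarrow> bool"
  where "binary_seq M s l \<longleftrightarrow> fset_code M s \<and>
    (\<forall>z\<in>fset M s. \<exists>i. i \<sqsubset>\<^bsub>M\<^esub> l \<and> (z = pair M i \<zero>\<^bsub>M\<^esub> \<or> z = pair M i \<one>\<^bsub>M\<^esub>)) \<and>
    (\<forall>i. i \<sqsubset>\<^bsub>M\<^esub> l \<longrightarrow> (pair M i \<zero>\<^bsub>M\<^esub> \<in> fset M s) \<noteq> (pair M i \<one>\<^bsub>M\<^esub> \<in> fset M s))"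


section \<open>Weak Koenig's lemma\<close>

text \<open>For binary sequences, being an initial segment is inclusion of graphs.\<close>

definition binary_tree :: "'a l2_structure \<Rightarrow> 'a set \<Rightarrow> bool"
  where "binary_tree M T \<longleftrightarrow>
    (\<forall>s\<in>T. \<exists>l. binary_seq M s l) \<and>
    (\<forall>s\<in>T. \<forall>t l. binary_seq M t l \<longrightarrow> fset M t \<subseteq> fset M s \<longrightarrow> t \<in> T)"

definition infinite_in :: "'a l2_structure \<Rightarrow> 'a set \<Rightarrow> bool"
  where "infinite_in M X \<longleftrightarrow> (\<forall>k. \<exists>x\<in>X. k \<sqsubset>\<^bsub>M\<^esub> x)"

text \<open>\<open>F\<close> is the graph of a function from numbers to \<open>{0, 1}\<close>, all of whose initial segments lie in \<open>T\<close>.\<close>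

definition infinite_path :: "'a l2_structure \<Rightarrow> 'a set \<Rightarrow> 'a set \<Rightarrow> bool"
  where "infinite_path M T F \<longleftrightarrow>
    (\<forall>z\<in>F. \<exists>i. z = pair M i \<zero>\<^bsub>M\<^esub> \<or> z = pair M i \<one>\<^bsub>M\<^esub>) \<and>
    (\<forall>i. (pair M i \<zero>\<^bsub>M\<^esub> \<in> F) \<noteq> (pair M i \<one>\<^bsub>M\<^esub> \<in> F)) \<and>
    (\<forall>l. \<exists>s\<in>T. binary_seq M s l \<and> fset M s \<subseteq> F)"

definition WKL :: "'a l2_structure \<Rightarrow> bool"
  where "WKL M \<longleftrightarrow>
    (\<forall>T\<in>Sets M. binary_tree M T \<longrightarrow> infinite_in M T \<longrightarrow> (\<exists>F\<in>Sets M. infinite_path M T F))"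


section \<open>Dimension of posets\<close>

definition linearization :: "'a set \<Rightarrow> 'a rel \<Rightarrow> 'a rel \<Rightarrow> bool"
  where "linearization P r l \<longleftrightarrow> linear_order_on P l \<and> r \<subseteq> l"

definition realization :: "'a l2_structure \<Rightarrow> 'a set \<Rightarrow> 'a rel \<Rightarrow> 'a \<Rightarrow> 'a set \<Rightarrow> bool"
  where "realization M P r m L \<longleftrightarrow>
    (\<forall>i. i \<sqsubset>\<^bsub>M\<^esub> m \<longrightarrow> linearization P r (rel M (fiber M L i))) \<and>
    (\<Inter>i\<in>{i. i \<sqsubset>\<^bsub>M\<^esub> m}. rel M (fiber M L i)) = r"

text \<open>\<open>dim_le M P p Q q k\<close> stands for \<open>dim (P, p) \<le> dim (Q, q) + k\<close>.\<close>

definition dim_le ::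
    "'a l2_structure \<Rightarrow> 'a set \<Rightarrow> 'a rel \<Rightarrow> 'a set \<Rightarrow> 'a rel \<Rightarrow> 'a \<Rightarrow> bool"
  where "dim_le M P p Q q k \<longleftrightarrow>
    (\<forall>m. m \<noteq> \<zero>\<^bsub>M\<^esub> \<longrightarrow>
      (\<forall>L\<in>Sets M. realization M Q q m L \<longrightarrow> (\<exists>K\<in>Sets M. realization M P p (m \<oplus>\<^bsub>M\<^esub> k) K)))"

definition chain_in :: "'a set \<Rightarrow> 'a rel \<Rightarrow> 'a set \<Rightarrow> bool"
  where "chain_in P r C \<longleftrightarrow> C \<subseteq> P \<and> C \<in> Chains r"

definition incomparable :: "'a rel \<Rightarrow> 'a set \<Rightarrow> 'a set \<Rightarrow> bool"
  where "incomparable r Y Z \<longleftrightarrow> (\<forall>y\<in>Y. \<forall>z\<in>Z. (y, z) \<notin> r \<and> (z, y) \<notin> r)"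

definition remove_family :: "'a l2_structure \<Rightarrow> 'a set \<Rightarrow> 'a set \<Rightarrow> 'a \<Rightarrow> 'a set"
  where "remove_family M P C n = P - (\<Union>i\<in>{i. i \<sqsubset>\<^bsub>M\<^esub> n}. fiber M C i)"

definition max2 :: "'a l2_structure \<Rightarrow> 'a \<Rightarrow> 'a"
  where "max2 M n = (if n \<sqsubset>\<^bsub>M\<^esub> numeral_of M 2 then numeral_of M 2 else n)"

definition DBi :: "'a l2_structure \<Rightarrow> 'a \<Rightarrow> bool"
  where "DBi M n \<longleftrightarrow>
    (\<forall>P\<in>Sets M. \<forall>R\<in>Sets M. \<forall>C\<in>Sets M.
      partial_order_on P (rel M R) \<longrightarrow>
      (\<forall>i. i \<sqsubset>\<^bsub>M\<^esub> n \<longrightarrow> chain_in P (rel M R) (fiber M C i)) \<longrightarrow>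
      (\<forall>i j. i \<sqsubset>\<^bsub>M\<^esub> n \<longrightarrow> j \<sqsubset>\<^bsub>M\<^esub> n \<longrightarrow> i \<noteq> j \<longrightarrow>
        incomparable (rel M R) (fiber M C i) (fiber M C j)) \<longrightarrow>
      (let Q = remove_family M P C n
       in dim_le M P (rel M R) Q (Restr (rel M R) Q) (max2 M n)))"

definition DBc :: "'a l2_structure \<Rightarrow> 'a \<Rightarrow> bool"
  where "DBc M n \<longleftrightarrow>
    (\<forall>P\<in>Sets M. \<forall>R\<in>Sets M. \<forall>C\<in>Sets M.
      partial_order_on P (rel M R) \<longrightarrow>
      (\<forall>i. i \<sqsubset>\<^bsub>M\<^esub> n \<longrightarrow> chain_in P (rel M R) (fiber M C i)) \<longrightarrow>
      (let Q = remove_family M P C n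
       in dim_le M P (rel M R) Q (Restr (rel M R) Q) (numeral_of M 2 \<otimes>\<^bsub>M\<^esub> n)))"

end

theory Submission
  imports Defs
begin

text \<open>
  From \<open>DBi\<close> and \<open>DBc\<close> to \<open>WKL\<close>: a standard example in which one pair is replaced by an infinite
  chain \<open>C\<close> and infinitely many points realizes its maximal dimension so tightly that exactly one
  linear order of a realization can reverse the incomparabilities between \<open>C\<close> and the points.
  These incomparabilities code two disjoint \<open>\<Sigma>\<^sup>0\<^sub>1\<close> sets, so that linear order computes a set
  separating them, and \<open>\<Sigma>\<^sup>0\<^sub>1\<close> separation gives weak Koenig's lemma.

  From \<open>WKL\<close> to \<open>DBi\<close> and \<open>DBc\<close>: each given linear order of the remaining poset extends to the
  whole poset, and further linear orders put one chain as low as possible and another one as high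
  as possible.  All the partial orders to be linearized are unions of increasing sequences of
  uniformly decidable partial orders; these have definable linear extensions, so weak Koenig's
  lemma provides linear extensions of the unions, for all indices at once.
\<close>

section \<open>Arithmetic in a model\<close>

text \<open>Only \<open>\<Delta>\<^sup>0\<^sub>1\<close> definable sets are guaranteed to exist in
  \<open>M\<close>, and only \<open>\<Sigma>\<^sup>0\<^sub>1\<close> induction is assumed. The
  orders to be linearized ask for an unbounded witness, so they are
  \<open>\<Sigma>\<^sup>0\<^sub>1\<close> and need not belong to \<open>M\<close>; bounding the
  witness by a stage yields the decidable approximations. As \<open>n\<close> may be nonstandard,
  the linear orders cannot be chosen one after another.

  The number of added orders comes from what each can do: every removed point must be pushed down in
  one order and up in one order, and a single order can serve one chain downwards and a second one,
  incomparable with the first, upwards. Arranged in a cycle, \<open>n \<ge> 2\<close> incomparable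
  chains need \<open>n\<close> orders; arbitrary chains get two orders each.

  Conversely, the removed chains leave exactly two pairs of the standard example intact, so two
  orders realize the rest. The number \<open>K\<close> of pairs is chosen such that the principle
  then gives \<open>K + 1\<close> orders for the whole poset: the pairs use up \<open>K\<close> of
  them, and one is left for the infinite chain.\<close>

locale rca =
  fixes M :: "'a l2_structure" (structure)
  assumes RCA0: "RCA0 M"
begin

definition le :: "'a \<Rightarrow> 'a \<Rightarrow> bool"  (infix "\<sqsubseteq>" 50)
  where "x \<sqsubseteq> y \<longleftrightarrow> x \<sqsubset> y \<or> x = y"

text \<open>Truncated subtraction is here only because the library structure interpreted below has a
  subtraction operation among its parameters.\<close>

definition monus :: "'a \<Rightarrow> 'a \<Rightarrow> 'a"
  where "monus x y = (if y \<sqsubseteq> x then THE z. y \<oplus> z = x else \<zero>)"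

lemma osr: "ordered_semiring M"
  using RCA0 by (simp add: RCA0_def)

lemma plus_assoc: "(x \<oplus> y) \<oplus> z = x \<oplus> (y \<oplus> z)"
  and plus_comm: "x \<oplus> y = y \<oplus> x"
  and times_assoc: "(x \<otimes> y) \<otimes> z = x \<otimes> (y \<otimes> z)"
  and times_comm: "x \<otimes> y = y \<otimes> x"
  and times_plus: "x \<otimes> (y \<oplus> z) = x \<otimes> y \<oplus> x \<otimes> z"
  and plus_zero: "x \<oplus> \<zero> = x"
  and times_zero: "x \<otimes> \<zero> = \<zero>"
  and times_one: "x \<otimes> \<one> = x"
  and less_irrefl: "\<not> x \<sqsubset> x"
  and less_trans: "x \<sqsubset> y \<Longrightarrow> y \<sqsubset> z \<Longrightarrow> x \<sqsubset> z"
  and less_total: "x \<sqsubset> y \<or> x = y \<or> y \<sqsubset> x"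
  and plus_less_mono: "x \<sqsubset> y \<Longrightarrow> x \<oplus> z \<sqsubset> y \<oplus> z"
  and times_less_mono: "\<zero> \<sqsubset> z \<Longrightarrow> x \<sqsubset> y \<Longrightarrow> x \<otimes> z \<sqsubset> y \<otimes> z"
  and less_imp_plus: "x \<sqsubset> y \<Longrightarrow> \<exists>z. x \<oplus> z = y"
  and zero_less_one: "\<zero> \<sqsubset> \<one>"
  and discrete: "\<zero> \<sqsubset> x \<Longrightarrow> x = \<one> \<or> \<one> \<sqsubset> x"
  and zero_or_pos: "x = \<zero> \<or> \<zero> \<sqsubset> x"
  by (metis osr[unfolded ordered_semiring_def])+

lemma plus_cancel: "x \<oplus> y = x \<oplus> z \<longleftrightarrow> y = z"
  by (metis less_irrefl less_total plus_comm plus_less_mono)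

lemma le_iff_plus: "x \<sqsubseteq> y \<longleftrightarrow> (\<exists>z. y = x \<oplus> z)"
proof
  show "x \<sqsubseteq> y \<Longrightarrow> \<exists>z. y = x \<oplus> z"
    unfolding le_def by (metis less_imp_plus plus_zero)
  show "\<exists>z. y = x \<oplus> z \<Longrightarrow> x \<sqsubseteq> y"
    unfolding le_def by (metis plus_comm plus_less_mono plus_zero zero_or_pos)
qed

lemma monus_plus: "monus (x \<oplus> y) x = y"
proof -
  have "x \<sqsubseteq> x \<oplus> y" by (auto simp: le_iff_plus)
  then show ?thesis by (simp add: monus_def plus_cancel)
qed

lemma monus_not_le: "\<not> y \<sqsubseteq> x \<Longrightarrow> monus x y = \<zero>"
  by (simp add: monus_def)

lemma monus_monus: "monus (monus x y) z = monus x (y \<oplus> z)"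
proof (cases "y \<sqsubseteq> x")
  case True
  then obtain u where u: "x = y \<oplus> u" by (auto simp: le_iff_plus)
  show ?thesis
  proof (cases "z \<sqsubseteq> u")
    case True
    then obtain v where "u = z \<oplus> v" by (auto simp: le_iff_plus)
    then show ?thesis by (metis u monus_plus plus_assoc)
  next
    case False
    then have "\<not> y \<oplus> z \<sqsubseteq> x" by (metis u le_iff_plus plus_assoc plus_cancel)
    with False show ?thesis by (simp add: u monus_plus monus_not_le)
  qed
next
  case False
  then have "\<not> y \<oplus> z \<sqsubseteq> x" by (metis le_iff_plus plus_assoc)
  moreover have "monus \<zero> z = \<zero>"
    by (metis le_iff_plus monus_not_le monus_plus plus_comm plus_zero le_def less_trans less_irrefl zero_or_pos)
  ultimately show ?thesis using False by (simp add: monus_not_le)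
qed

lemma times_monus: "x \<otimes> monus y z = monus (x \<otimes> y) (x \<otimes> z)"
proof (cases "z \<sqsubseteq> y")
  case True
  then obtain u where "y = z \<oplus> u" by (auto simp: le_iff_plus)
  then show ?thesis by (simp add: monus_plus times_plus)
next
  case False
  then have yz: "y \<sqsubset> z" using less_total le_def by blast
  show ?thesis
  proof (cases "x = \<zero>")
    case True
    then show ?thesis by (metis monus_plus plus_zero times_comm times_zero)
  next
    case False
    then have "y \<otimes> x \<sqsubset> z \<otimes> x" using yz times_less_mono zero_or_pos by blast
    then have "\<not> x \<otimes> z \<sqsubseteq> x \<otimes> y"
      using less_irrefl less_trans le_def by (metis times_comm)
    then show ?thesis using \<open>\<not> z \<sqsubseteq> y\<close> by (simp add: monus_not_le times_zero)
  qed
qed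

text \<open>This makes the library's arithmetic of ordered semidomains available for the numbers of
  \<open>M\<close>, under the prefix \<open>ar\<close>.\<close>

sublocale ar: discrete_linordered_semidom "Plus M" monus le "Less M" "Zero M" "Times M" "One M"
proof
  fix a b c :: 'a
  show "a \<otimes> b \<otimes> c = a \<otimes> (b \<otimes> c)" by (rule times_assoc)
  show "a \<otimes> b = b \<otimes> a" by (rule times_comm)
  show "a \<oplus> b \<oplus> c = a \<oplus> (b \<oplus> c)" by (rule plus_assoc)
  show "a \<oplus> b = b \<oplus> a" by (rule plus_comm)
  show "(a \<oplus> b) \<otimes> c = a \<otimes> c \<oplus> b \<otimes> c" by (metis times_comm times_plus)
  show "monus (a \<oplus> b) a = b" by (rule monus_plus)
  show "monus (monus a b) c = monus a (b \<oplus> c)" by (rule monus_monus)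
  show "\<zero> \<otimes> a = \<zero>" by (metis times_comm times_zero)
  show "a \<otimes> \<zero> = \<zero>" by (rule times_zero)
  show "a \<otimes> (b \<oplus> c) = a \<otimes> b \<oplus> a \<otimes> c" by (rule times_plus)
  show "\<zero> \<oplus> a = a" by (metis plus_comm plus_zero)
  show "\<zero> \<noteq> \<one>" using zero_less_one less_irrefl by metis
  show "\<one> \<otimes> a = a" by (metis times_comm times_one)
  show "a \<otimes> monus b c = monus (a \<otimes> b) (a \<otimes> c)" by (rule times_monus)
  show "a \<noteq> \<zero> \<Longrightarrow> b \<noteq> \<zero> \<Longrightarrow> a \<otimes> b \<noteq> \<zero>"
    by (metis less_irrefl times_comm times_less_mono times_zero zero_or_pos)
  show "(a \<sqsubset> b) = (a \<sqsubseteq> b \<and> \<not> b \<sqsubseteq> a)" unfolding le_def by (metis less_irrefl less_trans)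
  show "a \<sqsubseteq> a" by (simp add: le_def)
  show "a \<sqsubseteq> b \<Longrightarrow> b \<sqsubseteq> c \<Longrightarrow> a \<sqsubseteq> c" unfolding le_def by (metis less_trans)
  show "a \<sqsubseteq> b \<Longrightarrow> b \<sqsubseteq> a \<Longrightarrow> a = b" unfolding le_def by (metis less_irrefl less_trans)
  show "a \<sqsubseteq> b \<or> b \<sqsubseteq> a" unfolding le_def by (metis less_total)
  show "a \<sqsubseteq> b \<Longrightarrow> c \<oplus> a \<sqsubseteq> c \<oplus> b" by (metis le_iff_plus plus_assoc)
  show "a \<sqsubset> b \<Longrightarrow> \<zero> \<sqsubset> c \<Longrightarrow> c \<otimes> a \<sqsubset> c \<otimes> b" by (metis times_comm times_less_mono)
  show "\<zero> \<sqsubset> \<one>" by (rule zero_less_one)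
  show "b \<sqsubseteq> a \<Longrightarrow> monus a b \<oplus> b = a" by (metis le_iff_plus monus_plus plus_comm)
  show "(a \<sqsubset> b) = (a \<oplus> \<one> \<sqsubseteq> b)"
  proof
    assume "a \<sqsubset> b"
    then obtain z where z: "b = a \<oplus> z" "z \<noteq> \<zero>" by (metis less_imp_plus less_irrefl plus_zero)
    then have "\<one> \<sqsubseteq> z" unfolding le_def by (metis discrete zero_or_pos)
    then show "a \<oplus> \<one> \<sqsubseteq> b" using z by (metis le_iff_plus plus_assoc)
  next
    assume "a \<oplus> \<one> \<sqsubseteq> b"
    moreover have "a \<sqsubset> a \<oplus> \<one>" by (metis plus_comm plus_less_mono plus_zero zero_less_one)
    ultimately show "a \<sqsubset> b" unfolding le_def by (metis less_trans)
  qed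
qed

lemma zero_le [simp]: "\<zero> \<sqsubseteq> x"
  by (simp add: le_iff_plus)

lemma le_plus1 [simp]: "x \<sqsubseteq> x \<oplus> y"
  by (auto simp: le_iff_plus)

lemma le_plus2 [simp]: "x \<sqsubseteq> y \<oplus> x"
  by (metis le_plus1 plus_comm)

lemma not_less_zero [simp]: "\<not> x \<sqsubset> \<zero>"
  by (simp add: ar.not_less)

lemma le_zero [simp]: "x \<sqsubseteq> \<zero> \<longleftrightarrow> x = \<zero>"
  by (auto simp: le_def)

lemma less_Suc: "x \<sqsubset> y \<oplus> \<one> \<longleftrightarrow> x \<sqsubseteq> y"
  by (simp add: ar.less_eq_iff_succ_less)

lemma less_Suc_self [simp]: "x \<sqsubset> x \<oplus> \<one>"
  by (simp add: less_Suc)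

lemma pred_ex: "x \<noteq> \<zero> \<Longrightarrow> \<exists>y. x = y \<oplus> \<one>"
  by (metis ar.less_iff_succ_less_eq le_iff_plus plus_comm plus_zero zero_or_pos)

end

section \<open>Definability\<close>

primrec rename_term :: "(nat \<Rightarrow> nat) \<Rightarrow> l2_term \<Rightarrow> l2_term"
  where
    "rename_term \<rho> (TVar i) = TVar (\<rho> i)"
  | "rename_term \<rho> TZero = TZero"
  | "rename_term \<rho> TOne = TOne"
  | "rename_term \<rho> (TPlus s t) = TPlus (rename_term \<rho> s) (rename_term \<rho> t)"
  | "rename_term \<rho> (TTimes s t) = TTimes (rename_term \<rho> s) (rename_term \<rho> t)"

primrec rename_fm :: "(nat \<Rightarrow> nat) \<Rightarrow> (nat \<Rightarrow> nat) \<Rightarrow> bounded_fm \<Rightarrow> bounded_fm"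
  where
    "rename_fm \<rho> \<sigma> (FEq s t) = FEq (rename_term \<rho> s) (rename_term \<rho> t)"
  | "rename_fm \<rho> \<sigma> (FLess s t) = FLess (rename_term \<rho> s) (rename_term \<rho> t)"
  | "rename_fm \<rho> \<sigma> (FMem t i) = FMem (rename_term \<rho> t) (\<sigma> i)"
  | "rename_fm \<rho> \<sigma> (FNot \<phi>) = FNot (rename_fm \<rho> \<sigma> \<phi>)"
  | "rename_fm \<rho> \<sigma> (FAnd \<phi> \<psi>) = FAnd (rename_fm \<rho> \<sigma> \<phi>) (rename_fm \<rho> \<sigma> \<psi>)"
  | "rename_fm \<rho> \<sigma> (FAll i t \<phi>) = FAll (\<rho> i) (rename_term \<rho> t) (rename_fm \<rho> \<sigma> \<phi>)"

lemma eval_rename: "eval M e (rename_term \<rho> t) = eval M (e \<circ> \<rho>) t"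
  by (induction t) auto

text \<open>Injectivity of \<open>\<rho>\<close> keeps a bound variable from being identified with
  another one. Set variables are never bound, so \<open>\<sigma>\<close> may be arbitrary.\<close>

lemma sat_rename:
  assumes "inj \<rho>"
  shows "sat M e E (rename_fm \<rho> \<sigma> \<phi>) = sat M (e \<circ> \<rho>) (E \<circ> \<sigma>) \<phi>"
proof (induction \<phi> arbitrary: e)
  case (FAll i t \<phi>)
  have upd: "(e(\<rho> i := a)) \<circ> \<rho> = (e \<circ> \<rho>)(i := a)" for a
    using assms by (auto simp: fun_eq_iff inj_eq)
  show ?case
    by (simp only: rename_fm.simps sat.simps eval_rename FAll.IH upd)
qed (simp_all only: rename_fm.simps sat.simps eval_rename o_apply)

definition interleave :: "(nat \<Rightarrow> 'b) \<Rightarrow> (nat \<Rightarrow> 'b) \<Rightarrow> nat \<Rightarrow> 'b"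
  where "interleave f g n = (if even n then f (n div 2) else g (n div 2))"

text \<open>\<open>odd_left\<close> and \<open>odd_right\<close> keep the even variables and send
  the parameter variable \<open>2k+1\<close> to \<open>4k+1\<close> and \<open>4k+3\<close>, the two
  halves of an interleaved parameter sequence. Thus two formulas with different parameters can share
  one environment.\<close>

definition odd_left :: "nat \<Rightarrow> nat"
  where "odd_left n = (if even n then n else 2 * n - 1)"

definition odd_right :: "nat \<Rightarrow> nat"
  where "odd_right n = (if even n then n else 2 * n + 1)"

text \<open>Prepares the binding of variable 0: it goes to the odd variable 1, the other even
  variables move down by 2 as de Bruijn indices do, and the parameter \<open>2k+1\<close> goes to
  \<open>4k+5\<close>, so that variable 1 and the positions \<open>4k+3\<close> of
  \<open>odd_right\<close> stay free.\<close>

definition odd_far :: "nat \<Rightarrow> nat"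
  where "odd_far n = (if n = 0 then 1 else if even n then n - 2 else 2 * n + 3)"

lemma interleave_odd_left: "interleave e (interleave p q) \<circ> odd_left = interleave e p"
proof
  fix n show "(interleave e (interleave p q) \<circ> odd_left) n = interleave e p n"
  proof (cases "even n")
    case False
    then obtain k where "n = 2 * k + 1" by (elim oddE)
    then show ?thesis by (simp add: interleave_def odd_left_def)
  qed (simp add: interleave_def odd_left_def)
qed

lemma interleave_odd_right: "interleave e (interleave p q) \<circ> odd_right = interleave e q"
proof
  fix n show "(interleave e (interleave p q) \<circ> odd_right) n = interleave e q n"
  proof (cases "even n")
    case False
    then obtain k where "n = 2 * k + 1" by (elim oddE)
    then show ?thesis by (simp add: interleave_def odd_right_def)
  qed (simp add: interleave_def odd_right_def)
qed

lemma interleave_binder_term: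
  "interleave e (case_nat z (interleave p q)) \<circ> odd_right = interleave e p"
proof
  fix n show "(interleave e (case_nat z (interleave p q)) \<circ> odd_right) n = interleave e p n"
  proof (cases "even n")
    case False
    then obtain k where "n = 2 * k + 1" by (elim oddE)
    then show ?thesis by (simp add: interleave_def odd_right_def)
  qed (simp add: interleave_def odd_right_def)
qed

lemma interleave_binder_fm:
  "(interleave e (case_nat z (interleave p q)))(1 := a) \<circ> odd_far = interleave (case_nat a e) q"
proof
  fix n
  show "((interleave e (case_nat z (interleave p q)))(1 := a) \<circ> odd_far) n
      = interleave (case_nat a e) q n"
  proof (cases "even n")
    case True
    then obtain k where k: "n = 2 * k" by (elim evenE)
    then show ?thesis by (cases k) (auto simp: interleave_def odd_far_def)
  next
    case False
    then obtain k where k: "n = 2 * k + 1" by (elim oddE)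
    then have "odd_far n = 2 * (2 * k + 2) + 1" by (simp add: odd_far_def)
    moreover have "Suc (2 * (2 * k + 2)) div 2 = Suc (Suc (2 * k))" by simp
    ultimately show ?thesis using k by (simp add: interleave_def)
  qed
qed

lemma inj_odd_left: "inj odd_left"
proof (rule injI)
  have parity: "even (odd_left n) \<longleftrightarrow> even n" for n
    by (cases n) (auto simp: odd_left_def)
  fix x y assume eq: "odd_left x = odd_left y"
  with parity[of x] parity[of y] have "even x = even y" by simp
  with eq show "x = y" by (cases x; cases y) (auto simp: odd_left_def split: if_splits)
qed

lemma inj_odd_right: "inj odd_right"
proof (rule injI)
  have parity: "even (odd_right n) \<longleftrightarrow> even n" for n
    by (auto simp: odd_right_def)
  fix x y assume eq: "odd_right x = odd_right y"
  with parity[of x] parity[of y] have "even x = even y" by simp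
  with eq show "x = y" by (auto simp: odd_right_def split: if_splits)
qed

lemma inj_odd_far: "inj odd_far"
proof (rule injI)
  have parity: "even (odd_far n) \<longleftrightarrow> even n \<and> n \<noteq> 0" for n
    by (auto simp: odd_far_def)
  have ge: "n \<noteq> 0 \<Longrightarrow> even n \<Longrightarrow> 2 \<le> n" for n :: nat by presburger
  fix x y assume eq: "odd_far x = odd_far y"
  with parity[of x] parity[of y] have *: "(even x \<and> x \<noteq> 0) = (even y \<and> y \<noteq> 0)" by simp
  show "x = y"
  proof (cases "even x \<and> x \<noteq> 0")
    case True
    with * eq ge[of x] ge[of y] show ?thesis by (simp add: odd_far_def)
  next
    case False
    with * eq show ?thesis by (auto simp: odd_far_def split: if_splits)
  qed
qed

lemma interleave_comp_even: "interleave f g \<circ> (\<lambda>i. 2 * i) = f"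
  by (auto simp: interleave_def)

lemma interleave_comp_odd: "interleave f g \<circ> (\<lambda>i. 2 * i + 1) = g"
  by (auto simp: interleave_def)

lemma range_interleave: "range f \<subseteq> A \<Longrightarrow> range g \<subseteq> A \<Longrightarrow> range (interleave f g) \<subseteq> A"
  by (auto simp: interleave_def)

context rca
begin

text \<open>
  \<open>term_def t\<close> and \<open>D0 S\<close> say that \<open>t\<close> and \<open>S\<close> are given by a term and a \<open>\<Sigma>\<^sup>0\<^sub>0\<close> formula, with
  parameters, whose free variables are the even ones; the odd variables hold the parameters.
  Variables are de Bruijn indices: under a quantifier the bound variable becomes \<open>e 0\<close> and
  the others are shifted.
\<close>

definition term_def :: "((nat \<Rightarrow> 'a) \<Rightarrow> 'a) \<Rightarrow> bool"
  where "term_def t \<longleftrightarrow> (\<exists>\<tau> p. \<forall>e. t e = eval M (interleave e p) \<tau>)"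

definition D0 :: "((nat \<Rightarrow> 'a) \<Rightarrow> bool) \<Rightarrow> bool"
  where "D0 S \<longleftrightarrow> (\<exists>\<phi> p E. range E \<subseteq> Sets M \<and> (\<forall>e. S e = sat M (interleave e p) E \<phi>))"

definition S1 :: "((nat \<Rightarrow> 'a) \<Rightarrow> bool) \<Rightarrow> bool"
  where "S1 S \<longleftrightarrow> (\<exists>Q. D0 Q \<and> (\<forall>e. S e \<longleftrightarrow> (\<exists>w. Q (case_nat w e))))"

lemma Sets_ex: "\<exists>E :: nat \<Rightarrow> 'a set. range E \<subseteq> Sets M"
proof -
  obtain X where "X \<in> Sets M" using RCA0 by (auto simp: RCA0_def)
  then have "range (\<lambda>_::nat. X) \<subseteq> Sets M" by auto
  then show ?thesis by (rule exI[of _ "\<lambda>_. X"])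
qed

lemma D0E:
  assumes "D0 S"
  obtains E p \<phi> where "range E \<subseteq> Sets M" "\<And>e. S e = sat M (interleave e p) E \<phi>"
  using assms by (auto simp: D0_def)

lemma term_defE:
  assumes "term_def t"
  obtains p \<tau> where "\<And>e. t e = eval M (interleave e p) \<tau>"
  using assms by (auto simp: term_def_def)

lemma S1E:
  assumes "S1 S"
  obtains Q where "D0 Q" "\<And>e. S e \<longleftrightarrow> (\<exists>w. Q (case_nat w e))"
  using assms by (auto simp: S1_def)

lemma term_var: "term_def (\<lambda>e. e i)"
  unfolding term_def_def
  by (intro exI[of _ "TVar (2 * i)"]) (simp add: interleave_def)

lemma term_const: "term_def (\<lambda>e. c)"
  unfolding term_def_def
  by (intro exI[of _ "TVar 1"] exI[of _ "\<lambda>_. c"]) (simp add: interleave_def)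

lemma term_pair:
  assumes "term_def s" "term_def t"
  obtains \<sigma> \<tau> p where "\<And>e. s e = eval M (interleave e p) \<sigma>" "\<And>e. t e = eval M (interleave e p) \<tau>"
proof -
  obtain \<sigma> p where 1: "\<And>e. s e = eval M (interleave e p) \<sigma>"
    by (rule term_defE[OF assms(1)]) (rule that)
  obtain \<tau> q where 2: "\<And>e. t e = eval M (interleave e q) \<tau>"
    by (rule term_defE[OF assms(2)]) (rule that)
  show ?thesis
    by (rule that[of "interleave p q" "rename_term odd_left \<sigma>" "rename_term odd_right \<tau>"])
      (simp_all add: 1 2 eval_rename interleave_odd_left interleave_odd_right)
qed

lemma term_plus: "term_def s \<Longrightarrow> term_def t \<Longrightarrow> term_def (\<lambda>e. s e \<oplus> t e)"
proof (erule (1) term_pair)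
  fix \<sigma> \<tau> p
  assume "\<And>e. s e = eval M (interleave e p) \<sigma>" "\<And>e. t e = eval M (interleave e p) \<tau>"
  then show ?thesis unfolding term_def_def
    by (intro exI[of _ "TPlus \<sigma> \<tau>"] exI[of _ p]) simp
qed

lemma term_times: "term_def s \<Longrightarrow> term_def t \<Longrightarrow> term_def (\<lambda>e. s e \<otimes> t e)"
proof (erule (1) term_pair)
  fix \<sigma> \<tau> p
  assume "\<And>e. s e = eval M (interleave e p) \<sigma>" "\<And>e. t e = eval M (interleave e p) \<tau>"
  then show ?thesis unfolding term_def_def
    by (intro exI[of _ "TTimes \<sigma> \<tau>"] exI[of _ p]) simp
qed

lemma term_pr: "term_def s \<Longrightarrow> term_def t \<Longrightarrow> term_def (\<lambda>e. pair M (s e) (t e))"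
  unfolding pair_def by (intro term_plus term_times)

lemma D0_eq: "term_def s \<Longrightarrow> term_def t \<Longrightarrow> D0 (\<lambda>e. s e = t e)"
proof (erule (1) term_pair)
  fix \<sigma> \<tau> p
  assume "\<And>e. s e = eval M (interleave e p) \<sigma>" "\<And>e. t e = eval M (interleave e p) \<tau>"
  then show ?thesis unfolding D0_def using Sets_ex
    by (intro exI[of _ "FEq \<sigma> \<tau>"] exI[of _ p]) simp
qed

lemma D0_less: "term_def s \<Longrightarrow> term_def t \<Longrightarrow> D0 (\<lambda>e. s e \<sqsubset> t e)"
proof (erule (1) term_pair)
  fix \<sigma> \<tau> p
  assume "\<And>e. s e = eval M (interleave e p) \<sigma>" "\<And>e. t e = eval M (interleave e p) \<tau>"
  then show ?thesis unfolding D0_def using Sets_ex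
    by (intro exI[of _ "FLess \<sigma> \<tau>"] exI[of _ p]) simp
qed

lemma D0_mem:
  assumes "term_def t" "A \<in> Sets M"
  shows "D0 (\<lambda>e. t e \<in> A)"
proof -
  obtain \<tau> p where "\<And>e. t e = eval M (interleave e p) \<tau>"
    by (rule term_defE[OF assms(1)]) (rule that)
  moreover have "range (\<lambda>_::nat. A) \<subseteq> Sets M" using assms(2) by auto
  ultimately show ?thesis unfolding D0_def
    by (intro exI[of _ "FMem \<tau> 0"] exI[of _ p] exI[of _ "\<lambda>_. A"]) simp
qed

lemma D0_not: "D0 S \<Longrightarrow> D0 (\<lambda>e. \<not> S e)"
proof -
  assume "D0 S"
  then obtain \<phi> p E where "range E \<subseteq> Sets M" "\<And>e. S e = sat M (interleave e p) E \<phi>"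
    by (rule D0E) (rule that)
  then show ?thesis unfolding D0_def
    by (intro exI[of _ "FNot \<phi>"] exI[of _ p] exI[of _ E]) simp
qed

lemma D0_pair:
  assumes "D0 S" "D0 T"
  obtains \<phi> \<psi> p E where "range E \<subseteq> Sets M"
    "\<And>e. S e = sat M (interleave e p) E \<phi>" "\<And>e. T e = sat M (interleave e p) E \<psi>"
proof -
  obtain \<phi> p E where 1: "range E \<subseteq> Sets M" "\<And>e. S e = sat M (interleave e p) E \<phi>"
    by (rule D0E[OF assms(1)]) (rule that)
  obtain \<psi> q F where 2: "range F \<subseteq> Sets M" "\<And>e. T e = sat M (interleave e q) F \<psi>"
    by (rule D0E[OF assms(2)]) (rule that)
  show ?thesis
  proof (rule that)
    show "range (interleave E F) \<subseteq> Sets M" by (rule range_interleave[OF 1(1) 2(1)])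
    show "S e = sat M (interleave e (interleave p q)) (interleave E F)
        (rename_fm odd_left (\<lambda>i. 2 * i) \<phi>)" for e
      by (simp only: 1 sat_rename[OF inj_odd_left] interleave_odd_left interleave_comp_even)
    show "T e = sat M (interleave e (interleave p q)) (interleave E F)
        (rename_fm odd_right (\<lambda>i. 2 * i + 1) \<psi>)" for e
      by (simp only: 2 sat_rename[OF inj_odd_right] interleave_odd_right interleave_comp_odd)
  qed
qed

lemma D0_and: "D0 S \<Longrightarrow> D0 T \<Longrightarrow> D0 (\<lambda>e. S e \<and> T e)"
proof (erule (1) D0_pair)
  fix \<phi> \<psi> p E
  assume "range E \<subseteq> Sets M" "\<And>e. S e = sat M (interleave e p) E \<phi>"
    "\<And>e. T e = sat M (interleave e p) E \<psi>"
  then show ?thesis unfolding D0_def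
    by (intro exI[of _ "FAnd \<phi> \<psi>"] exI[of _ p] exI[of _ E]) simp
qed

lemma D0_cong: "D0 S \<Longrightarrow> (\<And>e. S e = T e) \<Longrightarrow> D0 T"
  unfolding D0_def by simp

lemma D0_or: "D0 S \<Longrightarrow> D0 T \<Longrightarrow> D0 (\<lambda>e. S e \<or> T e)"
  by (rule D0_cong[OF D0_not[OF D0_and[OF D0_not D0_not, of S T]]]) auto

lemma D0_imp: "D0 S \<Longrightarrow> D0 T \<Longrightarrow> D0 (\<lambda>e. S e \<longrightarrow> T e)"
  by (rule D0_cong[OF D0_or[OF D0_not, of S T]]) auto

lemma D0_iff: "D0 S \<Longrightarrow> D0 T \<Longrightarrow> D0 (\<lambda>e. S e \<longleftrightarrow> T e)"
  by (rule D0_cong[OF D0_and[OF D0_imp D0_imp, of S T T S]]) auto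

lemma D0_const: "D0 (\<lambda>e. b)"
proof -
  have "D0 (\<lambda>e. (if b then \<zero> else \<one>) = \<zero>)" by (rule D0_eq[OF term_const term_const])
  then show ?thesis by (rule D0_cong) auto
qed

lemma D0_le: "term_def s \<Longrightarrow> term_def t \<Longrightarrow> D0 (\<lambda>e. s e \<sqsubseteq> t e)"
  unfolding le_def by (intro D0_or D0_less D0_eq)

text \<open>The premise is in de Bruijn form while the conclusion has an ordinary quantifier, so
  repeated introduction reads definability off the shape of a predicate. The bound \<open>t\<close>
  lies outside the scope of the quantifier, hence the different renamings of \<open>t\<close> and of
  the body.\<close>

lemma D0_all_less:
  assumes "term_def t" "D0 (\<lambda>e. S (e 0) (\<lambda>i. e (Suc i)))"
  shows "D0 (\<lambda>e. \<forall>a. a \<sqsubset> t e \<longrightarrow> S a e)"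
proof -
  obtain \<tau> p where t: "\<And>e. t e = eval M (interleave e p) \<tau>"
    by (rule term_defE[OF assms(1)]) (rule that)
  obtain \<phi> q E where E: "range E \<subseteq> Sets M"
    and S: "\<And>e. S (e 0) (\<lambda>i. e (Suc i)) = sat M (interleave e q) E \<phi>"
    by (rule D0E[OF assms(2)]) (rule that)
  have S': "S a e = sat M (interleave (case_nat a e) q) E \<phi>" for a e
    using S[of "case_nat a e"] by simp
  \<comment> \<open>The first parameter slot is variable 1, reserved for the bound variable: its
    value is overwritten in the body and not read by the bound.\<close>
  let ?p = "case_nat undefined (interleave p q)"
  have "(\<forall>a. a \<sqsubset> t e \<longrightarrow> S a e) =
      sat M (interleave e ?p) E (FAll 1 (rename_term odd_right \<tau>) (rename_fm odd_far id \<phi>))" for e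
    by (simp only: sat.simps eval_rename sat_rename[OF inj_odd_far] interleave_binder_term
        interleave_binder_fm comp_id t[symmetric] S'[symmetric])
  with E show ?thesis unfolding D0_def
    by (intro exI[of _ "FAll 1 (rename_term odd_right \<tau>) (rename_fm odd_far id \<phi>)"]
        exI[of _ ?p] exI[of _ E]) simp
qed

lemma D0_ex_less:
  assumes "term_def t" "D0 (\<lambda>e. S (e 0) (\<lambda>i. e (Suc i)))"
  shows "D0 (\<lambda>e. \<exists>a. a \<sqsubset> t e \<and> S a e)"
  by (rule D0_cong[OF D0_not[OF D0_all_less[OF assms(1) D0_not[OF assms(2)]]]]) simp

lemma D0_all_le:
  assumes "term_def t" "D0 (\<lambda>e. S (e 0) (\<lambda>i. e (Suc i)))"
  shows "D0 (\<lambda>e. \<forall>a. a \<sqsubseteq> t e \<longrightarrow> S a e)"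
  by (rule D0_cong[OF D0_all_less[OF term_plus[OF assms(1) term_const[of \<one>]] assms(2)]])
    (simp add: less_Suc)

lemma D0_ex_le:
  assumes "term_def t" "D0 (\<lambda>e. S (e 0) (\<lambda>i. e (Suc i)))"
  shows "D0 (\<lambda>e. \<exists>a. a \<sqsubseteq> t e \<and> S a e)"
  by (rule D0_cong[OF D0_ex_less[OF term_plus[OF assms(1) term_const[of \<one>]] assms(2)]])
    (simp add: less_Suc)

lemmas term_intros = term_const term_var term_plus term_times term_pr

lemmas D0_intros = D0_const D0_eq D0_less D0_le D0_mem D0_not D0_and D0_or D0_imp D0_iff
  D0_all_less D0_ex_less D0_all_le D0_ex_le term_intros

lemma D0_rename:
  assumes "D0 S" "inj \<rho>"
  shows "D0 (\<lambda>e. S (\<lambda>i. e (\<rho> i)))"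
proof -
  obtain \<phi> p E where E: "range E \<subseteq> Sets M" and S: "\<And>e. S e = sat M (interleave e p) E \<phi>"
    by (rule D0E[OF assms(1)]) (rule that)
  let ?r = "\<lambda>n. if even n then 2 * \<rho> (n div 2) else n"
  have r: "inj ?r"
  proof (rule injI)
    fix x y assume eq: "?r x = ?r y"
    then have "even x = even y" by (auto split: if_splits)
    with eq have "even x \<and> \<rho> (x div 2) = \<rho> (y div 2) \<or> x = y" by (auto split: if_splits)
    with \<open>even x = even y\<close> show "x = y" using injD[OF assms(2)] by (metis dvd_mult_div_cancel)
  qed
  have "interleave (\<lambda>i. e (\<rho> i)) p = interleave e p \<circ> ?r" for e
    by (auto simp: interleave_def fun_eq_iff)
  then have "S (\<lambda>i. e (\<rho> i)) = sat M (interleave e p) E (rename_fm ?r id \<phi>)" for e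
    by (simp only: S sat_rename[OF r] comp_id)
  with E show ?thesis unfolding D0_def
    by (intro exI[of _ "rename_fm ?r id \<phi>"] exI[of _ p] exI[of _ E]) simp
qed

section \<open>Induction and comprehension\<close>

lemma D0_case_nat2:
  assumes "D0 Q" "inj \<rho>" "\<rho> 0 = i" "\<And>k. \<rho> (Suc k) = r k"
  shows "D0 (\<lambda>e. Q (case_nat (e i) (\<lambda>k. e (r k))))"
proof (rule D0_cong[OF D0_rename[OF assms(1,2)]])
  fix e :: "nat \<Rightarrow> 'a"
  have "(\<lambda>k. e (\<rho> k)) = case_nat (e i) (\<lambda>k. e (r k))"
    using assms by (auto simp: fun_eq_iff split: nat.split)
  then show "Q (\<lambda>k. e (\<rho> k)) = Q (case_nat (e i) (\<lambda>k. e (r k)))" by simp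
qed

lemma term_shift:
  assumes "term_def u"
  shows "term_def (\<lambda>e. u (\<lambda>i. e (Suc i)))"
proof -
  obtain p \<tau> where u: "\<And>e. u e = eval M (interleave e p) \<tau>"
    by (rule term_defE[OF assms]) (rule that)
  have "interleave (\<lambda>i. e (Suc i)) p = interleave e p \<circ> (\<lambda>i. if even i then i + 2 else i)" for e
    by (auto simp: interleave_def fun_eq_iff)
  then show ?thesis
    unfolding term_def_def
    by (intro exI[of _ "rename_term (\<lambda>i. if even i then i + 2 else i) \<tau>"] exI[of _ p])
      (simp only: u eval_rename simp_thms)
qed

lemma Suc_nonzero: "x \<oplus> \<one> \<noteq> \<zero>"
  using less_Suc_self not_less_zero by metis

lemma S1_D0: "D0 S \<Longrightarrow> S1 S"
proof -
  assume "D0 S"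
  then have "D0 (\<lambda>e. S (\<lambda>i. e (Suc i)))" by (rule D0_rename) simp
  then show ?thesis unfolding S1_def by (intro exI[of _ "\<lambda>e. S (\<lambda>i. e (Suc i))"]) simp
qed

lemma S1_cong: "S1 S \<Longrightarrow> (\<And>e. S e = T e) \<Longrightarrow> S1 T"
  unfolding S1_def by simp

lemma S1_bdI:
  assumes "D0 (\<lambda>e. S (e 0) (\<lambda>i. e (Suc i)))" "\<And>e. T e \<longleftrightarrow> (\<exists>w. S w e)"
  shows "S1 T"
  unfolding S1_def using assms by (intro exI[of _ "\<lambda>e. S (e 0) (\<lambda>i. e (Suc i))"]) simp

lemma inj_skip2: "inj (\<lambda>i. case i of 0 \<Rightarrow> 0 | Suc k \<Rightarrow> Suc (Suc k))"
  by (auto simp: inj_def split: nat.splits)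

text \<open>Two unbounded quantifiers are contracted into one by a number that bounds both
  witnesses, such as their sum; the two searches below it are bounded.\<close>

lemma S1_ex:
  assumes "S1 (\<lambda>e. S (e 0) (\<lambda>i. e (Suc i)))"
  shows "S1 (\<lambda>e. \<exists>a. S a e)"
proof -
  obtain Q where Q: "D0 Q" and S: "\<And>e. S (e 0) (\<lambda>i. e (Suc i)) \<longleftrightarrow> (\<exists>w. Q (case_nat w e))"
    by (rule S1E[OF assms]) (rule that)
  have S': "S a e \<longleftrightarrow> (\<exists>w. Q (case_nat w (case_nat a e)))" for a e
    using S[of "case_nat a e"] by simp
  show ?thesis
  proof (rule S1_bdI)
    show "(\<exists>a. S a e) \<longleftrightarrow> (\<exists>c. \<exists>a. a \<sqsubseteq> c \<and> (\<exists>w. w \<sqsubseteq> c \<and> Q (case_nat w (case_nat a e))))" for e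
      unfolding S' by (meson le_plus1 le_plus2)
    have "D0 (\<lambda>e. Q (case_nat (e 0) (case_nat (e 1) (\<lambda>k. e (Suc (Suc (Suc k)))))))"
    proof (rule D0_cong[OF D0_rename[OF Q, of "\<lambda>i. if i < 2 then i else Suc i"]])
      show "inj (\<lambda>i::nat. if i < 2 then i else Suc i)" by (auto simp: inj_def split: if_splits)
      show "Q (\<lambda>i. e (if i < 2 then i else Suc i))
          = Q (case_nat (e 0) (case_nat (e 1) (\<lambda>k. e (Suc (Suc (Suc k))))))" for e
        by (rule arg_cong[of _ _ Q]) (auto simp: fun_eq_iff split: nat.split)
    qed
    then show "D0 (\<lambda>e. \<exists>a. a \<sqsubseteq> e 0 \<and>
        (\<exists>w. w \<sqsubseteq> e 0 \<and> Q (case_nat w (case_nat a (\<lambda>i. e (Suc i))))))"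
      by (intro D0_intros) simp
  qed
qed

text \<open>The second property is the same matrix with one variable skipped, the form it takes
  below a further bounded quantifier.\<close>

lemma S1_bounded_cases:
  assumes "S1 S"
  obtains Q where "D0 (\<lambda>e. Q (e 0) (\<lambda>i. e (Suc i)))"
    "D0 (\<lambda>e. Q (e 0) (\<lambda>i. e (Suc (Suc i))))" "\<And>e. S e \<longleftrightarrow> (\<exists>w. Q w e)"
proof -
  obtain P where P: "D0 P" "\<And>e. S e \<longleftrightarrow> (\<exists>w. P (case_nat w e))"
    by (rule S1E[OF assms]) (rule that)
  show ?thesis
  proof (rule that[of "\<lambda>w e. P (case_nat w e)"])
    show "D0 (\<lambda>e. P (case_nat (e 0) (\<lambda>k. e (Suc k))))"
      by (rule D0_case_nat2[OF P(1), of id]) auto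
    show "D0 (\<lambda>e. P (case_nat (e 0) (\<lambda>k. e (Suc (Suc k)))))"
      by (rule D0_case_nat2[OF P(1) inj_skip2]) auto
  qed (rule P(2))
qed

lemma S1_and:
  assumes "S1 S" "S1 T"
  shows "S1 (\<lambda>e. S e \<and> T e)"
proof -
  obtain P where P: "D0 (\<lambda>e. P (e 0) (\<lambda>i. e (Suc (Suc i))))" "\<And>e. S e \<longleftrightarrow> (\<exists>w. P w e)"
    by (rule S1_bounded_cases[OF assms(1)]) (rule that)
  obtain Q where Q: "D0 (\<lambda>e. Q (e 0) (\<lambda>i. e (Suc (Suc i))))" "\<And>e. T e \<longleftrightarrow> (\<exists>w. Q w e)"
    by (rule S1_bounded_cases[OF assms(2)]) (rule that)
  show ?thesis
  proof (rule S1_bdI)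
    show "S e \<and> T e \<longleftrightarrow> (\<exists>w. (\<exists>a. a \<sqsubseteq> w \<and> P a e) \<and> (\<exists>a. a \<sqsubseteq> w \<and> Q a e))" for e
      unfolding P Q by (meson le_plus1 le_plus2)
    show "D0 (\<lambda>e. (\<exists>a. a \<sqsubseteq> e 0 \<and> P a (\<lambda>i. e (Suc i))) \<and> (\<exists>a. a \<sqsubseteq> e 0 \<and> Q a (\<lambda>i. e (Suc i))))"
      using P(1) Q(1) by (intro D0_intros)
  qed
qed

lemma S1_or:
  assumes "S1 S" "S1 T"
  shows "S1 (\<lambda>e. S e \<or> T e)"
proof -
  obtain P where P: "D0 (\<lambda>e. P (e 0) (\<lambda>i. e (Suc i)))" "\<And>e. S e \<longleftrightarrow> (\<exists>w. P w e)"
    by (rule S1_bounded_cases[OF assms(1)]) (rule that)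
  obtain Q where Q: "D0 (\<lambda>e. Q (e 0) (\<lambda>i. e (Suc i)))" "\<And>e. T e \<longleftrightarrow> (\<exists>w. Q w e)"
    by (rule S1_bounded_cases[OF assms(2)]) (rule that)
  show ?thesis
    by (rule S1_bdI[of "\<lambda>w e. P w e \<or> Q w e"], rule D0_or[OF P(1) Q(1)]) (auto simp: P(2) Q(2))
qed

lemma interleave_upd2:
  "(interleave (case_nat y (case_nat z e)) p)(2 := a, 0 := w) = interleave (case_nat w (case_nat a e)) p"
proof
  fix n
  show "((interleave (case_nat y (case_nat z e)) p)(2 := a, 0 := w)) n
      = interleave (case_nat w (case_nat a e)) p n"
  proof (cases "even n")
    case True
    then obtain k where "n = 2 * k" by (elim evenE)
    then show ?thesis by (auto simp: interleave_def split: nat.split)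
  qed (auto simp: interleave_def)
qed

lemma S1_induct_env:
  assumes "S1 S" "S (case_nat \<zero> e)" "\<And>a. S (case_nat a e) \<Longrightarrow> S (case_nat (a \<oplus> \<one>) e)"
  shows "S (case_nat a e)"
proof -
  obtain Q where "D0 Q" and S: "\<And>e. S e \<longleftrightarrow> (\<exists>w. Q (case_nat w e))"
    by (rule S1E[OF assms(1)]) (rule that)
  obtain \<phi> p E where E: "range E \<subseteq> Sets M" and Q: "\<And>e. Q e = sat M (interleave e p) E \<phi>"
    by (rule D0E[OF \<open>D0 Q\<close>]) (rule that)
  \<comment> \<open>Variable 0 holds the existential witness and variable 2 the induction variable;
    both initial values are overwritten.\<close>
  let ?e = "interleave (case_nat \<zero> (case_nat \<zero> e)) p"
  have *: "sat_Sigma1 M (?e(2 := a)) E 0 \<phi> \<longleftrightarrow> S (case_nat a e)" for a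
    by (simp only: sat_Sigma1_def S Q interleave_upd2)
  have "Sigma1_induction M" using RCA0 by (simp add: RCA0_def)
  from this[unfolded Sigma1_induction_def, rule_format, of E ?e 2 0 \<phi> a, unfolded *] assms(2,3) E
  show ?thesis by blast
qed

lemma S1_induct:
  assumes "S1 (\<lambda>e. P (e 0))" "P \<zero>" "\<And>a. P a \<Longrightarrow> P (a \<oplus> \<one>)"
  shows "P a"
proof -
  have "P (case_nat a undefined 0)"
    by (rule S1_induct_env[OF assms(1), of undefined a]) (use assms(2,3) in simp_all)
  then show ?thesis by simp
qed

text \<open>This is \<open>\<Sigma>\<^sup>0\<^sub>1\<close> bounding: by induction on
  \<open>j \<sqsubseteq> t e\<close>, one number bounds witnesses for all
  \<open>a \<sqsubset> j\<close>, and the existence of such a number is again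
  \<open>\<Sigma>\<^sup>0\<^sub>1\<close>.\<close>

lemma S1_all_less:
  assumes "term_def t" "S1 (\<lambda>e. S (e 0) (\<lambda>i. e (Suc i)))"
  shows "S1 (\<lambda>e. \<forall>a. a \<sqsubset> t e \<longrightarrow> S a e)"
proof -
  obtain Q where Q: "D0 Q" and S: "\<And>e. S (e 0) (\<lambda>i. e (Suc i)) \<longleftrightarrow> (\<exists>w. Q (case_nat w e))"
    by (rule S1E[OF assms(2)]) (rule that)
  have S': "S a e \<longleftrightarrow> (\<exists>w. Q (case_nat w (case_nat a e)))" for a e
    using S[of "case_nat a e"] by simp
  have Q3: "D0 (\<lambda>e. Q (case_nat (e 0) (case_nat (e 1) (\<lambda>k. e (Suc (Suc (Suc k)))))))"
  proof (rule D0_cong[OF D0_rename[OF Q, of "\<lambda>i. if i < 2 then i else Suc i"]])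
    show "inj (\<lambda>i::nat. if i < 2 then i else Suc i)" by (auto simp: inj_def split: if_splits)
    show "Q (\<lambda>i. e (if i < 2 then i else Suc i))
        = Q (case_nat (e 0) (case_nat (e 1) (\<lambda>k. e (Suc (Suc (Suc k))))))" for e
      by (rule arg_cong[of _ _ Q]) (auto simp: fun_eq_iff split: nat.split)
  qed
  have Q4: "D0 (\<lambda>e. Q (case_nat (e 0) (case_nat (e 1) (\<lambda>k. e (Suc (Suc (Suc (Suc k))))))))"
  proof (rule D0_cong[OF D0_rename[OF Q, of "\<lambda>i. if i < 2 then i else Suc (Suc i)"]])
    show "inj (\<lambda>i::nat. if i < 2 then i else Suc (Suc i))" by (auto simp: inj_def split: if_splits)
    show "Q (\<lambda>i. e (if i < 2 then i else Suc (Suc i)))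
        = Q (case_nat (e 0) (case_nat (e 1) (\<lambda>k. e (Suc (Suc (Suc (Suc k)))))))" for e
      by (rule arg_cong[of _ _ Q]) (auto simp: fun_eq_iff split: nat.split)
  qed
  have bound: "\<exists>b. \<forall>a. a \<sqsubset> j \<longrightarrow> (\<exists>w. w \<sqsubseteq> b \<and> Q (case_nat w (case_nat a e)))"
    if H1: "\<forall>a. a \<sqsubset> t e \<longrightarrow> S a e" and H2: "j \<sqsubseteq> t e" for e j
  proof -
    \<comment> \<open>The induction variable is \<open>f 0\<close>, while \<open>t e\<close> is a
      fixed parameter. The guard makes the statement trivial beyond the bound, where no witnesses
      are supplied.\<close>
    let ?T = "\<lambda>f. \<exists>b. f 0 \<sqsubseteq> t e \<longrightarrow>
      (\<forall>a. a \<sqsubset> f 0 \<longrightarrow> (\<exists>w. w \<sqsubseteq> b \<and> Q (case_nat w (case_nat a (\<lambda>i. f (Suc i))))))"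
    have "?T (case_nat j e)"
    proof (rule S1_induct_env[of ?T])
      show "S1 ?T"
      proof (rule S1_ex, rule S1_D0)
        show "D0 (\<lambda>f. f (Suc 0) \<sqsubseteq> t e \<longrightarrow> (\<forall>a. a \<sqsubset> f (Suc 0) \<longrightarrow>
            (\<exists>w. w \<sqsubseteq> f 0 \<and> Q (case_nat w (case_nat a (\<lambda>i. f (Suc (Suc i))))))))"
          using Q4 by (intro D0_intros) simp
      qed
      show "?T (case_nat \<zero> e)" by simp
      fix j assume IH: "?T (case_nat j e)"
      show "?T (case_nat (j \<oplus> \<one>) e)"
      proof (cases "j \<oplus> \<one> \<sqsubseteq> t e")
        case True
        then have "j \<sqsubset> t e" by (simp add: ar.less_iff_succ_less_eq)
        then obtain w where w: "Q (case_nat w (case_nat j e))" using H1 S'[of j e] by auto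
        obtain b where b: "\<forall>a. a \<sqsubset> j \<longrightarrow> (\<exists>w. w \<sqsubseteq> b \<and> Q (case_nat w (case_nat a e)))"
          using IH \<open>j \<sqsubset> t e\<close> by auto
        have "\<exists>v. v \<sqsubseteq> b \<oplus> w \<and> Q (case_nat v (case_nat a e))" if "a \<sqsubset> j \<oplus> \<one>" for a
        proof (cases "a = j")
          case True then show ?thesis using w le_plus2 by blast
        next
          case False
          with that have "a \<sqsubset> j" by (simp add: less_Suc le_def)
          with b obtain v where "v \<sqsubseteq> b" "Q (case_nat v (case_nat a e))" by blast
          then show ?thesis using le_plus1 ar.order_trans by blast
        qed
        then show ?thesis by (intro exI[of _ "b \<oplus> w"]) simp
      qed simp
    qed
    then show ?thesis using H2 by simp
  qed
  show ?thesis
  proof (rule S1_bdI)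
    show "(\<forall>a. a \<sqsubset> t e \<longrightarrow> S a e) \<longleftrightarrow>
        (\<exists>b. \<forall>a. a \<sqsubset> t e \<longrightarrow> (\<exists>w. w \<sqsubseteq> b \<and> Q (case_nat w (case_nat a e))))" for e
      using bound[of e "t e"] S' by auto
    from term_shift[OF assms(1)] show "D0 (\<lambda>e. \<forall>a. a \<sqsubset> t (\<lambda>i. e (Suc i)) \<longrightarrow>
        (\<exists>w. w \<sqsubseteq> e 0 \<and> Q (case_nat w (case_nat a (\<lambda>i. e (Suc i))))))"
      using Q3 by (intro D0_intros) (simp_all)
  qed
qed

lemmas S1_intros = S1_and S1_or S1_ex S1_all_less

text \<open>Without a least element one could descend: for every \<open>j\<close> there is an
  element \<open>c\<close> with \<open>c \<oplus> j \<sqsubseteq> b\<close>. This is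
  \<open>\<Sigma>\<^sup>0\<^sub>1\<close>, so it follows by induction, and
  \<open>j = b \<oplus> \<one>\<close> is absurd.\<close>

lemma S1_least:
  assumes "S1 (\<lambda>e. P (e 0))" "P b"
  obtains a where "P a" "a \<sqsubseteq> b" "\<And>c. c \<sqsubset> a \<Longrightarrow> \<not> P c"
proof (rule ccontr)
  assume no: "\<not> thesis"
  have step: "\<exists>c. c \<sqsubset> a \<and> P c" if "P a" "a \<sqsubseteq> b" for a
    using that no \<open>\<And>a. P a \<Longrightarrow> a \<sqsubseteq> b \<Longrightarrow> (\<And>c. c \<sqsubset> a \<Longrightarrow> \<not> P c) \<Longrightarrow> thesis\<close> by blast
  have "\<exists>c. P c \<and> c \<oplus> j \<sqsubseteq> b" for j
  proof (rule S1_induct[of "\<lambda>j. \<exists>c. P c \<and> c \<oplus> j \<sqsubseteq> b"])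
    show "S1 (\<lambda>e. \<exists>c. P c \<and> c \<oplus> e 0 \<sqsubseteq> b)"
      by (intro S1_ex S1_and assms(1) S1_D0 D0_intros)
    show "\<exists>c. P c \<and> c \<oplus> \<zero> \<sqsubseteq> b" using assms(2) by auto
    fix j assume "\<exists>c. P c \<and> c \<oplus> j \<sqsubseteq> b"
    then obtain c where c: "P c" "c \<oplus> j \<sqsubseteq> b" by blast
    then obtain d where d: "d \<sqsubset> c" "P d" using step le_plus1 ar.order_trans by blast
    have "d \<oplus> j \<oplus> \<one> \<sqsubseteq> b"
      using d(1) c(2) by (meson ar.add_strict_right_mono ar.less_iff_succ_less_eq ar.less_le_trans)
    then show "\<exists>c. P c \<and> c \<oplus> (j \<oplus> \<one>) \<sqsubseteq> b" using d(2) by (metis plus_assoc)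
  qed
  then obtain c where "c \<oplus> (b \<oplus> \<one>) \<sqsubseteq> b" by blast
  then have "b \<oplus> \<one> \<sqsubseteq> b" using le_plus2 ar.order_trans by blast
  then show False using less_Suc_self[of b] by (simp add: ar.not_less[symmetric])
qed

lemma D0_least:
  assumes "D0 (\<lambda>e. P (e 0))" "P b"
  obtains a where "P a" "a \<sqsubseteq> b" "\<And>c. c \<sqsubset> a \<Longrightarrow> \<not> P c"
  using S1_least[OF S1_D0[OF assms(1)] assms(2)] by blast

text \<open>A counterexample would give a least one by \<open>S1_least\<close>, and that is neither
  zero nor a successor.\<close>

lemma Pi1_induct:
  assumes "S1 (\<lambda>e. \<not> P (e 0))" "P \<zero>" "\<And>a. P a \<Longrightarrow> P (a \<oplus> \<one>)"
  shows "P a"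
proof (rule ccontr)
  assume "\<not> P a"
  then obtain b where b: "\<not> P b" "\<And>c. c \<sqsubset> b \<Longrightarrow> P c"
    by (rule S1_least[of "\<lambda>a. \<not> P a", OF assms(1)]) auto
  then obtain c where "b = c \<oplus> \<one>" using pred_ex assms(2) by metis
  with b assms(3) show False by auto
qed

lemma Delta1_Sets:
  assumes "S1 (\<lambda>e. P (e 0))" "S1 (\<lambda>e. \<not> P (e 0))"
  shows "{a. P a} \<in> Sets M"
proof -
  obtain S where S: "D0 S" "\<And>e. P (e 0) \<longleftrightarrow> (\<exists>w. S (case_nat w e))"
    by (rule S1E[OF assms(1)]) (rule that)
  obtain T where T: "D0 T" "\<And>e. \<not> P (e 0) \<longleftrightarrow> (\<exists>w. T (case_nat w e))"
    by (rule S1E[OF assms(2)]) (rule that)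
  obtain \<phi> \<psi> p E where E: "range E \<subseteq> Sets M" and S': "\<And>e. S e = sat M (interleave e p) E \<phi>"
    and T': "\<And>e. T e = sat M (interleave e p) E \<psi>"
    by (rule D0_pair[OF S(1) T(1)]) (rule that)
  let ?e = "interleave (case_nat \<zero> (case_nat \<zero> (\<lambda>_. \<zero>))) p"
  have 1: "sat_Sigma1 M (?e(2 := a)) E 0 \<phi> \<longleftrightarrow> P a" for a
    using S(2)[of "case_nat a (\<lambda>_. \<zero>)"] by (simp add: sat_Sigma1_def interleave_upd2 S')
  have 2: "sat_Pi1 M (?e(2 := a)) E 0 (FNot \<psi>) \<longleftrightarrow> P a" for a
    using T(2)[of "case_nat a (\<lambda>_. \<zero>)"] by (auto simp: sat_Pi1_def interleave_upd2 T')
  have "Delta1_comprehension M" using RCA0 by (simp add: RCA0_def)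
  from this[unfolded Delta1_comprehension_def, rule_format, of E ?e 2 0 \<phi> 0 "FNot \<psi>", unfolded 1 2] E
  obtain X where "X \<in> Sets M" "\<forall>a. a \<in> X \<longleftrightarrow> P a" by blast
  moreover then have "X = {a. P a}" by blast
  ultimately show ?thesis by simp
qed

lemma D0_Sets: "D0 (\<lambda>e. P (e 0)) \<Longrightarrow> {a. P a} \<in> Sets M"
  by (rule Delta1_Sets) (auto intro: S1_D0 D0_not)

section \<open>Pairs and numerals\<close>

text \<open>Pairs with sum \<open>s\<close> have codes between \<open>s\<^sup>2\<close> and
  \<open>s\<^sup>2 + s\<close>, hence below the next square. So the code determines the sum, and
  then the first component.\<close>

lemma pair_less_sum:
  assumes "x \<oplus> y \<sqsubset> u \<oplus> v"
  shows "pair M x y \<sqsubset> pair M u v"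
proof -
  let ?s = "x \<oplus> y"
  have "?s \<oplus> \<one> \<sqsubseteq> u \<oplus> v" using assms by (simp add: ar.less_iff_succ_less_eq)
  then have "(?s \<oplus> \<one>) \<otimes> (?s \<oplus> \<one>) \<sqsubseteq> (u \<oplus> v) \<otimes> (u \<oplus> v)"
    by (intro ar.mult_mono) auto
  moreover have "(?s \<oplus> \<one>) \<otimes> (?s \<oplus> \<one>) = (?s \<otimes> ?s \<oplus> x) \<oplus> (?s \<oplus> y \<oplus> \<one>)"
    by (simp add: algebra_simps)
  moreover have "?s \<otimes> ?s \<oplus> x \<sqsubset> (?s \<otimes> ?s \<oplus> x) \<oplus> (?s \<oplus> y \<oplus> \<one>)"
    by (metis le_plus1 less_Suc plus_assoc)
  ultimately show ?thesis unfolding pair_def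
    by (metis ar.less_le_trans le_plus1 ar.order_trans)
qed

lemma pair_inj [simp]: "pair M x y = pair M u v \<longleftrightarrow> x = u \<and> y = v"
proof
  assume eq: "pair M x y = pair M u v"
  then have s: "x \<oplus> y = u \<oplus> v"
    using pair_less_sum[of x y u v] pair_less_sum[of u v x y] less_total less_irrefl by metis
  with eq have "x = u" by (simp add: pair_def)
  with s show "x = u \<and> y = v" by (simp add: plus_cancel)
qed simp

lemma pair_mono: "x \<sqsubseteq> u \<Longrightarrow> y \<sqsubseteq> v \<Longrightarrow> pair M x y \<sqsubseteq> pair M u v"
  unfolding pair_def by (intro ar.add_mono ar.mult_mono) auto

lemma le_square: "x \<sqsubseteq> x \<otimes> x"
proof (cases "x = \<zero>")
  case False
  then obtain y where "x = y \<oplus> \<one>" using pred_ex by blast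
  then show ?thesis by (metis le_plus2 times_plus times_one)
qed simp

lemma pair_ge1: "x \<sqsubseteq> pair M x y"
  by (simp add: pair_def)

lemma pair_ge2: "y \<sqsubseteq> pair M x y"
  unfolding pair_def by (meson le_plus1 le_plus2 le_square ar.order_trans)

lemma in_rel: "(x, y) \<in> rel M R \<longleftrightarrow> pair M x y \<in> R"
  by (simp add: rel_def)

lemma in_fiber: "x \<in> fiber M F i \<longleftrightarrow> pair M i x \<in> F"
  by (simp add: fiber_def)

text \<open>A cofactor of \<open>b\<close> is at most \<open>b\<close> unless the divisor is zero,
  and in that case the cofactor zero serves, so the search is bounded.\<close>

lemma D0_divides:
  assumes "term_def s" "term_def t"
  shows "D0 (\<lambda>e. divides M (s e) (t e))"
proof (rule D0_cong)
  have le: "c \<sqsubseteq> a \<otimes> c" if "a \<noteq> \<zero>" for a c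
  proof -
    obtain b where "a = b \<oplus> \<one>" using pred_ex \<open>a \<noteq> \<zero>\<close> by blast
    then show ?thesis by (simp add: ar.distrib_right)
  qed
  have "divides M a b \<longleftrightarrow> (\<exists>c. c \<sqsubseteq> b \<and> b = a \<otimes> c)" for a b
    by (cases "a = \<zero>") (use le in \<open>auto simp: divides_def\<close>)
  then show "(\<exists>c. c \<sqsubseteq> t e \<and> t e = s e \<otimes> c) = divides M (s e) (t e)" for e by simp
  from term_shift[OF assms(1)] term_shift[OF assms(2)]
  show "D0 (\<lambda>e. \<exists>c. c \<sqsubseteq> t e \<and> t e = s e \<otimes> c)"
    using assms by (intro D0_intros)
qed

abbreviation nm :: "nat \<Rightarrow> 'a"
  where "nm n \<equiv> numeral_of M n"

lemma nm_strict: "i < j \<Longrightarrow> nm i \<sqsubset> nm j"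
proof (induction j)
  case (Suc j)
  then have "nm i \<sqsubseteq> nm j" by (auto simp: le_def less_Suc_eq)
  then show ?case by (simp add: less_Suc)
qed simp

lemma nm_less [simp]: "nm i \<sqsubset> nm j \<longleftrightarrow> i < j"
  by (metis nm_strict less_irrefl less_trans linorder_neqE_nat)

lemma nm_inj [simp]: "nm i = nm j \<longleftrightarrow> i = j"
  by (metis nm_strict less_irrefl linorder_neqE_nat)

lemma less_nm: "x \<sqsubset> nm n \<longleftrightarrow> (\<exists>i<n. x = nm i)"
proof
  show "x \<sqsubset> nm n \<Longrightarrow> \<exists>i<n. x = nm i"
  proof (induction n)
    case (Suc n)
    then have "x \<sqsubset> nm n \<or> x = nm n" by (simp add: less_Suc le_def)
    with Suc.IH show ?case by (auto intro: less_SucI)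
  qed simp
qed auto

lemma nm_add: "nm (i + j) = nm i \<oplus> nm j"
  by (induction j) (simp_all add: plus_assoc)

lemma nm_mult: "nm (i * j) = nm i \<otimes> nm j"
  by (induction j) (simp_all add: nm_add times_plus add.commute plus_comm)

lemma nm_1: "nm 1 = \<one>"
  by simp

section \<open>Codes of finite sets\<close>

lemma divides_dvd: "divides M = ar.dvd"
  by (auto simp: fun_eq_iff divides_def ar.dvd_def)

lemma divides_le: "divides M a b \<Longrightarrow> b \<noteq> \<zero> \<Longrightarrow> a \<sqsubseteq> b"
proof -
  assume "divides M a b" "b \<noteq> \<zero>"
  then obtain c where c: "b = a \<otimes> c" "c \<noteq> \<zero>" by (auto simp: divides_def)
  then obtain d where "c = d \<oplus> \<one>" using pred_ex by blast
  with c show "a \<sqsubseteq> b" by (simp add: times_plus)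
qed

text \<open>The moduli of Goedel's \<open>\<beta>\<close> function, which occur in the coding of
  finite sets.\<close>

definition coef :: "'a \<Rightarrow> 'a \<Rightarrow> 'a"
  where "coef m x = m \<otimes> (x \<oplus> \<one>) \<oplus> \<one>"

text \<open>Coprimality as a subtraction-free Bezout identity: \<open>n\<close> is invertible modulo
  \<open>d\<close>. This form is \<open>\<Sigma>\<^sup>0\<^sub>1\<close>, so it may occur in
  inductions, and it yields Euclid's lemma directly.\<close>

definition cop :: "'a \<Rightarrow> 'a \<Rightarrow> bool"
  where "cop d n \<longleftrightarrow> (\<exists>u v. v \<otimes> n = u \<otimes> d \<oplus> \<one>)"

text \<open>A substitute for the factorial of \<open>k\<close>; a nonzero common multiple of this
  kind makes the moduli \<open>coef m x\<close>, \<open>x \<sqsubset> k\<close>, pairwise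
  coprime.\<close>

definition modulus :: "'a \<Rightarrow> 'a \<Rightarrow> bool"
  where "modulus k m \<longleftrightarrow> m \<noteq> \<zero> \<and> (\<forall>i. i \<sqsubset> k \<longrightarrow> divides M (i \<oplus> \<one>) m)"

text \<open>A divisor of \<open>N\<close> can code any subset of the numbers below \<open>k\<close>,
  so \<open>N\<close> bounds all these codes in advance.\<close>

definition multiple :: "'a \<Rightarrow> 'a \<Rightarrow> 'a \<Rightarrow> bool"
  where "multiple k m N \<longleftrightarrow> N \<noteq> \<zero> \<and> (\<forall>x. x \<sqsubset> k \<longrightarrow> divides M (coef m x) N)"

lemma term_coef: "term_def s \<Longrightarrow> term_def t \<Longrightarrow> term_def (\<lambda>e. coef (s e) (t e))"
  unfolding coef_def by (intro term_intros)

lemma D0_modulus: "term_def s \<Longrightarrow> term_def t \<Longrightarrow> D0 (\<lambda>e. modulus (s e) (t e))"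
  unfolding modulus_def by (intro D0_intros D0_divides term_shift)

lemma D0_multiple:
  "term_def s \<Longrightarrow> term_def t \<Longrightarrow> term_def u \<Longrightarrow> D0 (\<lambda>e. multiple (s e) (t e) (u e))"
  unfolding multiple_def by (intro D0_intros D0_divides term_shift term_coef)

lemma S1_cop: "term_def s \<Longrightarrow> term_def t \<Longrightarrow> S1 (\<lambda>e. cop (s e) (t e))"
  unfolding cop_def by (intro S1_intros S1_D0 D0_intros term_shift)

lemma cop_1: "cop d \<one>"
  unfolding cop_def by (intro exI[of _ \<zero>] exI[of _ \<one>]) simp

lemma cop_mult: "cop d n \<Longrightarrow> cop d n' \<Longrightarrow> cop d (n \<otimes> n')"
proof -
  assume "cop d n" "cop d n'"
  then obtain u v u' v' where 1: "v \<otimes> n = u \<otimes> d \<oplus> \<one>" "v' \<otimes> n' = u' \<otimes> d \<oplus> \<one>"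
    unfolding cop_def by blast
  have "(v \<otimes> v') \<otimes> (n \<otimes> n') = (v \<otimes> n) \<otimes> (v' \<otimes> n')"
    by (simp only: ar.mult.assoc ar.mult.commute ar.mult.left_commute)
  also have "\<dots> = (u \<otimes> u' \<otimes> d \<oplus> u \<oplus> u') \<otimes> d \<oplus> \<one>" unfolding 1 by (simp add: algebra_simps)
  finally show ?thesis unfolding cop_def by blast
qed

lemma cop_divides: "cop d n \<Longrightarrow> divides M d (n \<otimes> y) \<Longrightarrow> divides M d y"
proof -
  assume "cop d n" and dv: "divides M d (n \<otimes> y)"
  then obtain u v where 1: "v \<otimes> n = u \<otimes> d \<oplus> \<one>"
    unfolding cop_def by blast
  have "v \<otimes> (n \<otimes> y) = d \<otimes> (u \<otimes> y) \<oplus> y"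
    by (metis (no_types, lifting) 1 ar.distrib_right ar.mult.assoc ar.mult.commute ar.mult_1)
  moreover have "ar.dvd d (v \<otimes> (n \<otimes> y))" using dv by (simp add: divides_dvd)
  ultimately have "ar.dvd d (d \<otimes> (u \<otimes> y) \<oplus> y)" by simp
  then show ?thesis unfolding divides_dvd by (metis ar.dvd_add_right_iff ar.dvd_triv_left)
qed

text \<open>Multiplying \<open>v n = u d + 1\<close> by \<open>n - 1\<close> and rearranging gives
  \<open>(n - 1) u d = ((n - 1) v - 1) n + 1\<close>. For \<open>n = 1\<close> the coefficient of
  \<open>n\<close> would be negative, which explains the case distinction.\<close>

lemma cop_sym: "cop d n \<Longrightarrow> d \<noteq> \<zero> \<Longrightarrow> n \<noteq> \<zero> \<Longrightarrow> cop n d"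
proof -
  assume "cop d n" "d \<noteq> \<zero>" "n \<noteq> \<zero>"
  then obtain u v where 1: "v \<otimes> n = u \<otimes> d \<oplus> \<one>"
    unfolding cop_def by blast
  obtain n0 where n0: "n = n0 \<oplus> \<one>" using pred_ex \<open>n \<noteq> \<zero>\<close> by blast
  show ?thesis
  proof (cases "n0 = \<zero>")
    case True
    then have "n = \<one>" using n0 by simp
    moreover obtain d0 where "d = d0 \<oplus> \<one>" using pred_ex \<open>d \<noteq> \<zero>\<close> by blast
    ultimately show ?thesis unfolding cop_def by (intro exI[of _ d0] exI[of _ \<one>]) simp
  next
    case False
    have "v \<noteq> \<zero>"
    proof
      assume "v = \<zero>"
      with 1 have "\<zero> = u \<otimes> d \<oplus> \<one>" by simp
      then show False using less_Suc_self[of "u \<otimes> d"] not_less_zero by metis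
    qed
    with False obtain w where w: "n0 \<otimes> v = w \<oplus> \<one>" using pred_ex[of "n0 \<otimes> v"] by auto
    have "n0 \<otimes> u \<otimes> d \<oplus> n = n0 \<otimes> (v \<otimes> n) \<oplus> \<one>"
      unfolding 1 by (simp add: n0 algebra_simps)
    also have "\<dots> = (n0 \<otimes> v) \<otimes> n \<oplus> \<one>" by (simp add: algebra_simps)
    also have "\<dots> = (w \<otimes> n \<oplus> \<one>) \<oplus> n" unfolding w by (simp add: algebra_simps)
    finally have "(n0 \<otimes> u) \<otimes> d = w \<otimes> n \<oplus> \<one>" by simp
    then show ?thesis unfolding cop_def by blast
  qed
qed

lemma modulus_ex: "\<exists>m. modulus k m"
proof (rule S1_induct[of "\<lambda>k. \<exists>m. modulus k m"])
  show "S1 (\<lambda>e. \<exists>m. modulus (e 0) m)" by (intro S1_intros S1_D0 D0_modulus term_intros)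
  show "\<exists>m. modulus \<zero> m" unfolding modulus_def by (intro exI[of _ \<one>]) simp
  fix k assume "\<exists>m. modulus k m"
  then obtain m where m: "modulus k m" by blast
  have "k \<oplus> \<one> \<noteq> \<zero>" using less_Suc_self[of k] not_less_zero by metis
  with m have "modulus (k \<oplus> \<one>) (m \<otimes> (k \<oplus> \<one>))"
    unfolding modulus_def divides_dvd by (auto simp: less_Suc le_def)
  then show "\<exists>m. modulus (k \<oplus> \<one>) m" by blast
qed

lemma coef_nonzero: "coef m x \<noteq> \<zero>"
  unfolding coef_def using less_Suc_self not_less_zero by metis

lemma coef_not_unit: "m \<noteq> \<zero> \<Longrightarrow> \<not> divides M (coef m x) \<one>"
proof
  assume "m \<noteq> \<zero>" "divides M (coef m x) \<one>"
  then have "m \<otimes> (x \<oplus> \<one>) \<oplus> \<one> \<sqsubseteq> \<one>" using divides_le[of "coef m x" \<one>] by (simp add: coef_def)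
  then have "m \<otimes> (x \<oplus> \<one>) = \<zero>"
    by (metis ar.add_le_same_cancel2 le_zero)
  moreover have "x \<oplus> \<one> \<noteq> \<zero>" using less_Suc_self[of x] not_less_zero by metis
  ultimately show False using \<open>m \<noteq> \<zero>\<close> by simp
qed

text \<open>
  Modulo \<open>d = m (x + 1) + 1\<close> the number \<open>m\<close> is a unit with inverse \<open>- (x + 1)\<close>, and so is
  every divisor of \<open>m\<close>.
\<close>

lemma coef_cop_less:
  assumes m: "modulus k m" and "x \<sqsubset> j" "j \<sqsubset> k"
  shows "cop (coef m x) (coef m j)"
proof -
  obtain \<delta> where \<delta>: "j = x \<oplus> \<delta>" using assms(2) less_imp_plus by blast
  with assms(2) have "\<delta> \<noteq> \<zero>" by auto
  then obtain i where i: "\<delta> = i \<oplus> \<one>" using pred_ex by blast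
  have "i \<sqsubset> k"
    using assms(3) \<delta> i less_Suc_self[of i] le_plus2[of \<delta> x] by (metis ar.less_le_trans less_trans)
  with m i obtain \<mu> where \<mu>: "m = \<delta> \<otimes> \<mu>" unfolding modulus_def divides_def by blast
  define M1 where "M1 = m \<otimes> (x \<oplus> \<one>)"
  have "M1 \<noteq> \<zero>"
    using m Suc_nonzero[of x] unfolding M1_def modulus_def by auto
  then obtain s where s: "M1 = s \<oplus> \<one>" using pred_ex by blast
  \<comment> \<open>As \<open>coef m x\<close> is \<open>M1 \<oplus> \<one>\<close>, the number
    \<open>M1\<close> is -1 modulo it and its square is 1. Modulo \<open>coef m x\<close> the other
    modulus is \<open>m \<otimes> \<delta>\<close>, and \<open>v\<close> is chosen to turn that into
    the square of \<open>M1\<close>.\<close>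
  define v where "v = \<mu> \<otimes> ((x \<oplus> \<one>) \<otimes> (x \<oplus> \<one>))"
  have "v \<otimes> (m \<otimes> \<delta>) = (\<delta> \<otimes> \<mu>) \<otimes> m \<otimes> ((x \<oplus> \<one>) \<otimes> (x \<oplus> \<one>))"
    by (simp only: v_def ar.mult.assoc ar.mult.commute ar.mult.left_commute)
  then have v: "v \<otimes> (m \<otimes> \<delta>) = M1 \<otimes> M1"
    by (simp only: M1_def \<mu>[symmetric] ar.mult.assoc ar.mult.commute ar.mult.left_commute)
  have "coef m j = (M1 \<oplus> \<one>) \<oplus> m \<otimes> \<delta>"
    by (simp add: coef_def M1_def \<delta> algebra_simps)
  then have "v \<otimes> coef m j = v \<otimes> (M1 \<oplus> \<one>) \<oplus> M1 \<otimes> M1"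
    by (simp only: times_plus v)
  also have "M1 \<otimes> M1 = s \<otimes> (M1 \<oplus> \<one>) \<oplus> \<one>"
    unfolding s by (simp only: ar.distrib_left ar.distrib_right ar.mult_1 ar.mult_1_right ar.add.assoc
        ar.add.commute ar.add.left_commute)
  finally have "v \<otimes> coef m j = (v \<oplus> s) \<otimes> coef m x \<oplus> \<one>"
    by (simp add: coef_def M1_def algebra_simps)
  then show ?thesis unfolding cop_def by blast
qed

lemma coef_cop:
  assumes "modulus k m" "x \<sqsubset> k" "j \<sqsubset> k" "x \<noteq> j"
  shows "cop (coef m x) (coef m j)"
  using less_total[of x j] assms coef_cop_less cop_sym coef_nonzero by metis

lemma multiple_ex: "\<exists>N. multiple k m N"
proof (rule S1_induct[of "\<lambda>k. \<exists>N. multiple k m N"])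
  show "S1 (\<lambda>e. \<exists>N. multiple (e 0) m N)" by (intro S1_intros S1_D0 D0_multiple term_intros)
  show "\<exists>N. multiple \<zero> m N" unfolding multiple_def by (intro exI[of _ \<one>]) simp
  fix k assume "\<exists>N. multiple k m N"
  then obtain N where "multiple k m N" by blast
  then have "multiple (k \<oplus> \<one>) m (N \<otimes> coef m k)"
    unfolding multiple_def divides_dvd using coef_nonzero by (auto simp: less_Suc le_def)
  then show "\<exists>N. multiple (k \<oplus> \<one>) m N" by blast
qed

text \<open>Multiply together the moduli of the elements of \<open>X\<close>, one \<open>j\<close>
  at a time. The product is kept a divisor of \<open>N\<close>, which bounds it, and the remaining
  moduli are kept coprime to it: unlike mere non-divisibility, this survives further multiplications
  and is \<open>\<Sigma>\<^sup>0\<^sub>1\<close>.\<close>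

lemma coded_product:
  assumes m: "modulus k m" and N: "multiple k m N" and X: "X \<in> Sets M"
  shows "\<exists>n. n \<sqsubseteq> N \<and> (\<forall>x. x \<sqsubset> k \<longrightarrow> (divides M (coef m x) n \<longleftrightarrow> x \<in> X))"
proof -
  let ?P = "\<lambda>j n x. (x \<in> X \<and> x \<sqsubset> j \<and> divides M (coef m x) n) \<or> (\<not> (x \<in> X \<and> x \<sqsubset> j) \<and> cop (coef m x) n)"
  have "\<exists>n. k \<sqsubset> j \<or> (divides M n N \<and> (\<forall>x. x \<sqsubset> k \<longrightarrow> ?P j n x))" for j
  proof (rule S1_induct[of "\<lambda>j. \<exists>n. k \<sqsubset> j \<or> (divides M n N \<and> (\<forall>x. x \<sqsubset> k \<longrightarrow> ?P j n x))"])
    show "S1 (\<lambda>e. \<exists>n. k \<sqsubset> e 0 \<or> (divides M n N \<and> (\<forall>x. x \<sqsubset> k \<longrightarrow> ?P (e 0) n x)))"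
      by (intro S1_ex S1_or S1_and S1_all_less S1_cop S1_D0 D0_intros D0_divides term_coef X)
    show "\<exists>n. k \<sqsubset> \<zero> \<or> (divides M n N \<and> (\<forall>x. x \<sqsubset> k \<longrightarrow> ?P \<zero> n x))"
      by (intro exI[of _ \<one>]) (simp add: cop_1 divides_dvd)
    fix j assume IH: "\<exists>n. k \<sqsubset> j \<or> (divides M n N \<and> (\<forall>x. x \<sqsubset> k \<longrightarrow> ?P j n x))"
    show "\<exists>n. k \<sqsubset> j \<oplus> \<one> \<or> (divides M n N \<and> (\<forall>x. x \<sqsubset> k \<longrightarrow> ?P (j \<oplus> \<one>) n x))"
    proof (cases "k \<sqsubseteq> j")
      case True
      then show ?thesis by (auto simp: less_Suc)
    next
      case False
      then have jk: "j \<sqsubset> k" by (simp add: ar.not_le)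
      with IH obtain n where n: "divides M n N" "\<And>x. x \<sqsubset> k \<Longrightarrow> ?P j n x"
        using less_irrefl less_trans by blast
      show ?thesis
      proof (cases "j \<in> X")
        case False
        then have "?P (j \<oplus> \<one>) n x" if "x \<sqsubset> k" for x
          using n(2)[OF that] by (auto simp: less_Suc le_def)
        with n(1) show ?thesis by blast
      next
        case True
        \<comment> \<open>The modulus of \<open>j\<close> divides \<open>N\<close> and is coprime to
          \<open>n\<close>, so it divides the quotient \<open>q\<close>; hence the enlarged product
          still divides \<open>N\<close>.\<close>
        obtain q where q: "N = n \<otimes> q" using n(1) by (auto simp: divides_def)
        have "cop (coef m j) n" using n(2)[OF jk] by (simp add: less_irrefl)
        moreover have "divides M (coef m j) (n \<otimes> q)" using N jk q by (simp add: multiple_def)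
        ultimately have "divides M (coef m j) q" by (rule cop_divides)
        then have "divides M (n \<otimes> coef m j) N" unfolding q by (auto simp: divides_def times_assoc)
        moreover have "?P (j \<oplus> \<one>) (n \<otimes> coef m j) x" if "x \<sqsubset> k" for x
        proof (cases "x = j")
          case True
          then show ?thesis using \<open>j \<in> X\<close> by (simp add: divides_dvd)
        next
          case False
          then have *: "x \<sqsubset> j \<oplus> \<one> \<longleftrightarrow> x \<sqsubset> j" by (auto simp: less_Suc le_def)
          have "cop (coef m x) (coef m j)" using coef_cop[OF m that jk False] .
          with n(2)[OF that] show ?thesis
            unfolding * by (auto simp: divides_dvd intro: cop_mult)
        qed
        ultimately show ?thesis by blast
      qed
    qed
  qed
  then obtain n where n: "divides M n N" "\<And>x. x \<sqsubset> k \<Longrightarrow> ?P k n x"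
    using less_irrefl by blast
  show ?thesis
  proof (intro exI conjI allI impI)
    show "n \<sqsubseteq> N" using n(1) N divides_le by (simp add: multiple_def)
    fix x assume x: "x \<sqsubset> k"
    show "divides M (coef m x) n \<longleftrightarrow> x \<in> X"
    proof (cases "x \<in> X")
      case True
      then show ?thesis using n(2)[OF x] x by simp
    next
      case False
      then have c: "cop (coef m x) n" using n(2)[OF x] by simp
      have "\<not> divides M (coef m x) n"
        using cop_divides[OF c, of \<one>] coef_not_unit m by (auto simp: modulus_def)
      with False show ?thesis by simp
    qed
  qed
qed

section \<open>Definability and bounds for codes of finite sets\<close>

lemma fset_triple:
  "fset M (pair M k (pair M m n)) = {x. x \<sqsubset> k \<and> divides M (coef m x) n}"
  by (auto simp: fset_def coef_def)

lemma in_fset: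
  "x \<in> fset M s \<longleftrightarrow> (\<exists>k. k \<sqsubseteq> s \<and> (\<exists>m. m \<sqsubseteq> s \<and> (\<exists>n. n \<sqsubseteq> s \<and>
    s = pair M k (pair M m n) \<and> x \<sqsubset> k \<and> divides M (coef m x) n)))"
proof -
  have "k \<sqsubseteq> pair M k (pair M m n)" "m \<sqsubseteq> pair M k (pair M m n)" "n \<sqsubseteq> pair M k (pair M m n)" for k m n
    using pair_ge1 pair_ge2 ar.order_trans by blast+
  then show ?thesis unfolding fset_def coef_def by blast
qed

lemma D0_in_fset: "term_def s \<Longrightarrow> term_def t \<Longrightarrow> D0 (\<lambda>e. s e \<in> fset M (t e))"
  unfolding in_fset by (intro D0_intros D0_divides term_coef term_shift)

lemma fset_less: "x \<in> fset M s \<Longrightarrow> x \<sqsubset> s"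
  using in_fset[of x s] ar.less_le_trans by blast

lemma fset_Sets: "fset M s \<in> Sets M"
  using D0_Sets[of "\<lambda>x. x \<in> fset M s"] by (simp add: D0_in_fset term_intros)

lemma D0_fset_le: "term_def s \<Longrightarrow> term_def t \<Longrightarrow> D0 (\<lambda>e. fset M (s e) \<subseteq> fset M (t e))"
proof (rule D0_cong)
  show "(\<forall>x. x \<sqsubset> s e \<longrightarrow> x \<in> fset M (s e) \<longrightarrow> x \<in> fset M (t e)) = (fset M (s e) \<subseteq> fset M (t e))" for e
    using fset_less by blast
qed (intro D0_intros D0_in_fset term_shift)

lemma D0_fset_code: "term_def s \<Longrightarrow> D0 (\<lambda>e. fset_code M (s e))"
  unfolding fset_code_def set_eq_subset by (intro D0_intros D0_fset_le term_shift)

text \<open>Such a \<open>B\<close> is at least every code of a set of numbers below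
  \<open>k\<close>. Being a bound of this form is \<open>D0\<close>, so a statement about all such
  codes becomes a bounded search once \<open>B\<close> is given.\<close>

definition code_bound :: "'a \<Rightarrow> 'a \<Rightarrow> bool"
  where "code_bound k B \<longleftrightarrow> (\<exists>m. m \<sqsubseteq> B \<and> (\<exists>N. N \<sqsubseteq> B \<and>
    B = pair M k (pair M m N) \<and> modulus k m \<and> multiple k m N))"

lemma D0_code_bound: "term_def s \<Longrightarrow> term_def t \<Longrightarrow> D0 (\<lambda>e. code_bound (s e) (t e))"
  unfolding code_bound_def by (intro D0_intros D0_modulus D0_multiple term_shift)

lemma code_bound_ex: "\<exists>B. code_bound k B"
proof -
  obtain m where "modulus k m" using modulus_ex by blast
  moreover obtain N where "multiple k m N" using multiple_ex by blast
  moreover have "m \<sqsubseteq> pair M k (pair M m N)" "N \<sqsubseteq> pair M k (pair M m N)"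
    using pair_ge1 pair_ge2 ar.order_trans by blast+
  ultimately show ?thesis unfolding code_bound_def by blast
qed

lemma fset_code_ex_bounded:
  assumes "code_bound k B" "X \<in> Sets M"
  obtains s where "s \<sqsubseteq> B" "fset_code M s" "fset M s = {x \<in> X. x \<sqsubset> k}"
proof -
  obtain m N where B: "B = pair M k (pair M m N)" and mN: "modulus k m" "multiple k m N"
    using assms(1) by (auto simp: code_bound_def)
  obtain n where n: "n \<sqsubseteq> N" "\<forall>x. x \<sqsubset> k \<longrightarrow> (divides M (coef m x) n \<longleftrightarrow> x \<in> X)"
    using coded_product[OF mN assms(2)] by blast
  let ?t = "pair M k (pair M m n)"
  have "D0 (\<lambda>e. fset M (e 0) = fset M ?t)"
    unfolding set_eq_subset by (intro D0_intros D0_fset_le)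
  then obtain s where s: "fset M s = fset M ?t" "s \<sqsubseteq> ?t" "\<And>c. c \<sqsubset> s \<Longrightarrow> fset M c \<noteq> fset M ?t"
    by (rule D0_least[of "\<lambda>s. fset M s = fset M ?t" ?t]) auto
  show ?thesis
  proof (rule that)
    show "s \<sqsubseteq> B" using s(2) n(1) unfolding B by (meson ar.order_refl ar.order_trans pair_mono)
    show "fset_code M s" using s(1,3) by (simp add: fset_code_def)
    show "fset M s = {x \<in> X. x \<sqsubset> k}" using s(1) n(2) by (auto simp: fset_triple)
  qed
qed

lemma fset_code_ex:
  assumes "X \<in> Sets M"
  obtains s where "fset_code M s" "fset M s = {x \<in> X. x \<sqsubset> k}"
  using code_bound_ex fset_code_ex_bounded[OF _ assms] by metis

lemma fset_code_unique: "fset_code M s \<Longrightarrow> fset_code M t \<Longrightarrow> fset M s = fset M t \<Longrightarrow> s = t"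
  unfolding fset_code_def using less_total by metis

lemma fset_code_le:
  assumes "code_bound k B" "fset_code M s" "\<And>x. x \<in> fset M s \<Longrightarrow> x \<sqsubset> k"
  shows "s \<sqsubseteq> B"
proof -
  obtain t where t: "t \<sqsubseteq> B" "fset_code M t" "fset M t = {x \<in> fset M s. x \<sqsubset> k}"
    using fset_code_ex_bounded[OF assms(1) fset_Sets] by blast
  moreover have "fset M t = fset M s" using t(3) assms(3) by blast
  ultimately show ?thesis using fset_code_unique assms(2) by metis
qed

section \<open>Binary sequences and compactness\<close>

lemma D0_binary_seq: "term_def s \<Longrightarrow> term_def t \<Longrightarrow> D0 (\<lambda>e. binary_seq M (s e) (t e))"
proof (rule D0_cong)
  let ?b = "\<lambda>s l. fset_code M s \<and>
    (\<forall>z. z \<sqsubset> s \<longrightarrow> z \<in> fset M s \<longrightarrow> (\<exists>i. i \<sqsubset> l \<and> (z = pair M i \<zero> \<or> z = pair M i \<one>))) \<and>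
    (\<forall>i. i \<sqsubset> l \<longrightarrow> \<not> (pair M i \<zero> \<in> fset M s \<longleftrightarrow> pair M i \<one> \<in> fset M s))"
  show "?b (s e) (t e) = binary_seq M (s e) (t e)" for e
    unfolding binary_seq_def using fset_less by blast
qed (intro D0_intros D0_in_fset D0_fset_code term_shift)

text \<open>The bits at positions below \<open>l\<close> are thus cut out by the single number
  \<open>pair M l \<zero>\<close>, which serves below to truncate sequences and to bound their
  codes.\<close>

lemma pair_bit_less: "b = \<zero> \<or> b = \<one> \<Longrightarrow> pair M i b \<sqsubset> pair M l \<zero> \<longleftrightarrow> i \<sqsubset> l"
proof
  assume b: "b = \<zero> \<or> b = \<one>"
  then have b1: "b \<sqsubseteq> \<one>" by auto
  show "i \<sqsubset> l" if "pair M i b \<sqsubset> pair M l \<zero>"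
  proof (rule ccontr)
    assume "\<not> i \<sqsubset> l"
    then have "pair M l \<zero> \<sqsubseteq> pair M i b" by (intro pair_mono) (auto simp: ar.not_less)
    with that show False by (simp add: ar.not_less[symmetric])
  qed
  assume il: "i \<sqsubset> l"
  then have "i \<oplus> \<one> \<sqsubseteq> l" by (simp add: ar.less_iff_succ_less_eq)
  then have "(i \<oplus> \<one>) \<otimes> (i \<oplus> \<one>) \<oplus> i \<sqsubset> l \<otimes> l \<oplus> l"
    using il by (intro ar.add_le_less_mono ar.mult_mono) auto
  then have "pair M i \<one> \<sqsubset> pair M l \<zero>" by (simp add: pair_def)
  then show "pair M i b \<sqsubset> pair M l \<zero>"
    using pair_mono[OF ar.order_refl b1, of i] ar.le_less_trans by blast
qed

lemma binary_seqE:
  assumes "binary_seq M s l" "z \<in> fset M s"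
  obtains i where "i \<sqsubset> l" "z = pair M i \<zero> \<or> z = pair M i \<one>"
  using assms unfolding binary_seq_def by blast

lemma binary_seq_bit:
  "binary_seq M s l \<Longrightarrow> i \<sqsubset> l \<Longrightarrow> (pair M i \<zero> \<in> fset M s) \<longleftrightarrow> \<not> (pair M i \<one> \<in> fset M s)"
  unfolding binary_seq_def by blast

lemma binary_seq_less: "binary_seq M s l \<Longrightarrow> z \<in> fset M s \<Longrightarrow> z \<sqsubset> pair M l \<zero>"
  by (erule (1) binary_seqE) (metis pair_bit_less)

lemma binary_seq_ex:
  assumes "{p. A p} \<in> Sets M"
  obtains s where "binary_seq M s l" "\<And>i. i \<sqsubset> l \<Longrightarrow> pair M i \<one> \<in> fset M s \<longleftrightarrow> A i"
proof -
  let ?X = "{z. \<exists>i. i \<sqsubseteq> z \<and> ((z = pair M i \<one> \<and> A i) \<or> (z = pair M i \<zero> \<and> \<not> A i))}"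
  have "D0 (\<lambda>e. \<exists>i. i \<sqsubseteq> e 0 \<and> ((e 0 = pair M i \<one> \<and> i \<in> {p. A p}) \<or> (e 0 = pair M i \<zero> \<and> \<not> i \<in> {p. A p})))"
    using assms by (intro D0_intros)
  then have "?X \<in> Sets M"
    using D0_Sets[of "\<lambda>z. \<exists>i. i \<sqsubseteq> z \<and> ((z = pair M i \<one> \<and> A i) \<or> (z = pair M i \<zero> \<and> \<not> A i))"] by simp
  then obtain s where s: "fset_code M s" "fset M s = {z \<in> ?X. z \<sqsubset> pair M l \<zero>}"
    by (rule fset_code_ex)
  have in_s: "z \<in> fset M s \<longleftrightarrow> (\<exists>i. i \<sqsubset> l \<and> ((z = pair M i \<one> \<and> A i) \<or> (z = pair M i \<zero> \<and> \<not> A i)))" for z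
    unfolding s(2) using pair_bit_less[of \<one>] pair_bit_less[of \<zero>] pair_ge1 by auto
  have "\<zero> \<noteq> \<one>" using zero_less_one by auto
  show ?thesis
  proof (rule that)
    show "binary_seq M s l"
      unfolding binary_seq_def using s(1) \<open>\<zero> \<noteq> \<one>\<close> by (auto simp: in_s)
    show "pair M i \<one> \<in> fset M s \<longleftrightarrow> A i" if "i \<sqsubset> l" for i
      unfolding in_s using that \<open>\<zero> \<noteq> \<one>\<close> by auto
  qed
qed

lemma binary_seq_restrict:
  assumes "binary_seq M s l" "k \<sqsubseteq> l"
  obtains t where "binary_seq M t k" "fset M t \<subseteq> fset M s"
proof -
  obtain t where t: "fset_code M t" "fset M t = {z \<in> fset M s. z \<sqsubset> pair M k \<zero>}"
    by (rule fset_code_ex[OF fset_Sets])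
  have in_t: "pair M i b \<in> fset M t \<longleftrightarrow> i \<sqsubset> k \<and> pair M i b \<in> fset M s" if "b = \<zero> \<or> b = \<one>" for i b
    using t(2) pair_bit_less[OF that] by auto
  have "binary_seq M t k"
    unfolding binary_seq_def
  proof (intro conjI ballI allI impI)
    fix z assume "z \<in> fset M t"
    then have "z \<in> fset M s" "z \<sqsubset> pair M k \<zero>" using t(2) by auto
    then show "\<exists>i. i \<sqsubset> k \<and> (z = pair M i \<zero> \<or> z = pair M i \<one>)"
      using binary_seqE[OF assms(1)] pair_bit_less by metis
  next
    fix i assume i: "i \<sqsubset> k"
    then have "i \<sqsubset> l" using assms(2) ar.less_le_trans by blast
    then show "(pair M i \<zero> \<in> fset M t) \<noteq> (pair M i \<one> \<in> fset M t)"
      using i binary_seq_bit[OF assms(1)] by (simp add: in_t)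
  qed (rule t(1))
  then show ?thesis using that t(2) by blast
qed

lemma binary_seq_subset_le:
  assumes "binary_seq M s l" "binary_seq M t k" "fset M t \<subseteq> fset M s"
  shows "k \<sqsubseteq> l"
proof (rule ccontr)
  assume "\<not> k \<sqsubseteq> l"
  then have "l \<sqsubset> k" by (simp add: ar.not_le)
  then obtain b where b: "b = \<zero> \<or> b = \<one>" "pair M l b \<in> fset M t"
    using binary_seq_bit[OF assms(2)] by metis
  then have "pair M l b \<sqsubset> pair M l \<zero>" using binary_seq_less[OF assms(1)] assms(3) by blast
  then show False using pair_bit_less[OF b(1)] less_irrefl by blast
qed

lemma binary_seq_length: "binary_seq M s l \<Longrightarrow> binary_seq M s k \<Longrightarrow> k = l"
  using binary_seq_subset_le[of s l s k] binary_seq_subset_le[of s k s l] ar.order_antisym by blast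

lemma binary_seq_bits:
  assumes "binary_seq M s l" "binary_seq M t k" "fset M t \<subseteq> fset M s" "i \<sqsubset> k"
  shows "pair M i \<one> \<in> fset M t \<longleftrightarrow> pair M i \<one> \<in> fset M s"
  using assms binary_seq_bit[OF assms(1), of i] binary_seq_bit[OF assms(2), of i]
    binary_seq_subset_le[OF assms(1-3)] ar.less_le_trans by blast

lemma binary_seq_subset:
  assumes "binary_seq M s l" "binary_seq M t k" "k \<sqsubseteq> l"
    "\<And>i. i \<sqsubset> k \<Longrightarrow> pair M i \<one> \<in> fset M t \<longleftrightarrow> pair M i \<one> \<in> fset M s"
  shows "fset M t \<subseteq> fset M s"
proof
  fix z assume z: "z \<in> fset M t"
  obtain i where i: "i \<sqsubset> k" "z = pair M i \<zero> \<or> z = pair M i \<one>" by (rule binary_seqE[OF assms(2) z])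
  have "i \<sqsubset> l" using i(1) assms(3) ar.less_le_trans by blast
  with i z show "z \<in> fset M s"
    using assms(4)[OF i(1)] binary_seq_bit[OF assms(1)] binary_seq_bit[OF assms(2)] by blast
qed

lemma binary_seq_eqI:
  assumes "binary_seq M s l" "binary_seq M t l" "fset M t \<subseteq> fset M s"
  shows "t = s"
proof (rule fset_code_unique)
  show "fset_code M t" "fset_code M s" using assms by (auto simp: binary_seq_def)
  have "fset M s \<subseteq> fset M t"
    using binary_seq_subset[OF assms(2,1)] binary_seq_bits[OF assms] by auto
  with assms(3) show "fset M t = fset M s" by blast
qed

lemma binary_seq_le:
  assumes "code_bound (pair M l \<zero>) B" "binary_seq M s k" "k \<sqsubseteq> l"
  shows "s \<sqsubseteq> B"
proof (rule fset_code_le[OF assms(1)])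
  show "fset_code M s" using assms(2) by (simp add: binary_seq_def)
  fix z assume "z \<in> fset M s"
  then have "z \<sqsubset> pair M k \<zero>" by (rule binary_seq_less[OF assms(2)])
  also have "\<dots> \<sqsubseteq> pair M l \<zero>" using assms(3) by (simp add: pair_mono)
  finally show "z \<sqsubset> pair M l \<zero>" .
qed

lemma binary_seq_ge: "binary_seq M s l \<Longrightarrow> l \<sqsubseteq> s"
proof (cases "l = \<zero>")
  case False
  assume s: "binary_seq M s l"
  obtain k where k: "l = k \<oplus> \<one>" using pred_ex False by blast
  then obtain b where "pair M k b \<in> fset M s"
    using binary_seq_bit[OF s, of k] less_Suc_self by metis
  then have "pair M k b \<sqsubset> s" by (rule fset_less)
  with pair_ge1[of k b] show ?thesis
    unfolding k by (metis ar.le_less_trans ar.less_iff_succ_less_eq)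
qed simp

text \<open>Weak Koenig's lemma as compactness: the tree consists of the sequences that satisfy
  \<open>\<Theta> k\<close> for all \<open>k\<close> up to their length. Asking this for every such
  \<open>k\<close> closes the tree under initial segments, locality transfers the conditions between
  a sequence and its extensions, and \<open>fin\<close> makes the tree infinite without any
  uniformity in \<open>l\<close>. The length is at most the code, so the tree is
  \<open>D0\<close>.\<close>

lemma WKL_compact:
  assumes "WKL M"
    and D0: "\<And>s t. term_def s \<Longrightarrow> term_def t \<Longrightarrow> D0 (\<lambda>e. \<Theta> (\<lambda>p. pair M p \<one> \<in> fset M (s e)) (t e))"
    and local: "\<And>A B l. (\<And>p. p \<sqsubset> l \<Longrightarrow> A p = B p) \<Longrightarrow> \<Theta> A l = \<Theta> B l"
    and fin: "\<And>l. \<exists>A. {p. A p} \<in> Sets M \<and> (\<forall>k. k \<sqsubseteq> l \<longrightarrow> \<Theta> A k)"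
  shows "\<exists>X\<in>Sets M. \<forall>l. \<Theta> (\<lambda>p. p \<in> X) l"
proof -
  let ?\<Theta> = "\<lambda>s. \<Theta> (\<lambda>p. pair M p \<one> \<in> fset M s)"
  define T where "T = {s. \<exists>l. l \<sqsubseteq> s \<and> binary_seq M s l \<and> (\<forall>k. k \<sqsubseteq> l \<longrightarrow> ?\<Theta> s k)}"
  have in_T: "s \<in> T \<longleftrightarrow> (\<exists>l. binary_seq M s l \<and> (\<forall>k. k \<sqsubseteq> l \<longrightarrow> ?\<Theta> s k))" for s
    unfolding T_def using binary_seq_ge by blast
  have "T \<in> Sets M"
    unfolding T_def by (rule D0_Sets) (intro D0_intros D0_binary_seq D0)
  moreover have "binary_tree M T"
    unfolding binary_tree_def
  proof (intro conjI ballI allI impI)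
    fix s assume "s \<in> T"
    then obtain l where l: "binary_seq M s l" "\<And>k. k \<sqsubseteq> l \<Longrightarrow> ?\<Theta> s k" unfolding in_T by blast
    then show "\<exists>l. binary_seq M s l" by blast
    fix t k assume t: "binary_seq M t k" "fset M t \<subseteq> fset M s"
    have kl: "k \<sqsubseteq> l" by (rule binary_seq_subset_le[OF l(1) t])
    have "?\<Theta> t j" if "j \<sqsubseteq> k" for j
    proof -
      have "?\<Theta> t j = ?\<Theta> s j"
        by (rule local) (meson that ar.less_le_trans binary_seq_bits[OF l(1) t])
      then show ?thesis using l(2) kl that ar.order_trans by blast
    qed
    with t(1) show "t \<in> T" unfolding in_T by blast
  qed
  moreover have "infinite_in M T"
    unfolding infinite_in_def
  proof
    fix k
    obtain A where A: "{p. A p} \<in> Sets M" "\<And>j. j \<sqsubseteq> k \<oplus> \<one> \<Longrightarrow> \<Theta> A j" using fin by blast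
    obtain s where s: "binary_seq M s (k \<oplus> \<one>)"
      "\<And>i. i \<sqsubset> k \<oplus> \<one> \<Longrightarrow> pair M i \<one> \<in> fset M s \<longleftrightarrow> A i"
      by (rule binary_seq_ex[OF A(1)]) (rule that)
    have "?\<Theta> s j" if "j \<sqsubseteq> k \<oplus> \<one>" for j
    proof -
      have "?\<Theta> s j = \<Theta> A j"
        by (rule local) (meson that ar.less_le_trans s(2))
      with A(2)[OF that] show ?thesis by simp
    qed
    with s(1) have "s \<in> T" unfolding in_T by blast
    moreover have "k \<sqsubset> s"
      using binary_seq_ge[OF s(1)] by (simp add: ar.less_iff_succ_less_eq)
    ultimately show "\<exists>x\<in>T. k \<sqsubset> x" by blast
  qed
  ultimately obtain F where F: "F \<in> Sets M" "infinite_path M T F"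
    using assms(1) unfolding WKL_def by blast
  let ?X = "{p. pair M p \<one> \<in> F}"
  have "?X \<in> Sets M" using F(1) by (intro D0_Sets D0_intros)
  moreover have "\<Theta> (\<lambda>p. p \<in> ?X) l" for l
  proof -
    obtain s where s: "s \<in> T" "binary_seq M s l" "fset M s \<subseteq> F"
      using F(2) unfolding infinite_path_def by blast
    obtain l' where "binary_seq M s l'" "\<And>k. k \<sqsubseteq> l' \<Longrightarrow> ?\<Theta> s k" using s(1) unfolding in_T by blast
    with s(2) have "?\<Theta> s l" using binary_seq_length by (metis ar.order_refl)
    moreover have "?\<Theta> s l = \<Theta> (\<lambda>p. p \<in> ?X) l"
    proof (rule local)
      fix p assume "p \<sqsubset> l"
      moreover have "(pair M p \<zero> \<in> F) \<noteq> (pair M p \<one> \<in> F)"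
        using F(2) unfolding infinite_path_def by blast
      ultimately show "(pair M p \<one> \<in> fset M s) = (p \<in> ?X)"
        using s(3) binary_seq_bit[OF s(2), of p] by blast
    qed
    ultimately show ?thesis by simp
  qed
  ultimately show ?thesis by blast
qed

end

section \<open>Extensions of partial orders\<close>

lemma partial_order_onI:
  assumes "r \<subseteq> P \<times> P" "\<And>x. x \<in> P \<Longrightarrow> (x, x) \<in> r"
    "\<And>x y z. (x, y) \<in> r \<Longrightarrow> (y, z) \<in> r \<Longrightarrow> (x, z) \<in> r"
    "\<And>x y. (x, y) \<in> r \<Longrightarrow> (y, x) \<in> r \<Longrightarrow> x = y"
  shows "partial_order_on P r"
  using assms unfolding partial_order_on_def preorder_on_def refl_on_def
  by (auto intro: transI antisymI)

lemma partial_order_onD: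
  assumes "partial_order_on P r"
  shows "\<And>x y. (x, y) \<in> r \<Longrightarrow> x \<in> P \<and> y \<in> P" "\<And>x. x \<in> P \<Longrightarrow> (x, x) \<in> r"
    "\<And>x y z. (x, y) \<in> r \<Longrightarrow> (y, z) \<in> r \<Longrightarrow> (x, z) \<in> r"
    "\<And>x y. (x, y) \<in> r \<Longrightarrow> (y, x) \<in> r \<Longrightarrow> x = y"
  using assms unfolding partial_order_on_def preorder_on_def refl_on_def
  by (auto dest: transD antisymD)

lemma linear_order_onI:
  assumes "r \<subseteq> P \<times> P" "\<And>x. x \<in> P \<Longrightarrow> (x, x) \<in> r"
    "\<And>x y z. (x, y) \<in> r \<Longrightarrow> (y, z) \<in> r \<Longrightarrow> (x, z) \<in> r"
    "\<And>x y. (x, y) \<in> r \<Longrightarrow> (y, x) \<in> r \<Longrightarrow> x = y"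
    "\<And>x y. x \<in> P \<Longrightarrow> y \<in> P \<Longrightarrow> (x, y) \<in> r \<or> (y, x) \<in> r"
  shows "linear_order_on P r"
proof -
  have "partial_order_on P r" by (rule partial_order_onI) (fact assms)+
  then show ?thesis using assms(5) unfolding linear_order_on_def total_on_def by blast
qed

lemma linear_order_onD:
  assumes "linear_order_on P r"
  shows "partial_order_on P r" "\<And>x y. x \<in> P \<Longrightarrow> y \<in> P \<Longrightarrow> (x, y) \<in> r \<or> (y, x) \<in> r"
proof -
  show po: "partial_order_on P r" using assms by (simp add: linear_order_on_def)
  show "(x, y) \<in> r \<or> (y, x) \<in> r" if "x \<in> P" "y \<in> P" for x y
    using assms partial_order_onD(2)[OF po] that unfolding linear_order_on_def total_on_def by metis
qed

text \<open>One passage through \<open>l\<close> suffices for transitivity: between two passages the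
  path goes by \<open>r\<close> from a point of \<open>S\<close> to a point of \<open>S\<close>, and
  there \<open>r\<close> is contained in \<open>l\<close>. A finite part \<open>S\<close> of
  \<open>Q\<close> will give a stage of the extension.\<close>

lemma partial_order_extend_suborder:
  assumes r: "partial_order_on P r" and l: "partial_order_on Q l" and "Restr r Q \<subseteq> l" "S \<subseteq> Q"
  shows "partial_order_on P
    {(x, y). (x, y) \<in> r \<or> (\<exists>p q. p \<in> S \<and> q \<in> S \<and> (x, p) \<in> r \<and> (p, q) \<in> l \<and> (q, y) \<in> r)}"
proof -
  note r = partial_order_onD[OF r] and l = partial_order_onD[OF l]
  have rl: "(x, y) \<in> l" if "(x, y) \<in> r" "x \<in> S" "y \<in> S" for x y using assms(3,4) that by blast
  define e where "e = (\<lambda>x y. \<exists>p q. p \<in> S \<and> q \<in> S \<and> (x, p) \<in> r \<and> (p, q) \<in> l \<and> (q, y) \<in> r)"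
  have ee: "e x z" if "e x y" "e y z" for x y z
  proof -
    obtain p q where pq: "p \<in> S" "q \<in> S" "(x, p) \<in> r" "(p, q) \<in> l" "(q, y) \<in> r"
      using \<open>e x y\<close> unfolding e_def by blast
    obtain p' q' where pq': "p' \<in> S" "q' \<in> S" "(y, p') \<in> r" "(p', q') \<in> l" "(q', z) \<in> r"
      using \<open>e y z\<close> unfolding e_def by blast
    have "(q, p') \<in> l" using rl r(3) pq pq' by blast
    then have "(p, q') \<in> l" using l(3) pq pq' by blast
    then show ?thesis unfolding e_def using pq pq' by blast
  qed
  have er: "e x z" if "e x y" "(y, z) \<in> r" for x y z using that r(3) unfolding e_def by blast
  have re: "e x z" if "(x, y) \<in> r" "e y z" for x y z using that r(3) unfolding e_def by blast
  have refl: "(x, y) \<in> r" if "e x y" "(y, x) \<in> r \<or> e y x" for x y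
  proof -
    obtain p q where pq: "p \<in> S" "q \<in> S" "(x, p) \<in> r" "(p, q) \<in> l" "(q, y) \<in> r"
      using \<open>e x y\<close> unfolding e_def by blast
    have "(q, p) \<in> l"
    proof (cases "(y, x) \<in> r")
      case True
      then show ?thesis using rl r(3) pq by blast
    next
      case False
      then obtain p' q' where pq': "p' \<in> S" "q' \<in> S" "(y, p') \<in> r" "(p', q') \<in> l" "(q', x) \<in> r"
        using \<open>(y, x) \<in> r \<or> e y x\<close> unfolding e_def by blast
      have "(q, p') \<in> l" "(q', p) \<in> l" using rl r(3) pq pq' by blast+
      then show ?thesis using l(3) pq' by blast
    qed
    with l(4) pq have "p = q" by blast
    with pq r(3) show ?thesis by blast
  qed
  have eq: "{(x, y). (x, y) \<in> r \<or> (\<exists>p q. p \<in> S \<and> q \<in> S \<and> (x, p) \<in> r \<and> (p, q) \<in> l \<and> (q, y) \<in> r)}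
      = {(x, y). (x, y) \<in> r \<or> e x y}"
    by (simp add: e_def)
  show ?thesis unfolding eq
  proof (rule partial_order_onI, goal_cases)
    case 1 then show ?case using r(1) unfolding e_def by blast
  next
    case (2 x) then show ?case using r(2) by blast
  next
    case (3 x y z)
    then have "(x, y) \<in> r \<or> e x y" "(y, z) \<in> r \<or> e y z" by simp_all
    then have "(x, z) \<in> r \<or> e x z" using r(3)[of x y z] ee[of x y z] er[of x y z] re[of x y z] by argo
    then show ?case by simp
  next
    case (4 x y)
    then have "(x, y) \<in> r \<or> e x y" "(y, x) \<in> r \<or> e y x" by simp_all
    then show ?case using r(4)[of x y] refl[of x y] refl[of y x] by argo
  qed
qed

text \<open>
  The elements of \<open>C\<close> are pushed down and those of \<open>D\<close> are pushed up.  Comparing the upper sets of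
  \<open>x\<close> and \<open>y\<close> in \<open>C\<close>, and their lower sets in \<open>D\<close>, gives the transitive closure in one step.
\<close>

definition push :: "'a rel \<Rightarrow> 'a set \<Rightarrow> 'a set \<Rightarrow> 'a set \<Rightarrow> 'a rel"
  where "push r P C D = {(x, y). (x, y) \<in> r \<or> (x \<in> P \<and> y \<in> P \<and>
    ((\<exists>c\<in>C. (x, c) \<in> r \<and> (y, c) \<notin> r) \<or> (\<exists>d\<in>D. (d, y) \<in> r \<and> (d, x) \<notin> r)))}"

text \<open>Along a chain the upper sets of two points are nested, so \<open>cl\<close> compares
  them strictly, and likewise \<open>dl\<close> the lower sets. Each relation alone is transitive
  and irreflexive; their interaction is controlled by incomparability.\<close>

lemma partial_order_push:
  assumes r: "partial_order_on P r" and "chain_in P r C" "chain_in P r D" "incomparable r C D"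
  shows "partial_order_on P (push r P C D)"
proof -
  note r = partial_order_onD[OF r]
  have C: "(c, d) \<in> r \<or> (d, c) \<in> r" if "c \<in> C" "d \<in> C" for c d
    using assms(2) that unfolding chain_in_def Chains_def by blast
  have D: "(c, d) \<in> r \<or> (d, c) \<in> r" if "c \<in> D" "d \<in> D" for c d
    using assms(3) that unfolding chain_in_def Chains_def by blast
  have CD: "(c, d) \<notin> r \<and> (d, c) \<notin> r" if "c \<in> C" "d \<in> D" for c d
    using assms(4) that unfolding incomparable_def by blast
  define cl where "cl = (\<lambda>x y. \<exists>c\<in>C. (x, c) \<in> r \<and> (y, c) \<notin> r)"
  define dl where "dl = (\<lambda>x y. \<exists>d\<in>D. (d, y) \<in> r \<and> (d, x) \<notin> r)"
  have push: "(x, y) \<in> push r P C D \<longleftrightarrow> (x, y) \<in> r \<or> (x \<in> P \<and> y \<in> P \<and> (cl x y \<or> dl x y))" for x y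
    by (simp add: push_def cl_def dl_def)
  have cc: "cl x z" if xy: "cl x y" and yz: "cl y z" for x y z
  proof -
    obtain c where c: "c \<in> C" "(x, c) \<in> r" "(y, c) \<notin> r" using xy unfolding cl_def by blast
    obtain c' where c': "c' \<in> C" "(y, c') \<in> r" "(z, c') \<notin> r" using yz unfolding cl_def by blast
    have "(c, c') \<in> r" using C[OF c(1) c'(1)] r(3)[OF c'(2), of c] c(3) by blast
    then have "(x, c') \<in> r" by (rule r(3)[OF c(2)])
    with c' show ?thesis unfolding cl_def by blast
  qed
  have dd: "dl x z" if xy: "dl x y" and yz: "dl y z" for x y z
  proof -
    obtain d where d: "d \<in> D" "(d, y) \<in> r" "(d, x) \<notin> r" using xy unfolding dl_def by blast
    obtain d' where d': "d' \<in> D" "(d', z) \<in> r" "(d', y) \<notin> r" using yz unfolding dl_def by blast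
    have "(d, d') \<in> r" using D[OF d(1) d'(1)] r(3)[OF _ d(2), of d'] d'(3) by blast
    then have "(d, z) \<in> r" using d'(2) by (rule r(3))
    with d show ?thesis unfolding dl_def by blast
  qed
  have ci: "\<not> cl x x" "\<not> dl x x" for x unfolding cl_def dl_def by auto
  have cr: "cl x y \<Longrightarrow> (y, z) \<in> r \<Longrightarrow> cl x z" "(x, y) \<in> r \<Longrightarrow> cl y z \<Longrightarrow> cl x z" for x y z
    unfolding cl_def using r(3) by meson+
  have dr: "dl x y \<Longrightarrow> (y, z) \<in> r \<Longrightarrow> dl x z" "(x, y) \<in> r \<Longrightarrow> dl y z \<Longrightarrow> dl x z" for x y z
    unfolding dl_def using r(3) by meson+
  \<comment> \<open>A point of \<open>D\<close> below some point that lies below a point of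
    \<open>C\<close> would make \<open>C\<close> and \<open>D\<close> comparable. This rules out
    \<open>dl\<close> followed by \<open>cl\<close>, and it composes the two in the other
    order.\<close>
  have cd: "cl x y \<Longrightarrow> dl y z \<Longrightarrow> cl x z \<or> dl x z" "dl x y \<Longrightarrow> \<not> cl y z" for x y z
    unfolding cl_def dl_def using r(3) CD by meson+
  show ?thesis
  proof (rule partial_order_onI, goal_cases)
    case 1 then show ?case using r(1) push by auto
  next
    case (2 x) then show ?case using r(2) push by blast
  next
    case (3 x y z)
    then show ?case unfolding push using r(1,3) cc dd cr dr cd by meson
  next
    case (4 x y)
    have "\<not> ((cl x y \<or> dl x y) \<and> ((y, x) \<in> r \<or> cl y x \<or> dl y x))"
      using cc dd ci cr dr cd by meson
    moreover have "\<not> ((cl y x \<or> dl y x) \<and> ((x, y) \<in> r \<or> cl x y \<or> dl x y))"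
      using cc dd ci cr dr cd by meson
    ultimately show ?case using 4 r(4) unfolding push by meson
  qed
qed

context rca
begin

text \<open>
  Order points by the characteristic functions of their lower sets, lexicographically: this is a
  linear extension that is definable without recursion.
\<close>

definition lex_below :: "('a \<Rightarrow> 'a \<Rightarrow> bool) \<Rightarrow> 'a \<Rightarrow> 'a \<Rightarrow> bool"
  where "lex_below le' x y \<longleftrightarrow> x = y \<or> (\<exists>z. z \<sqsubseteq> x \<oplus> y \<and> le' z y \<and> \<not> le' z x \<and>
    (\<forall>w. w \<sqsubset> z \<longrightarrow> (le' w x \<longleftrightarrow> le' w y)))"

text \<open>By antisymmetry the lower sets of distinct \<open>x\<close>, \<open>y\<close> differ at
  \<open>x\<close> or at \<open>y\<close>, so they have a first difference, at most
  \<open>x \<oplus> y\<close>. If \<open>x\<close> is below \<open>y\<close>, its lower set is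
  included in that of \<open>y\<close>, so the first difference favours \<open>y\<close>.\<close>

lemma linear_order_lex:
  assumes po: "partial_order_on P {(x, y). le' x y}"
    and D0: "\<And>s t. term_def s \<Longrightarrow> term_def t \<Longrightarrow> D0 (\<lambda>e. le' (s e) (t e))"
  shows "linear_order_on P {(x, y). x \<in> P \<and> y \<in> P \<and> lex_below le' x y}"
    and "le' x y \<Longrightarrow> lex_below le' x y"
proof -
  note r = partial_order_onD[OF po, unfolded mem_Collect_eq case_prod_conv]
  define lt where "lt = (\<lambda>z x y. le' z y \<and> \<not> le' z x \<and> (\<forall>w. w \<sqsubset> z \<longrightarrow> (le' w x \<longleftrightarrow> le' w y)))"
  have diff: "\<exists>z. z \<sqsubseteq> x \<oplus> y \<and> (lt z x y \<or> lt z y x)" if "x \<in> P" "y \<in> P" "x \<noteq> y" for x y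
  proof -
    have "(le' x x \<noteq> le' x y) \<or> (le' y x \<noteq> le' y y)"
      using r(2,4) that by blast
    then obtain u where u: "u \<sqsubseteq> x \<oplus> y" "le' u x \<noteq> le' u y" using le_plus1 le_plus2 by metis
    have "D0 (\<lambda>e. \<not> (le' (e 0) x \<longleftrightarrow> le' (e 0) y))" by (intro D0_intros D0)
    then obtain z where z: "\<not> (le' z x \<longleftrightarrow> le' z y)" "z \<sqsubseteq> u" "\<And>c. c \<sqsubset> z \<Longrightarrow> \<not> \<not> (le' c x \<longleftrightarrow> le' c y)"
      by (rule D0_least[of "\<lambda>z. \<not> (le' z x \<longleftrightarrow> le' z y)" u]) (use u in auto)
    with u(1) show ?thesis unfolding lt_def by (meson ar.order_trans)
  qed
  have lex: "lex_below le' x y \<longleftrightarrow> x = y \<or> (\<exists>z. lt z x y)" if "x \<in> P" "y \<in> P" for x y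
  proof -
    have "\<exists>z. z \<sqsubseteq> x \<oplus> y \<and> lt z x y" if z: "lt z x y" and "x \<noteq> y" for z
    proof -
      obtain v where v: "v \<sqsubseteq> x \<oplus> y" "lt v x y \<or> lt v y x"
        using diff \<open>x \<in> P\<close> \<open>y \<in> P\<close> \<open>x \<noteq> y\<close> by blast
      then have "z \<sqsubseteq> v" using z unfolding lt_def by (metis ar.not_le)
      with v(1) z show ?thesis using ar.order_trans by blast
    qed
    moreover have "lex_below le' x y \<longleftrightarrow> x = y \<or> (\<exists>z. z \<sqsubseteq> x \<oplus> y \<and> lt z x y)"
      by (simp add: lex_below_def lt_def)
    ultimately show ?thesis by blast
  qed
  have asym: "\<not> lt z' y x" if "lt z x y" for z z' x y
    using that less_total[of z z'] unfolding lt_def by blast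
  have trans: "\<exists>z. lt z x w" if "lt z1 x y" "lt z2 y w" for z1 z2 x y w
    using that less_total[of z1 z2] unfolding lt_def by (metis less_trans)
  have ext: "x = y \<or> (\<exists>z. lt z x y)" if xy: "le' x y" for x y
  proof (cases "x = y")
    case False
    then obtain z where "lt z x y \<or> lt z y x" using diff r(1)[OF xy] by blast
    then show ?thesis using r(3)[OF _ xy] unfolding lt_def by blast
  qed simp
  then show "le' x y \<Longrightarrow> lex_below le' x y" using lex r(1) by blast
  show "linear_order_on P {(x, y). x \<in> P \<and> y \<in> P \<and> lex_below le' x y}"
  proof (rule linear_order_onI, goal_cases)
    case (3 x y z)
    then show ?case using trans lex by auto metis
  next
    case (4 x y)
    then show ?case using asym lex by auto
  next
    case (5 x y)
    then show ?case using diff lex by auto metis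
  qed (auto simp: lex_below_def)
qed

lemma upper_bound_ex: "finite S \<Longrightarrow> \<exists>l. \<forall>a\<in>S. a \<sqsubset> l"
proof (induction S rule: finite_induct)
  case (insert a S)
  then obtain l where "\<forall>a\<in>S. a \<sqsubset> l" by blast
  then have "\<forall>b\<in>insert a S. b \<sqsubset> l \<oplus> a \<oplus> \<one>"
    using le_plus1 le_plus2 by (auto simp: less_Suc) (metis ar.less_imp_le ar.order_trans le_plus1)
  then show ?case by blast
qed simp

text \<open>\<open>\<Theta> A l\<close> collects the axioms of linear orders extending stage
  \<open>l\<close>, for all indices at once, and mentions only indices, points and codes below
  \<open>l\<close>. Hence it depends on \<open>A\<close> below \<open>l\<close> only, and
  compactness applies to the single set \<open>A\<close> coding the whole family.\<close>

lemma uniform_linear_extension: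
  fixes ord :: "'a \<Rightarrow> 'a \<Rightarrow> 'a \<Rightarrow> 'a \<Rightarrow> bool"
  assumes WKL: "WKL M" and P: "P \<in> Sets M"
    and D0: "\<And>s t u v. term_def s \<Longrightarrow> term_def t \<Longrightarrow> term_def u \<Longrightarrow> term_def v
      \<Longrightarrow> D0 (\<lambda>e. ord (s e) (t e) (u e) (v e))"
    and po: "\<And>l i. i \<sqsubset> n \<Longrightarrow> partial_order_on P {(x, y). ord l i x y}"
    and mono: "\<And>l l' i x y. l \<sqsubseteq> l' \<Longrightarrow> ord l i x y \<Longrightarrow> ord l' i x y"
  shows "\<exists>K\<in>Sets M. \<forall>i. i \<sqsubset> n \<longrightarrow> linear_order_on P (rel M (fiber M K i)) \<and>
    (\<forall>l x y. ord l i x y \<longrightarrow> (x, y) \<in> rel M (fiber M K i))"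
proof -
  let ?p = "\<lambda>i x y. pair M i (pair M x y)"
  define \<Theta> where "\<Theta> = (\<lambda>A l. \<forall>i. i \<sqsubset> l \<longrightarrow> i \<sqsubset> n \<longrightarrow> (\<forall>x. x \<sqsubset> l \<longrightarrow> x \<in> P \<longrightarrow> (\<forall>y. y \<sqsubset> l \<longrightarrow> y \<in> P \<longrightarrow>
    (?p i x y \<sqsubset> l \<longrightarrow> ord l i x y \<longrightarrow> A (?p i x y)) \<and>
    (?p i x y \<sqsubset> l \<longrightarrow> ?p i y x \<sqsubset> l \<longrightarrow> (A (?p i x y) \<or> A (?p i y x)) \<and>
      (A (?p i x y) \<longrightarrow> A (?p i y x) \<longrightarrow> x = y)) \<and>
    (\<forall>z. z \<sqsubset> l \<longrightarrow> z \<in> P \<longrightarrow> ?p i x y \<sqsubset> l \<longrightarrow> ?p i y z \<sqsubset> l \<longrightarrow> ?p i x z \<sqsubset> l \<longrightarrow>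
      A (?p i x y) \<longrightarrow> A (?p i y z) \<longrightarrow> A (?p i x z)))))"
  have "\<exists>X\<in>Sets M. \<forall>l. \<Theta> (\<lambda>p. p \<in> X) l"
  proof (rule WKL_compact[OF WKL])
    show "D0 (\<lambda>e. \<Theta> (\<lambda>p. pair M p \<one> \<in> fset M (s e)) (t e))" if "term_def s" "term_def t" for s t
      unfolding \<Theta>_def using that by (intro D0_intros D0 D0_in_fset term_shift P)
    show "\<Theta> A l = \<Theta> B l" if "\<And>p. p \<sqsubset> l \<Longrightarrow> A p = B p" for A B l
      unfolding \<Theta>_def by (simp add: that cong: imp_cong conj_cong)
    fix l
    \<comment> \<open>One family serves all \<open>k \<sqsubseteq> l\<close>: a linear extension of
      stage \<open>l\<close> extends every earlier stage by monotonicity.\<close>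
    let ?A = "\<lambda>p. \<exists>i. i \<sqsubseteq> p \<and> i \<sqsubset> n \<and> (\<exists>x. x \<sqsubseteq> p \<and> (\<exists>y. y \<sqsubseteq> p \<and> p = ?p i x y \<and>
      x \<in> P \<and> y \<in> P \<and> lex_below (ord l i) x y))"
    have A: "?A (?p i x y) \<longleftrightarrow> i \<sqsubset> n \<and> x \<in> P \<and> y \<in> P \<and> lex_below (ord l i) x y" for i x y
    proof -
      have "i \<sqsubseteq> ?p i x y" "x \<sqsubseteq> ?p i x y" "y \<sqsubseteq> ?p i x y"
        using pair_ge1 pair_ge2 ar.order_trans by blast+
      then show ?thesis by auto
    qed
    have "{p. ?A p} \<in> Sets M"
      unfolding lex_below_def by (intro D0_Sets D0_intros D0 P term_shift)
    moreover have "\<Theta> ?A k" if "k \<sqsubseteq> l" for k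
    proof -
      have lin: "linear_order_on P {(x, y). x \<in> P \<and> y \<in> P \<and> lex_below (ord l i) x y}"
        and ext: "\<And>x y. ord l i x y \<Longrightarrow> lex_below (ord l i) x y" if "i \<sqsubset> n" for i
        using linear_order_lex[OF po[OF that], of l] by (simp_all add: D0 term_const)
      have lex: "lex_below (ord l i) x y \<or> lex_below (ord l i) y x"
        "lex_below (ord l i) x y \<Longrightarrow> lex_below (ord l i) y x \<Longrightarrow> x = y"
        "lex_below (ord l i) x y \<Longrightarrow> lex_below (ord l i) y z \<Longrightarrow> lex_below (ord l i) x z"
        if "i \<sqsubset> n" "x \<in> P" "y \<in> P" "z \<in> P" for i x y z
        using linear_order_onD(2)[OF lin[OF that(1)], of x y]
          partial_order_onD(4)[OF linear_order_onD(1)[OF lin[OF that(1)]], of x y]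
          partial_order_onD(3)[OF linear_order_onD(1)[OF lin[OF that(1)]], of x y z] that
        by blast+
      show ?thesis
        unfolding \<Theta>_def A using ext mono[OF that] lex by (intro allI impI conjI) blast+
    qed
    ultimately show "\<exists>A. {p. A p} \<in> Sets M \<and> (\<forall>k. k \<sqsubseteq> l \<longrightarrow> \<Theta> A k)" by (intro exI conjI) auto
  qed
  then obtain X where X: "X \<in> Sets M" "\<And>l. \<Theta> (\<lambda>p. p \<in> X) l" by blast
  have XE: "(ord l0 i x y \<longrightarrow> ?p i x y \<in> X) \<and> (?p i x y \<in> X \<or> ?p i y x \<in> X) \<and>
      (?p i x y \<in> X \<longrightarrow> ?p i y x \<in> X \<longrightarrow> x = y) \<and>
      (?p i x y \<in> X \<longrightarrow> ?p i y z \<in> X \<longrightarrow> ?p i x z \<in> X)"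
    if "i \<sqsubset> n" "x \<in> P" "y \<in> P" "z \<in> P" for i x y z l0
  proof -
    obtain l where "\<forall>a\<in>{l0, i, x, y, z, ?p i x y, ?p i y x, ?p i y z, ?p i x z}. a \<sqsubset> l"
      using upper_bound_ex by (metis finite.emptyI finite.insertI)
    then have l: "l0 \<sqsubseteq> l" "i \<sqsubset> l" "x \<sqsubset> l" "y \<sqsubset> l" "z \<sqsubset> l" "?p i x y \<sqsubset> l" "?p i y x \<sqsubset> l"
      "?p i y z \<sqsubset> l" "?p i x z \<sqsubset> l" by auto
    then show ?thesis
      using X(2)[of l, unfolded \<Theta>_def, rule_format, OF l(2) that(1) l(3) that(2) l(4) that(3)]
        mono[OF l(1), of i x y] that(4) by blast
  qed
  \<comment> \<open>The conditions say nothing about codes of points outside \<open>P\<close>, so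
    these are discarded from \<open>X\<close>.\<close>
  let ?K = "{p. \<exists>i. i \<sqsubseteq> p \<and> (\<exists>x. x \<sqsubseteq> p \<and> (\<exists>y. y \<sqsubseteq> p \<and> p = ?p i x y \<and> x \<in> P \<and> y \<in> P \<and> p \<in> X))}"
  have K: "(x, y) \<in> rel M (fiber M ?K i) \<longleftrightarrow> x \<in> P \<and> y \<in> P \<and> ?p i x y \<in> X" for i x y
  proof -
    have "i \<sqsubseteq> ?p i x y" "x \<sqsubseteq> ?p i x y" "y \<sqsubseteq> ?p i x y"
      using pair_ge1 pair_ge2 ar.order_trans by blast+
    then show ?thesis by (auto simp: in_rel in_fiber)
  qed
  have "?K \<in> Sets M" by (intro D0_Sets D0_intros P X(1) term_shift)
  moreover have "linear_order_on P (rel M (fiber M ?K i)) \<and>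
    (\<forall>l x y. ord l i x y \<longrightarrow> (x, y) \<in> rel M (fiber M ?K i))" if i: "i \<sqsubset> n" for i
  proof
    note XE = XE[OF i]
    show "linear_order_on P (rel M (fiber M ?K i))"
    proof (rule linear_order_onI)
      show "rel M (fiber M ?K i) \<subseteq> P \<times> P" using K by auto
    qed (use K XE in blast)+
    show "\<forall>l x y. ord l i x y \<longrightarrow> (x, y) \<in> rel M (fiber M ?K i)"
      using K XE partial_order_onD(1)[OF po[OF i], unfolded mem_Collect_eq case_prod_conv] by blast
  qed
  ultimately show ?thesis by blast
qed

section \<open>Dimension bounds from weak Koenig's lemma\<close>

text \<open>If \<open>x\<close> is not below \<open>y\<close>, some order must put \<open>y\<close>
  below \<open>x\<close>. For two points of \<open>Q\<close> the extension of an old order does. If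
  \<open>x\<close> was removed, the order that pushes up a chain containing \<open>x\<close> does,
  with \<open>x\<close> itself as the witness \<open>d\<close>; if \<open>y\<close> was removed, the
  order that pushes down a chain containing \<open>y\<close> does, with
  \<open>c = y\<close>.\<close>

lemma dim_bound:
  assumes WKL: "WKL M" and Sets: "P \<in> Sets M" "R \<in> Sets M" "Q \<in> Sets M" "L \<in> Sets M" "Lo \<in> Sets M" "Hi \<in> Sets M"
    and po: "partial_order_on P (rel M R)" and "Q \<subseteq> P" and "m \<noteq> \<zero>"
    and L: "realization M Q (Restr (rel M R) Q) m L"
    and Lo: "\<And>j. j \<sqsubset> k \<Longrightarrow> chain_in P (rel M R) (fiber M Lo j)"
    and Hi: "\<And>j. j \<sqsubset> k \<Longrightarrow> chain_in P (rel M R) (fiber M Hi j)"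
    and inc: "\<And>j. j \<sqsubset> k \<Longrightarrow> incomparable (rel M R) (fiber M Lo j) (fiber M Hi j)"
    and cover: "\<And>c. c \<in> P \<Longrightarrow> c \<notin> Q \<Longrightarrow> (\<exists>j. j \<sqsubset> k \<and> c \<in> fiber M Lo j) \<and> (\<exists>j. j \<sqsubset> k \<and> c \<in> fiber M Hi j)"
  shows "\<exists>K\<in>Sets M. realization M P (rel M R) (m \<oplus> k) K"
proof -
  let ?r = "rel M R"
  note r = partial_order_onD[OF po]
  define old where "old = (\<lambda>l i x y. pair M x y \<in> R \<or> (\<exists>p. p \<sqsubset> l \<and> (\<exists>q. q \<sqsubset> l \<and> p \<in> Q \<and> q \<in> Q \<and>
    pair M x p \<in> R \<and> pair M i (pair M p q) \<in> L \<and> pair M q y \<in> R)))"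
  define new where "new = (\<lambda>l j x y. pair M x y \<in> R \<or> (x \<in> P \<and> y \<in> P \<and>
    ((\<exists>c. c \<sqsubset> l \<and> pair M j c \<in> Lo \<and> pair M x c \<in> R \<and> pair M y c \<notin> R) \<or>
     (\<exists>d. d \<sqsubset> l \<and> pair M j d \<in> Hi \<and> pair M d y \<in> R \<and> pair M d x \<notin> R))))"
  define ord where "ord = (\<lambda>l i x y. (i \<sqsubset> m \<and> old l i x y) \<or> (\<exists>j. j \<sqsubseteq> i \<and> i = m \<oplus> j \<and> new l j x y))"
  have ord_old: "ord l i x y \<longleftrightarrow> old l i x y" if "i \<sqsubset> m" for l i x y
  proof -
    have "i \<noteq> m \<oplus> j" for j using that le_plus1[of m j] by (metis ar.not_le)
    with that show ?thesis unfolding ord_def by blast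
  qed
  have ord_new: "ord l (m \<oplus> j) x y \<longleftrightarrow> new l j x y" for l j x y
    unfolding ord_def using ar.not_le[of m "m \<oplus> j"] by auto
  have index: "i \<sqsubset> m \<or> (\<exists>j. j \<sqsubset> k \<and> i = m \<oplus> j)" if "i \<sqsubset> m \<oplus> k" for i
  proof (cases "i \<sqsubset> m")
    case False
    then obtain j where "i = m \<oplus> j" using le_iff_plus by (metis ar.not_less)
    with that show ?thesis by simp
  qed simp
  have lin: "linearization Q (Restr ?r Q) (rel M (fiber M L i))" if "i \<sqsubset> m" for i
    using L that unfolding realization_def by blast
  have "\<exists>K\<in>Sets M. \<forall>i. i \<sqsubset> m \<oplus> k \<longrightarrow> linear_order_on P (rel M (fiber M K i)) \<and>
    (\<forall>l x y. ord l i x y \<longrightarrow> (x, y) \<in> rel M (fiber M K i))"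
  proof (rule uniform_linear_extension[OF WKL Sets(1)])
    show "D0 (\<lambda>e. ord (s e) (t e) (u e) (v e))"
      if "term_def s" "term_def t" "term_def u" "term_def v" for s t u v
      unfolding ord_def old_def new_def using that Sets by (intro D0_intros term_shift)
    show "ord l' i x y" if "l \<sqsubseteq> l'" "ord l i x y" for l l' i x y
    proof -
      have less: "p \<sqsubset> l'" if "p \<sqsubset> l" for p using that \<open>l \<sqsubseteq> l'\<close> by (rule ar.less_le_trans)
      have "old l i x y \<Longrightarrow> old l' i x y" unfolding old_def using less by meson
      moreover have "new l j x y \<Longrightarrow> new l' j x y" for j unfolding new_def using less by meson
      ultimately show ?thesis using that(2) unfolding ord_def by blast
    qed
    fix l i assume "i \<sqsubset> m \<oplus> k"
    then consider "i \<sqsubset> m" | j where "j \<sqsubset> k" "i = m \<oplus> j" using index by blast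
    then show "partial_order_on P {(x, y). ord l i x y}"
    proof cases
      case 1
      have "{(x, y). ord l i x y} = {(x, y). (x, y) \<in> ?r \<or>
        (\<exists>p q. p \<in> {p \<in> Q. p \<sqsubset> l} \<and> q \<in> {p \<in> Q. p \<sqsubset> l} \<and> (x, p) \<in> ?r \<and> (p, q) \<in> rel M (fiber M L i) \<and> (q, y) \<in> ?r)}"
        unfolding ord_old[OF 1] by (auto simp: old_def in_rel in_fiber)
      then show ?thesis
        using partial_order_extend_suborder[OF po, of Q "rel M (fiber M L i)" "{p \<in> Q. p \<sqsubset> l}"] lin[OF 1]
        unfolding linearization_def linear_order_on_def by auto
    next
      case 2
      let ?C = "{c \<in> fiber M Lo j. c \<sqsubset> l}" and ?D = "{c \<in> fiber M Hi j. c \<sqsubset> l}"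
      have eq: "{(x, y). ord l i x y} = push ?r P ?C ?D"
        unfolding 2(2) ord_new by (auto simp: new_def push_def in_rel in_fiber)
      show ?thesis unfolding eq
      proof (rule partial_order_push[OF po])
        show "chain_in P ?r ?C" "chain_in P ?r ?D"
          using Lo[OF 2(1)] Hi[OF 2(1)] unfolding chain_in_def Chains_def by blast+
        show "incomparable ?r ?C ?D" using inc[OF 2(1)] unfolding incomparable_def by blast
      qed
    qed
  qed
  then obtain K where K: "K \<in> Sets M"
    and lin_K: "\<And>i. i \<sqsubset> m \<oplus> k \<Longrightarrow> linear_order_on P (rel M (fiber M K i))"
    and ord_K: "\<And>i l x y. i \<sqsubset> m \<oplus> k \<Longrightarrow> ord l i x y \<Longrightarrow> (x, y) \<in> rel M (fiber M K i)" by blast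
  have r_K: "(x, y) \<in> rel M (fiber M K i)" if "(x, y) \<in> ?r" "i \<sqsubset> m \<oplus> k" for x y i
    using ord_K[OF that(2), of \<zero>] that index[OF that(2)] ord_old[of i] ord_new
    unfolding old_def new_def in_rel by blast
  have im: "i \<sqsubset> m \<oplus> k" if "i \<sqsubset> m" for i using that le_plus1 ar.less_le_trans by blast
  have jk: "m \<oplus> j \<sqsubset> m \<oplus> k" if "j \<sqsubset> k" for j using that by simp
  have anti: "x = y" if "i \<sqsubset> m \<oplus> k" "(x, y) \<in> rel M (fiber M K i)" "(y, x) \<in> rel M (fiber M K i)" for i x y
    using partial_order_onD(4)[OF linear_order_onD(1)[OF lin_K[OF that(1)]]] that by blast
  have "(x, y) \<in> ?r" if *: "\<And>i. i \<sqsubset> m \<oplus> k \<Longrightarrow> (x, y) \<in> rel M (fiber M K i)" for x y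
  proof (rule ccontr)
    assume n: "(x, y) \<notin> ?r"
    \<comment> \<open>At least one linear order exists, so a pair in all of them consists of points
      of \<open>P\<close>.\<close>
    have "\<zero> \<sqsubset> m" using \<open>m \<noteq> \<zero>\<close> zero_or_pos by blast
    then have xy: "x \<in> P" "y \<in> P"
      using *[OF im] partial_order_onD(1)[OF linear_order_onD(1)[OF lin_K[OF im]]] by blast+
    then have "x \<noteq> y" using n r(2) by blast
    have contra: "\<not> ord l i y x" if "i \<sqsubset> m \<oplus> k" for l i
      using anti[OF that *[OF that]] ord_K[OF that] \<open>x \<noteq> y\<close> by blast
    show False
    proof (cases "x \<in> Q \<and> y \<in> Q")
      case True
      have "(\<Inter>i\<in>{i. i \<sqsubset> m}. rel M (fiber M L i)) = Restr ?r Q"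
        using L unfolding realization_def by blast
      then obtain i where i: "i \<sqsubset> m" "(x, y) \<notin> rel M (fiber M L i)" using n by blast
      then have "(y, x) \<in> rel M (fiber M L i)"
        using True linear_order_onD(2) lin[OF i(1)] unfolding linearization_def by metis
      obtain l where "\<forall>a\<in>{x, y}. a \<sqsubset> l"
        using upper_bound_ex by (metis finite.emptyI finite.insertI)
      then have "old l i y x"
        using True \<open>(y, x) \<in> rel M (fiber M L i)\<close> r(2) xy unfolding old_def in_rel in_fiber by blast
      then show False using contra[OF im[OF i(1)]] ord_old[OF i(1)] by blast
    next
      case False
      then consider "x \<notin> Q" | "y \<notin> Q" by blast
      then show False
      proof cases
        case 1
        then obtain j where j: "j \<sqsubset> k" "x \<in> fiber M Hi j" using cover xy(1) by blast
        have "x \<sqsubset> x \<oplus> \<one>" by (rule less_Suc_self)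
        then have "new (x \<oplus> \<one>) j y x"
          unfolding new_def using j(2) n r(2) xy unfolding in_rel in_fiber by blast
        then show False using contra[OF jk[OF j(1)]] ord_new by blast
      next
        case 2
        then obtain j where j: "j \<sqsubset> k" "y \<in> fiber M Lo j" using cover xy(2) by blast
        have "y \<sqsubset> y \<oplus> \<one>" by (rule less_Suc_self)
        then have "new (y \<oplus> \<one>) j y x"
          unfolding new_def using j(2) n r(2) xy unfolding in_rel in_fiber by blast
        then show False using contra[OF jk[OF j(1)]] ord_new by blast
      qed
    qed
  qed
  then have "(\<Inter>i\<in>{i. i \<sqsubset> m \<oplus> k}. rel M (fiber M K i)) = ?r" using r_K by auto
  moreover have "linearization P ?r (rel M (fiber M K i))" if "i \<sqsubset> m \<oplus> k" for i
    using lin_K[OF that] r_K[OF _ that] unfolding linearization_def by auto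
  ultimately have "realization M P ?r (m \<oplus> k) K" unfolding realization_def by blast
  with K show ?thesis by blast
qed

section \<open>Distributing the removed chains over the new linear orders\<close>

lemma nm_2_times: "nm 2 \<otimes> x = x \<oplus> x"
  by (simp add: numeral_2_eq_2 ar.mult_2)

lemma double_mono: "x \<sqsubset> y \<Longrightarrow> (x \<oplus> x) \<oplus> \<one> \<sqsubset> y \<oplus> y"
proof -
  assume "x \<sqsubset> y"
  then have "x \<oplus> \<one> \<sqsubseteq> y" by (simp add: ar.less_iff_succ_less_eq)
  with \<open>x \<sqsubset> y\<close> have "x \<oplus> (x \<oplus> \<one>) \<sqsubset> y \<oplus> y" by (rule ar.add_less_le_mono)
  then show ?thesis by (simp add: plus_assoc)
qed

lemma double_less: "x \<sqsubset> y \<Longrightarrow> x \<oplus> x \<sqsubset> y \<oplus> y"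
  using double_mono less_Suc_self less_trans by blast

lemma double_inj: "x \<oplus> x = y \<oplus> y \<longleftrightarrow> x = y"
  using less_total[of x y] double_less less_irrefl by metis

lemma even_not_odd: "x \<oplus> x \<noteq> (y \<oplus> y) \<oplus> \<one>"
proof
  assume eq: "x \<oplus> x = (y \<oplus> y) \<oplus> \<one>"
  show False
  proof (cases "y \<sqsubset> x")
    case True
    then show False using double_mono eq less_irrefl by metis
  next
    case False
    then have "x \<oplus> x \<sqsubseteq> y \<oplus> y" by (intro ar.add_mono) (simp_all add: ar.not_less)
    then show False using eq by (simp add: ar.not_less[symmetric])
  qed
qed

lemma remove_family_Sets:
  "P \<in> Sets M \<Longrightarrow> C \<in> Sets M \<Longrightarrow> remove_family M P C n \<in> Sets M"
proof -
  assume *: "P \<in> Sets M" "C \<in> Sets M"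
  have "{x. x \<in> P \<and> \<not> (\<exists>i. i \<sqsubset> n \<and> pair M i x \<in> C)} \<in> Sets M"
    using * by (intro D0_Sets D0_intros)
  moreover have "{x. x \<in> P \<and> \<not> (\<exists>i. i \<sqsubset> n \<and> pair M i x \<in> C)} = remove_family M P C n"
    by (auto simp: remove_family_def in_fiber)
  ultimately show ?thesis by simp
qed

text \<open>Chain \<open>r\<close> is pushed down in the new order \<open>2r\<close> and up in the
  new order \<open>2r + 1\<close>. In each order the opposite family is empty, so incomparability
  holds trivially.\<close>

lemma WKL_imp_DBc:
  assumes "WKL M"
  shows "DBc M n"
  unfolding DBc_def Let_def dim_le_def
proof (intro ballI allI impI)
  fix P R C m L
  assume Sets: "P \<in> Sets M" "R \<in> Sets M" "C \<in> Sets M" "L \<in> Sets M"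
    and po: "partial_order_on P (rel M R)"
    and C: "\<forall>i. i \<sqsubset> n \<longrightarrow> chain_in P (rel M R) (fiber M C i)"
    and m: "m \<noteq> \<zero>"
  let ?Q = "remove_family M P C n"
  assume L: "realization M ?Q (Restr (rel M R) ?Q) m L"
  let ?Lo = "{z. \<exists>r. r \<sqsubseteq> z \<and> (\<exists>c. c \<sqsubseteq> z \<and> r \<sqsubset> n \<and> z = pair M (r \<oplus> r) c \<and> pair M r c \<in> C)}"
  let ?Hi = "{z. \<exists>r. r \<sqsubseteq> z \<and> (\<exists>c. c \<sqsubseteq> z \<and> r \<sqsubset> n \<and> z = pair M ((r \<oplus> r) \<oplus> \<one>) c \<and> pair M r c \<in> C)}"
  have ge: "r \<sqsubseteq> pair M (r \<oplus> r) c" "r \<sqsubseteq> pair M ((r \<oplus> r) \<oplus> \<one>) c" for r c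
    using pair_ge1 le_plus1 ar.order_trans by meson+
  have Lo: "c \<in> fiber M ?Lo j \<longleftrightarrow> (\<exists>r. r \<sqsubset> n \<and> j = r \<oplus> r \<and> c \<in> fiber M C r)" for c j
    using ge pair_ge2 by (auto simp: in_fiber double_inj)
  have Hi: "c \<in> fiber M ?Hi j \<longleftrightarrow> (\<exists>r. r \<sqsubset> n \<and> j = (r \<oplus> r) \<oplus> \<one> \<and> c \<in> fiber M C r)" for c j
    using ge pair_ge2 by (auto simp: in_fiber double_inj)
  show "\<exists>K\<in>Sets M. realization M P (rel M R) (m \<oplus> nm 2 \<otimes> n) K"
  proof (rule dim_bound[OF assms Sets(1,2) remove_family_Sets[OF Sets(1,3)] Sets(4) _ _ po _ m L])
    show "?Lo \<in> Sets M" "?Hi \<in> Sets M" using Sets(3) by (auto intro!: D0_Sets D0_intros)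
    show "?Q \<subseteq> P" by (auto simp: remove_family_def)
    have "c \<in> P \<and> ((c, d) \<in> rel M R \<or> (d, c) \<in> rel M R)"
      if "r \<sqsubset> n" "c \<in> fiber M C r" "d \<in> fiber M C r" for r c d
      using C that unfolding chain_in_def Chains_def by blast
    note chain = this
    show "chain_in P (rel M R) (fiber M ?Lo j)" for j
      unfolding chain_in_def Chains_def Ball_def mem_Collect_eq subset_iff Lo
      by (auto simp: double_inj) (use chain in blast)+
    show "chain_in P (rel M R) (fiber M ?Hi j)" for j
      unfolding chain_in_def Chains_def Ball_def mem_Collect_eq subset_iff Hi
      by (auto simp: double_inj) (use chain in blast)+
    show "incomparable (rel M R) (fiber M ?Lo j) (fiber M ?Hi j)" for j
      unfolding incomparable_def Ball_def Lo Hi by (auto simp: even_not_odd)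
    fix c assume "c \<in> P" "c \<notin> ?Q"
    then obtain r where r: "r \<sqsubset> n" "c \<in> fiber M C r" by (auto simp: remove_family_def)
    show "(\<exists>j. j \<sqsubset> nm 2 \<otimes> n \<and> c \<in> fiber M ?Lo j) \<and> (\<exists>j. j \<sqsubset> nm 2 \<otimes> n \<and> c \<in> fiber M ?Hi j)"
      unfolding Lo Hi nm_2_times using r double_less[OF r(1)] double_mono[OF r(1)] by blast
  qed
qed

text \<open>For a single chain incomparability is vacuous and both increments are 2.\<close>

lemma DBi_1_iff: "DBi M (nm 1) \<longleftrightarrow> DBc M (nm 1)"
proof -
  have "max2 M (nm 1) = nm 2" "nm 2 \<otimes> nm 1 = nm 2" by (simp_all add: max2_def del: numeral_of.simps) (simp)
  moreover have "i = j" if "i \<sqsubset> nm 1" "j \<sqsubset> nm 1" for i j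
    using that by (auto simp: less_nm simp del: numeral_of.simps)
  ultimately show ?thesis unfolding DBi_def DBc_def by metis
qed

text \<open>For \<open>n \<ge> 2\<close> the new order \<open>j\<close> pushes chain
  \<open>j\<close> down and its cyclic successor up; these are different, hence incomparable, and
  every chain gets both treatments. One chain is covered by \<open>DBc\<close>; with no chain at
  all, the two new orders just linearize \<open>P\<close>.\<close>

lemma WKL_imp_DBi:
  assumes "WKL M"
  shows "DBi M n"
proof -
  have "n = nm 0 \<or> n = nm 1" if "n \<sqsubset> nm 2"
    using that unfolding less_nm by (auto simp: less_Suc_eq numeral_2_eq_2)
  moreover have "\<zero> \<sqsubset> nm 2" using nm_less[of 0 2] by simp
  ultimately consider "n = nm 1" | "n = \<zero>" | "\<not> n \<sqsubset> nm 2" "n \<noteq> \<zero>" by auto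
  then show ?thesis
  proof cases
    case 1
    then show ?thesis using DBi_1_iff WKL_imp_DBc[OF assms] by metis
  next
    case 2
    show ?thesis
      unfolding DBi_def Let_def dim_le_def
    proof (intro ballI allI impI)
      fix P R C m L
      assume Sets: "P \<in> Sets M" "R \<in> Sets M" "C \<in> Sets M" "L \<in> Sets M"
        and po: "partial_order_on P (rel M R)" and m: "m \<noteq> \<zero>"
      let ?Q = "remove_family M P C n"
      assume L: "realization M ?Q (Restr (rel M R) ?Q) m L"
      have "{x. False} \<in> Sets M" by (intro D0_Sets D0_intros)
      then have empty: "{} \<in> Sets M" by simp
      show "\<exists>K\<in>Sets M. realization M P (rel M R) (m \<oplus> max2 M n) K"
        by (rule dim_bound[OF assms Sets(1,2) remove_family_Sets[OF Sets(1,3)] Sets(4) empty empty po _ m L])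
          (auto simp: 2 remove_family_def chain_in_def Chains_def incomparable_def fiber_def)
    qed
  next
    case 3
    then have max: "max2 M n = n" by (simp add: max2_def)
    show ?thesis
      unfolding DBi_def Let_def dim_le_def max
    proof (intro ballI allI impI)
      fix P R C m L
      assume Sets: "P \<in> Sets M" "R \<in> Sets M" "C \<in> Sets M" "L \<in> Sets M"
        and po: "partial_order_on P (rel M R)"
        and C: "\<forall>i. i \<sqsubset> n \<longrightarrow> chain_in P (rel M R) (fiber M C i)"
        and inc: "\<forall>i j. i \<sqsubset> n \<longrightarrow> j \<sqsubset> n \<longrightarrow> i \<noteq> j \<longrightarrow> incomparable (rel M R) (fiber M C i) (fiber M C j)"
        and m: "m \<noteq> \<zero>"
      let ?Q = "remove_family M P C n"
      assume L: "realization M ?Q (Restr (rel M R) ?Q) m L"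
      \<comment> \<open>The family \<open>C\<close> shifted cyclically: the last index receives
        chain zero.\<close>
      let ?Hi = "{z. \<exists>j. j \<sqsubseteq> z \<and> (\<exists>c. c \<sqsubseteq> z \<and> z = pair M j c \<and>
        ((j \<oplus> \<one> \<sqsubset> n \<and> pair M (j \<oplus> \<one>) c \<in> C) \<or> (j \<oplus> \<one> = n \<and> pair M \<zero> c \<in> C)))}"
      define nxt where "nxt = (\<lambda>j. if j \<oplus> \<one> \<sqsubset> n then j \<oplus> \<one> else \<zero>)"
      have Hi: "fiber M ?Hi j = fiber M C (nxt j)" if "j \<sqsubset> n" for j
      proof -
        have "j \<oplus> \<one> \<sqsubset> n \<or> j \<oplus> \<one> = n" using that by (metis ar.less_iff_succ_less_eq le_def)
        then show ?thesis
          using pair_ge1 pair_ge2 by (auto simp: nxt_def in_fiber less_irrefl)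
      qed
      have nxt: "nxt j \<sqsubset> n" "nxt j \<noteq> j" if "j \<sqsubset> n" for j
      proof -
        show "nxt j \<sqsubset> n" using 3(2) zero_or_pos[of n] by (simp add: nxt_def)
        have "n \<noteq> \<one>" using 3(1) nm_1 nm_less[of 1 2] by auto
        then have "j \<oplus> \<one> \<sqsubset> n" if "j = \<zero>"
          using that \<open>j \<sqsubset> n\<close> by (metis ar.less_iff_succ_less_eq le_def ar.add_0_left)
        then show "nxt j \<noteq> j" using less_Suc_self[of j] less_irrefl unfolding nxt_def by metis
      qed
      show "\<exists>K\<in>Sets M. realization M P (rel M R) (m \<oplus> n) K"
      proof (rule dim_bound[OF assms Sets(1,2) remove_family_Sets[OF Sets(1,3)] Sets(4,3) _ po _ m L])
        show "?Hi \<in> Sets M" using Sets(3) by (intro D0_Sets D0_intros)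
        show "?Q \<subseteq> P" by (auto simp: remove_family_def)
        show "chain_in P (rel M R) (fiber M C j)" if "j \<sqsubset> n" for j using C that by blast
        show "chain_in P (rel M R) (fiber M ?Hi j)" if "j \<sqsubset> n" for j
          unfolding Hi[OF that] using C nxt[OF that] by blast
        show "incomparable (rel M R) (fiber M C j) (fiber M ?Hi j)" if "j \<sqsubset> n" for j
          unfolding Hi[OF that] using inc that nxt[OF that] by metis
        fix c assume "c \<in> P" "c \<notin> ?Q"
        then obtain r where r: "r \<sqsubset> n" "c \<in> fiber M C r" by (auto simp: remove_family_def)
        obtain j where j: "j \<sqsubset> n" "nxt j = r"
        proof (cases "r = \<zero>")
          case True
          obtain j where "n = j \<oplus> \<one>" using pred_ex 3(2) by blast
          then show ?thesis using that[of j] True by (simp add: nxt_def)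
        next
          case False
          then obtain j where "r = j \<oplus> \<one>" using pred_ex by blast
          moreover from this have "j \<sqsubset> n" using r(1) less_trans[OF less_Suc_self] by blast
          ultimately show ?thesis using that[of j] r(1) by (simp add: nxt_def)
        qed
        show "(\<exists>j. j \<sqsubset> n \<and> c \<in> fiber M C j) \<and> (\<exists>j. j \<sqsubset> n \<and> c \<in> fiber M ?Hi j)"
          using r j Hi by blast
      qed
    qed
  qed
qed

section \<open>Weak Koenig's lemma from separation\<close>

definition Sigma1_separation :: bool
  where "Sigma1_separation \<longleftrightarrow> (\<forall>A B. D0 (\<lambda>e. A (e 0) (e 1)) \<longrightarrow> D0 (\<lambda>e. B (e 0) (e 1)) \<longrightarrow>
    (\<forall>x u v. A x u \<longrightarrow> \<not> B x v) \<longrightarrow>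
    (\<exists>X\<in>Sets M. \<forall>x w. (A x w \<longrightarrow> x \<in> X) \<and> (B x w \<longrightarrow> x \<notin> X)))"

lemma binary_seq_mem:
  assumes "binary_seq M s l" "binary_seq M t k" "fset M t \<subseteq> fset M s" "z \<in> fset M s" "z \<sqsubset> pair M k \<zero>"
  shows "z \<in> fset M t"
proof -
  obtain i where i: "z = pair M i \<zero> \<or> z = pair M i \<one>" by (rule binary_seqE[OF assms(1,4)])
  with assms(5) have "i \<sqsubset> k" using pair_bit_less by blast
  then show ?thesis
    using i assms(4) binary_seq_bits[OF assms(1-3)] binary_seq_bit[OF assms(1), of i]
      binary_seq_bit[OF assms(2), of i] binary_seq_subset_le[OF assms(1-3)] ar.less_le_trans by blast
qed

text \<open>
  At each node the separating set avoids the child whose subtree is seen to be finite first, so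
  a node whose subtree is infinite is followed by a child whose subtree is infinite.
\<close>

lemma separation_imp_WKL:
  assumes sep: Sigma1_separation
  shows "WKL M"
  unfolding WKL_def
proof (intro ballI impI)
  fix T assume T: "T \<in> Sets M" and tree: "binary_tree M T" and inf: "infinite_in M T"
  have restrict: "\<exists>t\<in>T. binary_seq M t k \<and> fset M t \<subseteq> fset M s"
    if "s \<in> T" and s: "binary_seq M s l" and k: "k \<sqsubseteq> l" for s l k
  proof -
    obtain t where t: "binary_seq M t k" "fset M t \<subseteq> fset M s" by (rule binary_seq_restrict[OF s k]) (rule that)
    with tree \<open>s \<in> T\<close> have "t \<in> T" unfolding binary_tree_def by blast
    with t show ?thesis by blast
  qed
  have level: "\<exists>t\<in>T. binary_seq M t l" for l
  proof -
    \<comment> \<open>Sequences of length at most \<open>l\<close> have codes at most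
      \<open>B\<close>, so a node with a larger code is longer and can be cut down to length
      \<open>l\<close>.\<close>
    obtain B where B: "code_bound (pair M l \<zero>) B" using code_bound_ex by blast
    obtain s where s: "s \<in> T" "B \<sqsubset> s" using inf unfolding infinite_in_def by blast
    then obtain k where k: "binary_seq M s k" using tree unfolding binary_tree_def by blast
    have "l \<sqsubseteq> k"
    proof (rule ccontr)
      assume "\<not> l \<sqsubseteq> k"
      then have "k \<sqsubseteq> l" using ar.linear by blast
      from binary_seq_le[OF B k this] s(2) show False by (simp add: ar.not_le[symmetric])
    qed
    then show ?thesis using restrict[OF s(1) k] by blast
  qed
  \<comment> \<open>Stage \<open>w\<close> certifies that no node of \<open>T\<close> of some length
    \<open>l\<close> extends \<open>s\<close> and contains the bit \<open>p\<close>. The bound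
    \<open>B\<close> on the codes of length \<open>l\<close> is part of the certificate, so checking
    it is a bounded search.\<close>
  define dead where "dead = (\<lambda>s p w. \<exists>l. l \<sqsubseteq> w \<and> (\<exists>B. B \<sqsubseteq> w \<and> p \<sqsubset> pair M l \<zero> \<and>
    code_bound (pair M l \<zero>) B \<and>
    (\<forall>t. t \<sqsubseteq> B \<longrightarrow> t \<in> T \<longrightarrow> binary_seq M t l \<longrightarrow> fset M s \<subseteq> fset M t \<longrightarrow> p \<notin> fset M t)))"
  have D0_dead: "D0 (\<lambda>e. dead (s e) (t e) (u e))" if "term_def s" "term_def t" "term_def u" for s t u
    unfolding dead_def using that T
    by (intro D0_intros D0_code_bound D0_binary_seq D0_fset_le D0_in_fset term_shift)
  \<comment> \<open>The code \<open>x\<close> stands for a node \<open>s\<close> of length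
    \<open>i\<close>; by stage \<open>w\<close> its child \<open>b\<close> is known to be dead and
    its child \<open>c\<close> is not. Comparing stages shows that the two roles exclude each
    other.\<close>
  define first where "first = (\<lambda>b c x w. \<exists>i. i \<sqsubseteq> x \<and> (\<exists>s. s \<sqsubseteq> x \<and> x = pair M i s \<and>
    (\<exists>u. u \<sqsubseteq> w \<and> dead s (pair M i b) u) \<and> \<not> (\<exists>u. u \<sqsubseteq> w \<and> dead s (pair M i c) u)))"
  have first: "first b c (pair M i s) w \<longleftrightarrow>
    (\<exists>u. u \<sqsubseteq> w \<and> dead s (pair M i b) u) \<and> \<not> (\<exists>u. u \<sqsubseteq> w \<and> dead s (pair M i c) u)" for b c i s w
    unfolding first_def using pair_ge1 pair_ge2 by auto
  have D0_first: "D0 (\<lambda>e. first b c (e 0) (e 1))" for b c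
    unfolding first_def by (intro D0_intros D0_dead term_shift)
  have disjoint: "\<not> first c b x v" if u: "first b c x u" for b c x u v
  proof -
    obtain i s where x: "x = pair M i s" using u unfolding first_def by blast
    show ?thesis using u ar.linear[of u v] ar.order_trans unfolding x first by blast
  qed
  have "\<exists>X\<in>Sets M. \<forall>x w. (first \<zero> \<one> x w \<longrightarrow> x \<in> X) \<and> (first \<one> \<zero> x w \<longrightarrow> x \<notin> X)"
    by (rule sep[unfolded Sigma1_separation_def, rule_format, OF D0_first[of \<zero> \<one>] D0_first[of \<one> \<zero>]])
      (rule disjoint)
  then obtain X where X: "X \<in> Sets M"
    and "\<forall>x w. (first \<zero> \<one> x w \<longrightarrow> x \<in> X) \<and> (first \<one> \<zero> x w \<longrightarrow> x \<notin> X)"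
    by blast
  then have X0: "\<And>x w. first \<zero> \<one> x w \<Longrightarrow> x \<in> X" and X1: "\<And>x w. first \<one> \<zero> x w \<Longrightarrow> x \<notin> X"
    by auto
  \<comment> \<open>\<open>s\<close> is the path of length \<open>l\<close> steered by
    \<open>X\<close>, where membership in \<open>X\<close> means choosing bit 1. The recursion is
    expressed through the initial segments of \<open>s\<close> itself, as a
    \<open>\<Sigma>\<^sup>0\<^sub>1\<close> property whose solutions are then shown to exist and to
    be coherent.\<close>
  define obey where "obey = (\<lambda>s l. binary_seq M s l \<and> (\<forall>i. i \<sqsubset> l \<longrightarrow> (\<exists>t. binary_seq M t i \<and>
    fset M t \<subseteq> fset M s \<and> (pair M i \<one> \<in> fset M s \<longleftrightarrow> pair M i t \<in> X))))"
  have S1_obey: "S1 (\<lambda>e. obey (s e) (t e))" if "term_def s" "term_def t" for s t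
    unfolding obey_def using that X
    by (intro S1_intros S1_D0 D0_intros D0_binary_seq D0_fset_le D0_in_fset term_shift)
  have obey_ex: "\<exists>s. obey s l" for l
  proof (rule S1_induct[of "\<lambda>l. \<exists>s. obey s l"])
    show "S1 (\<lambda>e. \<exists>s. obey s (e 0))" by (intro S1_ex S1_obey term_intros)
    have "{p. False} \<in> Sets M" by (intro D0_Sets D0_intros)
    then obtain s where "binary_seq M s \<zero>" by (rule binary_seq_ex)
    then show "\<exists>s. obey s \<zero>" unfolding obey_def by auto
    fix l assume "\<exists>s. obey s l"
    then obtain s where s: "binary_seq M s l" and obey: "\<And>i. i \<sqsubset> l \<Longrightarrow> \<exists>t. binary_seq M t i \<and>
      fset M t \<subseteq> fset M s \<and> (pair M i \<one> \<in> fset M s \<longleftrightarrow> pair M i t \<in> X)" unfolding obey_def by blast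
    let ?A = "\<lambda>p. (p \<sqsubset> l \<and> pair M p \<one> \<in> fset M s) \<or> (p = l \<and> pair M l s \<in> X)"
    have "{p. ?A p} \<in> Sets M" by (intro D0_Sets D0_intros D0_in_fset)
    then obtain t where t: "binary_seq M t (l \<oplus> \<one>)"
      "\<And>i. i \<sqsubset> l \<oplus> \<one> \<Longrightarrow> pair M i \<one> \<in> fset M t \<longleftrightarrow> ?A i" by (rule binary_seq_ex) (rule that)
    have st: "fset M s \<subseteq> fset M t"
      by (rule binary_seq_subset[OF t(1) s]) (use t(2) less_Suc_self less_trans less_irrefl in \<open>auto simp: less_Suc le_def\<close>)
    have "obey t (l \<oplus> \<one>)"
      unfolding obey_def
    proof (intro conjI allI impI)
      fix i assume i: "i \<sqsubset> l \<oplus> \<one>"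
      show "\<exists>u. binary_seq M u i \<and> fset M u \<subseteq> fset M t \<and> (pair M i \<one> \<in> fset M t \<longleftrightarrow> pair M i u \<in> X)"
      proof (cases "i = l")
        case True
        then show ?thesis using s st t(2)[OF i] less_irrefl by auto
      next
        case False
        with i have il: "i \<sqsubset> l" by (simp add: less_Suc le_def)
        then show ?thesis using obey[OF il] st t(2)[OF i] False by blast
      qed
    qed (rule t(1))
    then show "\<exists>s. obey s (l \<oplus> \<one>)" by blast
  qed
  \<comment> \<open>Before a first disagreement \<open>j\<close> the two initial segments coincide,
    so \<open>X\<close> prescribes the same bit at \<open>j\<close>.\<close>
  have coherent: "fset M s \<subseteq> fset M t" if s: "obey s k" and t: "obey t l" and kl: "k \<sqsubseteq> l" for s t k l
  proof -
    have bs: "binary_seq M s k" and bt: "binary_seq M t l" using s t unfolding obey_def by auto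
    have "pair M i \<one> \<in> fset M s \<longleftrightarrow> pair M i \<one> \<in> fset M t" if "i \<sqsubset> k" for i
    proof (rule ccontr)
      let ?P = "\<lambda>i. i \<sqsubset> k \<and> \<not> (pair M i \<one> \<in> fset M s \<longleftrightarrow> pair M i \<one> \<in> fset M t)"
      assume "\<not> (pair M i \<one> \<in> fset M s \<longleftrightarrow> pair M i \<one> \<in> fset M t)"
      moreover have "D0 (\<lambda>e. ?P (e 0))" by (intro D0_intros D0_in_fset)
      ultimately obtain j where j: "?P j" "\<And>c. c \<sqsubset> j \<Longrightarrow> \<not> ?P c"
        using \<open>i \<sqsubset> k\<close> by (metis (no_types, lifting) D0_least[of ?P i])
      then have jk: "j \<sqsubset> k" and jl: "j \<sqsubset> l" using kl ar.less_le_trans by blast+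
      obtain u where u: "binary_seq M u j" "fset M u \<subseteq> fset M s" "pair M j \<one> \<in> fset M s \<longleftrightarrow> pair M j u \<in> X"
        using s jk unfolding obey_def by blast
      obtain v where v: "binary_seq M v j" "fset M v \<subseteq> fset M t" "pair M j \<one> \<in> fset M t \<longleftrightarrow> pair M j v \<in> X"
        using t jl unfolding obey_def by blast
      have "fset M u \<subseteq> fset M v"
      proof (rule binary_seq_subset[OF v(1) u(1)])
        fix c assume "c \<sqsubset> j"
        then show "pair M c \<one> \<in> fset M u \<longleftrightarrow> pair M c \<one> \<in> fset M v"
          using j(2) jk less_trans binary_seq_bits[OF bs u(1,2)] binary_seq_bits[OF bt v(1,2)] by blast
      qed simp
      then have "u = v" by (rule binary_seq_eqI[OF v(1) u(1)])
      with j(1) u(3) v(3) show False by blast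
    qed
    then show ?thesis by (rule binary_seq_subset[OF bt bs kl])
  qed
  let ?ext = "\<lambda>s m B. \<exists>t. t \<sqsubseteq> B \<and> t \<in> T \<and> binary_seq M t m \<and> fset M s \<subseteq> fset M t"
  \<comment> \<open>That \<open>T\<close> is infinite above \<open>s\<close> means extensions to
    every length \<open>m\<close>. With the code bound \<open>B\<close> quantified universally, the
    search for an extension is bounded and the statement is \<open>\<Pi>\<^sup>0\<^sub>1\<close>, as
    \<open>Pi1_induct\<close> requires.\<close>
  let ?P = "\<lambda>l. \<forall>s m B. obey s l \<longrightarrow> l \<sqsubseteq> m \<longrightarrow> code_bound (pair M m \<zero>) B \<longrightarrow> ?ext s m B"
  have alive: "?P l" for l
  proof (rule Pi1_induct[of ?P])
    have "S1 (\<lambda>e. \<exists>s m B. obey s (e 0) \<and> e 0 \<sqsubseteq> m \<and> code_bound (pair M m \<zero>) B \<and> \<not> ?ext s m B)"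
      by (intro S1_ex S1_and S1_obey S1_D0 D0_intros D0_code_bound D0_binary_seq D0_fset_le T)
    then show "S1 (\<lambda>e. \<not> ?P (e 0))" by (rule S1_cong) blast
    show "?P \<zero>"
    proof (intro allI impI)
      fix s m B assume s: "obey s \<zero>" and B: "code_bound (pair M m \<zero>) B"
      obtain t where t: "t \<in> T" "binary_seq M t m" using level by blast
      have "fset M s = {}" using s unfolding obey_def binary_seq_def by auto
      then show "?ext s m B" using t binary_seq_le[OF B t(2)] by auto
    qed
    fix l assume IH: "?P l"
    show "?P (l \<oplus> \<one>)"
    proof (intro allI impI)
      fix s m B assume s: "obey s (l \<oplus> \<one>)" and lm: "l \<oplus> \<one> \<sqsubseteq> m" and B: "code_bound (pair M m \<zero>) B"
      have bs: "binary_seq M s (l \<oplus> \<one>)" using s unfolding obey_def by blast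
      obtain s' where s': "obey s' l" using obey_ex by blast
      then have bs': "binary_seq M s' l" unfolding obey_def by blast
      have ss': "fset M s' \<subseteq> fset M s" by (rule coherent[OF s' s]) simp
      obtain u where u: "binary_seq M u l" "fset M u \<subseteq> fset M s" "pair M l \<one> \<in> fset M s \<longleftrightarrow> pair M l u \<in> X"
        using s less_Suc_self[of l] unfolding obey_def by blast
      have "fset M u \<subseteq> fset M s'"
        by (rule binary_seq_subset[OF bs' u(1)])
          (simp_all add: binary_seq_bits[OF bs u(1,2)] binary_seq_bits[OF bs bs' ss'])
      then have "u = s'" by (rule binary_seq_eqI[OF bs' u(1)])
      with u(3) have bit: "pair M l \<one> \<in> fset M s \<longleftrightarrow> pair M l s' \<in> X" by simp
      \<comment> \<open>By the induction hypothesis \<open>s'\<close> has an extension in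
        \<open>T\<close> of length \<open>k0 \<oplus> k1\<close>, beyond both lengths at which the
        children were declared dead. It contains one of the two bits, and its restriction to the
        corresponding length contradicts that certificate.\<close>
      have not_both: False if d: "dead s' (pair M l \<zero>) u0" "dead s' (pair M l \<one>) u1" for u0 u1
      proof -
        obtain k0 B0 where 0: "pair M l \<zero> \<sqsubset> pair M k0 \<zero>" "code_bound (pair M k0 \<zero>) B0"
          "\<And>t. t \<sqsubseteq> B0 \<Longrightarrow> t \<in> T \<Longrightarrow> binary_seq M t k0 \<Longrightarrow> fset M s' \<subseteq> fset M t \<Longrightarrow> pair M l \<zero> \<notin> fset M t"
          using d(1) unfolding dead_def by blast
        obtain k1 B1 where 1: "pair M l \<one> \<sqsubset> pair M k1 \<zero>" "code_bound (pair M k1 \<zero>) B1"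
          "\<And>t. t \<sqsubseteq> B1 \<Longrightarrow> t \<in> T \<Longrightarrow> binary_seq M t k1 \<Longrightarrow> fset M s' \<subseteq> fset M t \<Longrightarrow> pair M l \<one> \<notin> fset M t"
          using d(2) unfolding dead_def by blast
        have l0: "l \<sqsubset> k0" using 0(1) pair_bit_less by blast
        have l1: "l \<sqsubset> k1" using 1(1) pair_bit_less by blast
        obtain B' where B': "code_bound (pair M (k0 \<oplus> k1) \<zero>) B'" using code_bound_ex by blast
        have "l \<sqsubseteq> k0 \<oplus> k1" using l0 le_plus1 ar.less_le_trans ar.less_imp_le by blast
        with IH s' B' obtain t where t: "t \<in> T" "binary_seq M t (k0 \<oplus> k1)" "fset M s' \<subseteq> fset M t" by blast
        have "pair M l b \<notin> fset M t"
          if b: "b = \<zero> \<or> b = \<one>" and k: "k \<sqsubseteq> k0 \<oplus> k1" "l \<sqsubset> k" "code_bound (pair M k \<zero>) B'"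
            and no: "\<And>t. t \<sqsubseteq> B' \<Longrightarrow> t \<in> T \<Longrightarrow> binary_seq M t k \<Longrightarrow> fset M s' \<subseteq> fset M t \<Longrightarrow> pair M l b \<notin> fset M t"
          for b k B'
        proof
          assume mem: "pair M l b \<in> fset M t"
          obtain v where v: "v \<in> T" "binary_seq M v k" "fset M v \<subseteq> fset M t"
            using restrict[OF t(1,2) k(1)] by blast
          have "z \<in> fset M v" if "z \<in> fset M s'" for z
          proof (rule binary_seq_mem[OF t(2) v(2,3)])
            show "z \<in> fset M t" using that t(3) by blast
            have "z \<sqsubset> pair M l \<zero>" by (rule binary_seq_less[OF bs' that])
            also have "pair M l \<zero> \<sqsubset> pair M k \<zero>" using k(2) pair_bit_less by blast
            finally show "z \<sqsubset> pair M k \<zero>" .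
          qed
          moreover have "pair M l b \<in> fset M v"
            by (rule binary_seq_mem[OF t(2) v(2,3) mem]) (use k(2) pair_bit_less b in blast)
          ultimately show False using no[of v] v binary_seq_le[OF k(3) v(2)] by blast
        qed
        from this[OF _ _ l0 0(2,3)] this[OF _ _ l1 1(2,3)]
        have "pair M l \<zero> \<notin> fset M t" "pair M l \<one> \<notin> fset M t" by simp_all
        moreover have "l \<sqsubset> k0 \<oplus> k1" using l0 le_plus1 ar.less_le_trans by blast
        ultimately show False using binary_seq_bit[OF t(2)] by blast
      qed
      obtain b where b: "b = \<zero> \<or> b = \<one>" "pair M l b \<in> fset M s"
        using binary_seq_bit[OF bs less_Suc_self] by blast
      \<comment> \<open>If the chosen child were dead, the other one would never be, so the
        corresponding instance of \<open>first\<close> would have made \<open>X\<close> choose the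
        other bit.\<close>
      have "\<not> dead s' (pair M l b) w" for w
      proof
        assume dead: "dead s' (pair M l b) w"
        show False
        proof (cases "b = \<zero>")
          case True
          then have "first \<zero> \<one> (pair M l s') w" using dead not_both unfolding first by blast
          then show False using X0 bit b(2) True binary_seq_bit[OF bs less_Suc_self] by blast
        next
          case False
          then have "first \<one> \<zero> (pair M l s') w" using dead b(1) not_both unfolding first by blast
          then show False using X1 bit b False by blast
        qed
      qed
      moreover have "pair M l b \<sqsubset> pair M m \<zero>"
        using pair_bit_less[OF b(1)] ar.less_le_trans[OF less_Suc_self lm] by blast
      \<comment> \<open>Not being dead is used at the stage \<open>m \<oplus> B\<close>, which
        admits the length \<open>m\<close> and the bound \<open>B\<close> as candidates for a
        certificate.\<close>
      ultimately obtain t where t: "t \<sqsubseteq> B" "t \<in> T" "binary_seq M t m" "fset M s' \<subseteq> fset M t" "pair M l b \<in> fset M t"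
        using B le_plus1[of m B] le_plus2[of B m] unfolding dead_def by blast
      have "fset M s \<subseteq> fset M t"
      proof
        fix z assume z: "z \<in> fset M s"
        obtain i where i: "i \<sqsubset> l \<oplus> \<one>" "z = pair M i \<zero> \<or> z = pair M i \<one>" by (rule binary_seqE[OF bs z])
        show "z \<in> fset M t"
        proof (cases "i = l")
          case True
          then have "z = pair M l b"
            using i(2) b z binary_seq_bit[OF bs less_Suc_self] by blast
          with t(5) show ?thesis by simp
        next
          case False
          with i(1) have "i \<sqsubset> l" by (simp add: less_Suc le_def)
          then have "z \<in> fset M s'"
            using binary_seq_mem[OF bs bs' ss' z] i(2) pair_bit_less by blast
          with t(4) show ?thesis by blast
        qed
      qed
      with t show "?ext s m B" by blast
    qed
  qed
  \<comment> \<open>Paths of a given length that obey \<open>X\<close> exist and are unique, so a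
    bit is absent from the path iff some obeying sequence omits it. Thus the path and its complement
    are both \<open>\<Sigma>\<^sup>0\<^sub>1\<close>, and the path exists by
    \<open>\<Delta>\<^sup>0\<^sub>1\<close> comprehension.\<close>
  let ?F = "\<lambda>z. \<exists>i. i \<sqsubseteq> z \<and> (z = pair M i \<zero> \<or> z = pair M i \<one>) \<and> (\<exists>s. obey s (i \<oplus> \<one>) \<and> z \<in> fset M s)"
  let ?G = "\<lambda>z. \<not> (\<exists>i. i \<sqsubseteq> z \<and> (z = pair M i \<zero> \<or> z = pair M i \<one>)) \<or>
    (\<exists>i. i \<sqsubseteq> z \<and> (z = pair M i \<zero> \<or> z = pair M i \<one>) \<and> (\<exists>s. obey s (i \<oplus> \<one>) \<and> z \<notin> fset M s))"
  have unique: "fset M s = fset M t" if "obey s l" "obey t l" for s t l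
    using coherent that ar.order_refl by blast
  have F_bit: "?F (pair M i b) \<longleftrightarrow> (\<exists>s. obey s (i \<oplus> \<one>) \<and> pair M i b \<in> fset M s)" if "b = \<zero> \<or> b = \<one>" for i b
    using that pair_ge1 by auto
  have F_iff: "?F (pair M i b) \<longleftrightarrow> pair M i b \<in> fset M s" if "b = \<zero> \<or> b = \<one>" "obey s (i \<oplus> \<one>)" for i b s
    unfolding F_bit[OF that(1)] using unique that(2) by blast
  have G: "\<not> ?F z \<longleftrightarrow> ?G z" for z
  proof (cases "\<exists>i b. (b = \<zero> \<or> b = \<one>) \<and> z = pair M i b")
    case True
    then obtain i b where z: "b = \<zero> \<or> b = \<one>" "z = pair M i b" by blast
    obtain s where s: "obey s (i \<oplus> \<one>)" using obey_ex by blast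
    have "?G (pair M i b) \<longleftrightarrow> (\<exists>s. obey s (i \<oplus> \<one>) \<and> pair M i b \<notin> fset M s)"
      using z(1) pair_ge1 by auto
    also have "\<dots> \<longleftrightarrow> pair M i b \<notin> fset M s" using s unique[OF _ s] by blast
    finally have G_iff: "?G z \<longleftrightarrow> z \<notin> fset M s" unfolding z(2) .
    have "\<not> ?F z \<longleftrightarrow> z \<notin> fset M s" unfolding z(2) by (simp only: F_iff[OF z(1) s] simp_thms)
    then show ?thesis using G_iff by (rule trans[OF _ sym])
  next
    case False
    then have none: "\<not> (\<exists>i. i \<sqsubseteq> z \<and> (z = pair M i \<zero> \<or> z = pair M i \<one>))" by blast
    then have "?G z" by (rule disjI1)
    moreover from none have "\<not> ?F z" by blast
    ultimately show ?thesis by (intro iffI)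
  qed
  have F: "{z. ?F z} \<in> Sets M"
  proof (rule Delta1_Sets)
    show "S1 (\<lambda>e. ?F (e 0))"
      by (intro S1_ex S1_and S1_obey S1_D0 D0_intros D0_in_fset)
    have "S1 (\<lambda>e. ?G (e 0))"
      by (intro S1_or S1_ex S1_and S1_obey S1_D0 D0_intros D0_in_fset)
    then show "S1 (\<lambda>e. \<not> ?F (e 0))" by (rule S1_cong) (rule G[symmetric])
  qed
  have "infinite_path M T {z. ?F z}"
    unfolding infinite_path_def mem_Collect_eq
  proof (intro conjI ballI allI)
    fix z assume "z \<in> {z. ?F z}"
    then show "\<exists>i. z = pair M i \<zero> \<or> z = pair M i \<one>" by blast
  next
    fix i
    obtain s where s: "obey s (i \<oplus> \<one>)" using obey_ex by blast
    then have "binary_seq M s (i \<oplus> \<one>)" unfolding obey_def by blast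
    then show "?F (pair M i \<zero>) \<noteq> ?F (pair M i \<one>)"
      using F_iff[OF _ s, of \<zero>] F_iff[OF _ s, of \<one>] binary_seq_bit less_Suc_self by blast
  next
    fix l
    obtain s where s: "obey s l" using obey_ex by blast
    then have bs: "binary_seq M s l" unfolding obey_def by blast
    obtain B where "code_bound (pair M l \<zero>) B" using code_bound_ex by blast
    with alive[rule_format, OF s] obtain t where t: "t \<in> T" "binary_seq M t l" "fset M s \<subseteq> fset M t" by blast
    then have "s = t" using binary_seq_eqI bs by blast
    have "z \<in> {z. ?F z}" if z: "z \<in> fset M s" for z
    proof -
      obtain i where i: "i \<sqsubset> l" "z = pair M i \<zero> \<or> z = pair M i \<one>" by (rule binary_seqE[OF bs z])
      then obtain b where b: "b = \<zero> \<or> b = \<one>" "z = pair M i b" by blast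
      obtain u where u: "obey u (i \<oplus> \<one>)" using obey_ex by blast
      then have bu: "binary_seq M u (i \<oplus> \<one>)" unfolding obey_def by blast
      have "fset M u \<subseteq> fset M s"
        by (rule coherent[OF u s]) (use i(1) in \<open>simp add: ar.less_iff_succ_less_eq\<close>)
      then have "z \<in> fset M u"
        using binary_seq_mem[OF bs bu _ z] b pair_bit_less[OF b(1)] less_Suc_self by blast
      then show ?thesis using F_iff[OF b(1) u] b(2) by blast
    qed
    then show "\<exists>s\<in>T. binary_seq M s l \<and> fset M s \<subseteq> {z. ?F z}"
      using t(1) bs \<open>s = t\<close> by blast
  qed
  with F show "\<exists>F\<in>Sets M. infinite_path M T F" by blast
qed

section \<open>Separation from dimension bounds\<close>

text \<open>The index set is finite outside the model, so this quantifier is a finite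
  disjunction.\<close>

lemma D0_ex_finite:
  assumes "finite T" "\<And>t. t \<in> T \<Longrightarrow> D0 (S t)"
  shows "D0 (\<lambda>e. \<exists>t\<in>T. S t e)"
  using assms
proof (induction T rule: finite_induct)
  case empty
  show ?case by (rule D0_cong[OF D0_const[of False]]) simp
next
  case (insert t T)
  have "D0 (\<lambda>e. S t e \<or> (\<exists>t\<in>T. S t e))" using insert by (intro D0_or) auto
  then show ?case by (rule D0_cong) simp
qed

lemma D0_nat_if:
  assumes "D0 C" "D0 (\<lambda>e. f e = (n::nat))" "D0 (\<lambda>e. g e = n)"
  shows "D0 (\<lambda>e. (if C e then f e else g e) = n)"
proof (rule D0_cong)
  show "D0 (\<lambda>e. (C e \<and> f e = n) \<or> (\<not> C e \<and> g e = n))" using assms by (intro D0_intros)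
qed auto

lemma D0_nat_rel:
  assumes "\<And>n. D0 (\<lambda>e. f e = (n::nat))" "\<And>n. D0 (\<lambda>e. g e = n)" "\<And>e. f e < N" "\<And>e. g e < N"
  shows "D0 (\<lambda>e. H (f e) (g e))"
proof (rule D0_cong)
  show "D0 (\<lambda>e. \<exists>n\<in>{..<N}. \<exists>m\<in>{..<N}. f e = n \<and> g e = m \<and> H n m)"
    by (intro D0_ex_finite finite_lessThan D0_and D0_const assms(1,2))
qed (use assms(3,4) in auto)

section \<open>A standard example with one pair replaced by a chain and points\<close>

definition el :: "nat \<Rightarrow> 'a \<Rightarrow> 'a"
  where "el t i = pair M (nm t) i"

lemma el_inj [simp]: "el t i = el u j \<longleftrightarrow> t = u \<and> i = j"
  by (simp add: el_def)

lemma el_ge: "i \<sqsubseteq> el t i"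
  by (simp add: el_def pair_ge2)

lemma term_el: "term_def s \<Longrightarrow> term_def (\<lambda>e. el t (s e))"
  unfolding el_def by (intro term_intros)

text \<open>
  The poset consists of a chain \<open>c\<^sub>0 < c\<^sub>1 < \<dots>\<close> (\<open>el 0 t\<close>), of points \<open>x\<^sub>e\<close> (\<open>el 1 e\<close>) and \<open>y\<^sub>e\<close>
  (\<open>el 2 e\<close>), and of a standard example \<open>a\<^sub>i, b\<^sub>i\<close> (\<open>el 3 i\<close>, \<open>el 4 i\<close>), \<open>i < K\<close>, with \<open>a\<^sub>i < b\<^sub>j\<close>
  for \<open>i \<noteq> j\<close>.  The chain and the points play the roles of a further \<open>a\<close> and a further \<open>b\<close>, where
  \<open>c\<^sub>t < x\<^sub>e\<close> holds until \<open>A e\<close> is seen to hold, and \<open>c\<^sub>t < y\<^sub>e\<close> until \<open>B e\<close> is seen to hold.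
\<close>

definition std_below ::
    "('a \<Rightarrow> 'a \<Rightarrow> bool) \<Rightarrow> ('a \<Rightarrow> 'a \<Rightarrow> bool) \<Rightarrow> nat \<Rightarrow> 'a \<Rightarrow> nat \<Rightarrow> 'a \<Rightarrow> bool"
  where "std_below A B t i u j \<longleftrightarrow>
    (t = u \<and> i = j) \<or> (t = 0 \<and> u = 0 \<and> i \<sqsubseteq> j) \<or> (t = 0 \<and> u = 4) \<or>
    (t = 0 \<and> u = 1 \<and> \<not> (\<exists>s. s \<sqsubseteq> i \<and> A j s)) \<or> (t = 0 \<and> u = 2 \<and> \<not> (\<exists>s. s \<sqsubseteq> i \<and> B j s)) \<or>
    (t = 3 \<and> u = 1) \<or> (t = 3 \<and> u = 2) \<or> (t = 3 \<and> u = 4 \<and> i \<noteq> j)"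

definition std_dom :: "nat \<Rightarrow> nat \<Rightarrow> 'a \<Rightarrow> bool"
  where "std_dom K t i \<longleftrightarrow> t < 3 \<or> (t < 5 \<and> i \<sqsubset> nm K)"

definition std_set :: "nat \<Rightarrow> 'a set"
  where "std_set K = {x. \<exists>t i. x = el t i \<and> std_dom K t i}"

definition std_rel :: "('a \<Rightarrow> 'a \<Rightarrow> bool) \<Rightarrow> ('a \<Rightarrow> 'a \<Rightarrow> bool) \<Rightarrow> nat \<Rightarrow> 'a rel"
  where "std_rel A B K = {(x, y). \<exists>t i u j. x = el t i \<and> y = el u j \<and>
    std_dom K t i \<and> std_dom K u j \<and> std_below A B t i u j}"

lemma in_std_set [simp]: "el t i \<in> std_set K \<longleftrightarrow> std_dom K t i"
  by (auto simp: std_set_def)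

lemma in_std_rel [simp]:
  "(el t i, el u j) \<in> std_rel A B K \<longleftrightarrow> std_dom K t i \<and> std_dom K u j \<and> std_below A B t i u j"
  by (auto simp: std_rel_def)

lemma std_dom_less: "std_dom K t i \<Longrightarrow> t < 5"
  by (auto simp: std_dom_def)

lemma std_set_Sets: "std_set K \<in> Sets M"
proof -
  have "{x. \<exists>t\<in>{..<5}. \<exists>i. i \<sqsubseteq> x \<and> x = el t i \<and> std_dom K t i} \<in> Sets M"
    unfolding std_dom_def by (intro D0_Sets D0_ex_finite finite_lessThan D0_intros term_el)
  moreover have "{x. \<exists>t\<in>{..<5}. \<exists>i. i \<sqsubseteq> x \<and> x = el t i \<and> std_dom K t i} = std_set K"
    using el_ge std_dom_less by (auto simp: std_set_def)
  ultimately show ?thesis by simp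
qed

text \<open>\<open>D0_rename\<close> only replaces variables by variables; terms are substituted by
  bounded quantifiers over a value equal to the term.\<close>

lemma D0_comp2:
  assumes "D0 (\<lambda>e. A (e 0) (e 1))" "term_def s" "term_def t"
  shows "D0 (\<lambda>e. A (s e) (t e))"
proof (rule D0_cong)
  have "D0 (\<lambda>e. A (e 0) (e 1))" by (rule assms(1))
  from D0_rename[OF this, of id] have A: "D0 (\<lambda>e. A (e 0) (e (Suc 0)))" by simp
  have "D0 (\<lambda>e. \<exists>a. a \<sqsubseteq> s e \<and> a = s e \<and> (\<exists>b. b \<sqsubseteq> t e \<and> b = t e \<and> A a b))"
    using assms(2,3) D0_rename[OF A, of "\<lambda>i. if i = 0 then 1 else if i = 1 then 0 else i"]
    by (intro D0_intros term_shift) (auto simp: inj_def)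
  then show "D0 (\<lambda>e. \<exists>a. a \<sqsubseteq> s e \<and> a = s e \<and> (\<exists>b. b \<sqsubseteq> t e \<and> b = t e \<and> A a b))" .
qed auto

lemma std_rel_Sets:
  assumes "D0 (\<lambda>e. A (e 0) (e 1))" "D0 (\<lambda>e. B (e 0) (e 1))"
  shows "\<exists>R\<in>Sets M. rel M R = std_rel A B K"
proof
  let ?R = "{w. \<exists>t\<in>{..<5}. \<exists>u\<in>{..<5}. \<exists>i. i \<sqsubseteq> w \<and> (\<exists>j. j \<sqsubseteq> w \<and> w = pair M (el t i) (el u j) \<and>
    std_dom K t i \<and> std_dom K u j \<and> std_below A B t i u j)}"
  show "?R \<in> Sets M"
    unfolding std_dom_def std_below_def
    by (intro D0_Sets D0_ex_finite finite_lessThan D0_intros term_el term_shift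
        D0_comp2[OF assms(1)] D0_comp2[OF assms(2)])
  have "i \<sqsubseteq> pair M (el t i) (el u j)" "j \<sqsubseteq> pair M (el t i) (el u j)" for t i u j
    using el_ge pair_ge1 pair_ge2 ar.order_trans by blast+
  then show "rel M ?R = std_rel A B K"
    using std_dom_less by (auto simp: in_rel std_rel_def)
qed

text \<open>Points and \<open>b\<close>'s are maximal and \<open>a\<close>'s are minimal, so a
  composition of two steps is nontrivial only if the first stays in the chain. Moving down the chain
  keeps all relations, because fewer stages are inspected.\<close>

lemma partial_order_std: "partial_order_on (std_set K) (std_rel A B K)"
proof (rule partial_order_onI)
  show "std_rel A B K \<subseteq> std_set K \<times> std_set K" by (auto simp: std_rel_def)
  show "(x, x) \<in> std_rel A B K" if "x \<in> std_set K" for x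
    using that by (auto simp: std_set_def std_below_def)
next
  fix x y z assume "(x, y) \<in> std_rel A B K" "(y, z) \<in> std_rel A B K"
  then obtain t i u j v k where x: "x = el t i" "y = el u j" "z = el v k"
    and d: "std_dom K t i" "std_dom K v k" and b: "std_below A B t i u j" "std_below A B u j v k"
    by (auto simp: std_rel_def)
  have "(t = u \<and> i = j) \<or> (u = v \<and> j = k) \<or> (t = 0 \<and> u = 0 \<and> i \<sqsubseteq> j)"
    using b unfolding std_below_def by auto
  then have "std_below A B t i v k"
  proof (elim disjE conjE)
    assume 0: "t = 0" "u = 0" "i \<sqsubseteq> j"
    have "s \<sqsubseteq> j" if "s \<sqsubseteq> i" for s using that 0(3) by (rule ar.order_trans)
    moreover have "i \<sqsubseteq> k" if "j \<sqsubseteq> k" using 0(3) that by (rule ar.order_trans)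
    ultimately show ?thesis using b(2) 0 unfolding std_below_def by auto
  qed (use b in simp_all)
  with d show "(x, z) \<in> std_rel A B K" by (simp add: x)
next
  fix x y assume "(x, y) \<in> std_rel A B K" "(y, x) \<in> std_rel A B K"
  then show "x = y"
    by (auto simp: std_rel_def std_below_def)
qed

section \<open>Two linear orders for the poset without the chains\<close>

lemma linear_order_rank:
  fixes \<rho> :: "'a \<Rightarrow> nat"
  assumes "\<And>x. s x x" "\<And>x y z. s x y \<Longrightarrow> s y z \<Longrightarrow> s x z"
    "\<And>x y. s x y \<Longrightarrow> s y x \<Longrightarrow> x = y" "\<And>x y. s x y \<or> s y x"
  shows "linear_order_on Q {(x, y). x \<in> Q \<and> y \<in> Q \<and> (\<rho> x < \<rho> y \<or> (\<rho> x = \<rho> y \<and> s x y))}"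
proof (rule linear_order_onI, goal_cases)
  case (3 x y z)
  then show ?case using assms(2)[of x y z] by auto
next
  case (4 x y)
  then show ?case using assms(3)[of x y] by auto
next
  case (5 x y)
  then show ?case using assms(4)[of x y] by auto
qed (use assms(1) in auto)

text \<open>The blocks are \<open>a_q\<close>, the other \<open>a\<close>'s, \<open>b_p\<close>,
  \<open>a_p\<close>, then the points with the other \<open>b\<close>'s, and \<open>b_q\<close>. So
  pair \<open>p\<close> is reversed and pair \<open>q\<close> is not; exchanging \<open>p\<close>
  and \<open>q\<close> gives the second order.\<close>

definition rank :: "'a \<Rightarrow> 'a \<Rightarrow> 'a \<Rightarrow> nat"
  where "rank p q x = (if x = el 3 q then 0 else if x = el 3 p then 3
    else if \<exists>i. i \<sqsubseteq> x \<and> x = el 3 i then 1 else if x = el 4 p then 2 else if x = el 4 q then 5 else 4)"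

lemma rank_less: "rank p q x < 6"
  by (simp add: rank_def)

lemma D0_rank: "term_def s \<Longrightarrow> D0 (\<lambda>e. rank p q (s e) = n)"
  unfolding rank_def by (intro D0_nat_if D0_intros term_el term_shift)

lemma rank_el:
  "rank p q (el 3 i) = (if i = q then 0 else if i = p then 3 else 1)"
  "rank p q (el 4 i) = (if i = p then 2 else if i = q then 5 else 4)"
  "rank p q (el (Suc 0) i) = 4" "rank p q (el 2 i) = 4"
  using el_ge by (auto simp: rank_def)

text \<open>With the chain gone and each earlier pair broken, only the pairs \<open>p\<close> and
  \<open>q\<close> contain an \<open>a\<close> that is not below a \<open>b\<close>. The two
  rankings reverse one of these each, and ties inside a block are broken in opposite
  directions.\<close>

lemma std_realization:
  fixes K :: nat
  assumes Q: "Q \<in> Sets M" "Q \<subseteq> std_set K" and c: "\<And>t. el 0 t \<notin> Q" and "K \<ge> 2"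
    and ab: "\<And>i. i < K - 2 \<Longrightarrow> el 3 (nm i) \<notin> Q \<or> el 4 (nm i) \<notin> Q"
  shows "\<exists>L\<in>Sets M. realization M Q (Restr (std_rel A B K) Q) (nm 2) L"
proof -
  define p where "p = nm (K - 2)"
  define q where "q = nm (K - 1)"
  have "p \<noteq> q" using \<open>K \<ge> 2\<close> by (auto simp: p_def q_def)
  let ?L1 = "{(x, y). x \<in> Q \<and> y \<in> Q \<and> (rank p q x < rank p q y \<or> (rank p q x = rank p q y \<and> x \<sqsubseteq> y))}"
  let ?L2 = "{(x, y). x \<in> Q \<and> y \<in> Q \<and> (rank q p x < rank q p y \<or> (rank q p x = rank q p y \<and> y \<sqsubseteq> x))}"
  let ?L = "{w. \<exists>x. x \<sqsubseteq> w \<and> (\<exists>y. y \<sqsubseteq> w \<and> x \<in> Q \<and> y \<in> Q \<and>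
    ((w = pair M (nm 0) (pair M x y) \<and> (rank p q x < rank p q y \<or> (rank p q x = rank p q y \<and> x \<sqsubseteq> y))) \<or>
     (w = pair M (nm 1) (pair M x y) \<and> (rank q p x < rank q p y \<or> (rank q p x = rank q p y \<and> y \<sqsubseteq> x)))))}"
  have L: "?L \<in> Sets M"
    using Q(1) by (intro D0_Sets D0_intros D0_nat_rel[OF D0_rank D0_rank rank_less rank_less])
  have ge: "x \<sqsubseteq> pair M i (pair M x y)" "y \<sqsubseteq> pair M i (pair M x y)" for i x y
    using pair_ge1 pair_ge2 ar.order_trans by blast+
  have "nm 0 \<noteq> nm 1" unfolding nm_inj by simp
  then have rel0: "rel M (fiber M ?L (nm 0)) = ?L1" and rel1: "rel M (fiber M ?L (nm 1)) = ?L2"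
    using ge by (auto simp: in_rel in_fiber)
  have el: "\<exists>t i. x = el t i \<and> (t = 1 \<or> t = 2 \<or> ((t = 3 \<or> t = 4) \<and> (\<exists>n<K. i = nm n)))" if xQ: "x \<in> Q" for x
  proof -
    obtain t i where x: "x = el t i" "std_dom K t i" using Q(2) xQ by (auto simp: std_set_def)
    moreover have "t \<noteq> 0" using c xQ x(1) by (cases t) auto
    ultimately show ?thesis by (auto simp: std_dom_def less_nm less_Suc_eq numeral_eq_Suc)
  qed
  have eq: "?L1 \<inter> ?L2 = Restr (std_rel A B K) Q"
  proof (rule set_eqI, clarify)
    fix x y
    show "(x, y) \<in> ?L1 \<inter> ?L2 \<longleftrightarrow> (x, y) \<in> Restr (std_rel A B K) Q"
    proof (cases "x \<in> Q \<and> y \<in> Q")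
      case True
      obtain t i where x: "x = el t i" and t: "t = 1 \<or> t = 2 \<or> ((t = 3 \<or> t = 4) \<and> (\<exists>n<K. i = nm n))"
        using el True by blast
      obtain u j where y: "y = el u j" and u: "u = 1 \<or> u = 2 \<or> ((u = 3 \<or> u = 4) \<and> (\<exists>n<K. j = nm n))"
        using el True by blast
      have dom: "std_dom K t i" "std_dom K u j" using True Q(2) x y by auto
      have mid: "i = p \<or> i = q" if "t = 3" and u4: "u = 4" "i = j"
      proof -
        obtain n where n: "n < K" "i = nm n" using t \<open>t = 3\<close> by auto
        have "\<not> n < K - 2" using ab[of n] True x y \<open>t = 3\<close> u4 n(2) by auto
        then have "n = K - 2 \<or> n = K - 1" using n(1) \<open>K \<ge> 2\<close> by arith
        with n(2) show ?thesis by (auto simp: p_def q_def)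
      qed
      have "(rank p q x < rank p q y \<or> (rank p q x = rank p q y \<and> x \<sqsubseteq> y)) \<and>
          (rank q p x < rank q p y \<or> (rank q p x = rank q p y \<and> y \<sqsubseteq> x)) \<longleftrightarrow> std_below A B t i u j"
      proof -
        have tt: "t = 1 \<or> t = 2 \<or> t = 3 \<or> t = 4" and uu: "u = 1 \<or> u = 2 \<or> u = 3 \<or> u = 4" using t u by auto
        define a b where "a \<longleftrightarrow> x \<sqsubseteq> y" and "b \<longleftrightarrow> y \<sqsubseteq> x"
        have "a \<and> b \<longleftrightarrow> x = y" unfolding a_def b_def using ar.order_antisym[of x y] by auto
        note eq = this
        then have anti: "a \<and> b \<longleftrightarrow> t = u \<and> i = j" by (simp add: x y)
        let ?G = "(rank p q x < rank p q y \<or> (rank p q x = rank p q y \<and> a)) \<and>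
          (rank q p x < rank q p y \<or> (rank q p x = rank q p y \<and> b))"
        have upper: "rank p q x = 2 \<and> rank q p x = 5 \<and> (t, i) = (4, p) \<or> rank p q x = 5 \<and> rank q p x = 2 \<and> (t, i) = (4, q) \<or>
            rank p q x = 4 \<and> rank q p x = 4 \<and> (t, i) \<noteq> (4, p) \<and> (t, i) \<noteq> (4, q)"
          if "x = el t i" "t = 1 \<or> t = 2 \<or> t = 4" for x t i
          using that(2) \<open>p \<noteq> q\<close> unfolding that(1)
          by (cases "i = p"; cases "i = q"; elim disjE; simp add: rank_el)
        have lower: "rank p q x = 0 \<and> rank q p x = 3 \<and> i = q \<or> rank p q x = 3 \<and> rank q p x = 0 \<and> i = p \<or>
            rank p q x = 1 \<and> rank q p x = 1 \<and> i \<noteq> p \<and> i \<noteq> q"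
          if "x = el 3 i" for x i
          using \<open>p \<noteq> q\<close> unfolding that
          by (cases "i = p"; cases "i = q"; simp add: rank_el)
        have "?G \<longleftrightarrow> std_below A B t i u j"
        proof (cases "t = 3")
          case t3: True
          with x have x3: "x = el 3 i" by simp
          show ?thesis
          proof (cases "u = 3")
            case True
            with y have y3: "y = el 3 j" by simp
            have ij: "a \<and> b \<longleftrightarrow> i = j" using anti t3 True by simp
            have "std_below A B t i u j \<longleftrightarrow> a \<and> b" using t3 True anti by (simp add: std_below_def)
            moreover have "?G \<longleftrightarrow> a \<and> b"
              using lower[OF x3] lower[OF y3] ij \<open>p \<noteq> q\<close> by (elim disjE conjE) simp_all
            ultimately show ?thesis by blast
          next
            case False
            then have u': "u = 1 \<or> u = 2 \<or> u = 4" using uu by blast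
            have "std_below A B t i u j \<longleftrightarrow> \<not> (u = 4 \<and> i = j)"
              using t3 u' by (auto simp: std_below_def)
            moreover have "?G \<longleftrightarrow> \<not> (u = 4 \<and> i = j)"
              using lower[OF x3] upper[OF y u'] mid[OF t3] \<open>p \<noteq> q\<close> by (elim disjE conjE) auto
            ultimately show ?thesis by blast
          qed
        next
          case False
          then have t': "t = 1 \<or> t = 2 \<or> t = 4" using tt by blast
          then have below: "std_below A B t i u j \<longleftrightarrow> a \<and> b" unfolding anti by (auto simp: std_below_def)
          show ?thesis
          proof (cases "u = 3")
            case True
            with y have y3: "y = el 3 j" by simp
            have "\<not> (a \<and> b)" using anti False True by blast
            moreover have "\<not> ?G"
              using lower[OF y3] upper[OF x t'] \<open>p \<noteq> q\<close> by (elim disjE conjE) simp_all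
            ultimately show ?thesis using below by blast
          next
            case False
            then have u': "u = 1 \<or> u = 2 \<or> u = 4" using uu by blast
            have "?G \<longleftrightarrow> a \<and> b"
            proof -
              have "rank p q x = rank p q y \<longleftrightarrow> rank q p x = rank q p y"
                using upper[OF x t'] upper[OF y u'] by (elim disjE conjE) simp_all
              moreover have "rank p q x < rank p q y \<longleftrightarrow> rank q p y < rank q p x"
                using upper[OF x t'] upper[OF y u'] by (elim disjE conjE) simp_all
              ultimately have "?G \<longleftrightarrow> rank p q x = rank p q y \<and> a \<and> b" by auto
              then show ?thesis using eq by auto
            qed
            then show ?thesis using below by blast
          qed
        qed
        then show ?thesis unfolding a_def b_def .
      qed
      then show ?thesis using True dom by (simp add: x y)
    qed auto
  qed
  have "realization M Q (Restr (std_rel A B K) Q) (nm 2) ?L"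
    unfolding realization_def
  proof (intro conjI allI impI)
    have ix: "i \<sqsubset> nm 2 \<longleftrightarrow> i = nm 0 \<or> i = nm 1" for i
      unfolding less_nm by (auto simp: less_Suc_eq numeral_2_eq_2)
    have "{i. i \<sqsubset> nm 2} = {nm 0, nm 1}" using ix by blast
    then show "(\<Inter>i\<in>{i. i \<sqsubset> nm 2}. rel M (fiber M ?L i)) = Restr (std_rel A B K) Q"
      using eq rel0 rel1 by simp
    fix i assume "i \<sqsubset> nm 2"
    then have "i = nm 0 \<or> i = nm 1" using ix by blast
    then show "linearization Q (Restr (std_rel A B K) Q) (rel M (fiber M ?L i))"
    proof
      assume "i = nm 0"
      then show ?thesis unfolding linearization_def \<open>i = nm 0\<close> rel0
        using linear_order_rank[of "(\<sqsubseteq>)" Q "rank p q"] ar.order_trans ar.order_antisym ar.linear eq by blast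
    next
      assume "i = nm 1"
      then show ?thesis unfolding linearization_def \<open>i = nm 1\<close> rel1
        using linear_order_rank[of "\<lambda>x y. y \<sqsubseteq> x" Q "rank q p"] ar.order_trans ar.order_antisym ar.linear eq by blast
    qed
  qed
  with L show ?thesis by blast
qed

text \<open>
  In a realization by \<open>K + 1\<close> linear orders each pair \<open>a\<^sub>i, b\<^sub>i\<close> is reversed by one of them and each
  linear order reverses at most one pair.  In the linear orders that reverse a pair all \<open>c\<^sub>t\<close> are
  below all \<open>x\<^sub>e\<close> and \<open>y\<^sub>e\<close>, so the only remaining one reverses every incomparable \<open>c\<^sub>t\<close> and
  \<open>x\<^sub>e\<close> (or \<open>y\<^sub>e\<close>), and thereby decides whether \<open>A e\<close> or \<open>B e\<close>.
\<close>

lemma realization_separates: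
  fixes K :: nat
  assumes L: "L \<in> Sets M" and real: "realization M (std_set K) (std_rel A B K) (nm (Suc K)) L"
    and disjoint: "\<And>x u v. A x u \<Longrightarrow> \<not> B x v"
  shows "\<exists>X\<in>Sets M. \<forall>x w. (A x w \<longrightarrow> x \<in> X) \<and> (B x w \<longrightarrow> x \<notin> X)"
proof -
  let ?r = "std_rel A B K"
  define l where "l = (\<lambda>h. rel M (fiber M L (nm h)))"
  have lin: "linear_order_on (std_set K) (l h)" and ext: "?r \<subseteq> l h" if "h \<le> K" for h
    using real that unfolding realization_def linearization_def l_def
    by (auto simp del: numeral_of.simps simp: less_Suc_eq_le)
  have anti: "x = y" if "h \<le> K" "(x, y) \<in> l h" "(y, x) \<in> l h" for h x y
    using partial_order_onD(4)[OF linear_order_onD(1)[OF lin[OF that(1)]]] that by blast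
  have trans: "(x, z) \<in> l h" if "h \<le> K" "(x, y) \<in> l h" "(y, z) \<in> l h" for h x y z
    using partial_order_onD(3)[OF linear_order_onD(1)[OF lin[OF that(1)]]] that by blast
  have reverse: "\<exists>h\<le>K. (y, x) \<in> l h" if xy: "x \<in> std_set K" "y \<in> std_set K" "(x, y) \<notin> ?r" for x y
  proof -
    have "(\<Inter>i\<in>{i. i \<sqsubset> nm (Suc K)}. rel M (fiber M L i)) = ?r"
      using real unfolding realization_def by blast
    then obtain i where i: "i \<sqsubset> nm (Suc K)" "(x, y) \<notin> rel M (fiber M L i)" using xy(3) by blast
    then obtain h where "h < Suc K" "i = nm h" unfolding less_nm by blast
    with i(2) have "h \<le> K" "(x, y) \<notin> l h" by (auto simp: l_def)
    then show ?thesis using linear_order_onD(2)[OF lin] xy by blast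
  qed
  have "\<exists>h\<le>K. (el 4 (nm i), el 3 (nm i)) \<in> l h" if "i < K" for i
    by (rule reverse) (use that in \<open>auto simp: std_dom_def std_below_def\<close>)
  then obtain g where g: "\<And>i. i < K \<Longrightarrow> g i \<le> K" "\<And>i. i < K \<Longrightarrow> (el 4 (nm i), el 3 (nm i)) \<in> l (g i)"
    by metis
  have "inj_on g {..<K}"
  proof (rule inj_onI, rule ccontr)
    fix i j assume ij: "i \<in> {..<K}" "j \<in> {..<K}" "g i = g j" "i \<noteq> j"
    then have "(el 3 (nm i), el 4 (nm j)) \<in> l (g i)" "(el 3 (nm j), el 4 (nm i)) \<in> l (g i)"
      using ext[OF g(1)[of i]] by (auto simp: std_dom_def std_below_def subset_iff)
    moreover have "(el 4 (nm i), el 3 (nm i)) \<in> l (g i)" "(el 4 (nm j), el 3 (nm j)) \<in> l (g i)"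
      using ij g(2)[of i] g(2)[of j] by auto
    moreover have "g i \<le> K" using ij g(1) by simp
    \<comment> \<open>An order reversing both pairs contains the cycle
      \<open>b_i, a_i, b_j, a_j, b_i\<close>.\<close>
    ultimately have "el 4 (nm i) = el 4 (nm j)" using anti trans by meson
    with ij(4) show False by simp
  qed
  then have "card (g ` {..<K}) = K" by (simp add: card_image)
  moreover have "g ` {..<K} \<subseteq> {..K}" using g(1) by auto
  \<comment> \<open>Of the \<open>K + 1\<close> orders, \<open>K\<close> are used by the injection
    \<open>g\<close>.\<close>
  ultimately have "card ({..K} - g ` {..<K}) = 1" by (simp add: card_Diff_subset)
  then obtain h0 where h0: "{..K} - g ` {..<K} = {h0}" by (auto simp: card_1_singleton_iff)
  then have h0K: "h0 \<le> K" by blast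
  have other: "(el 0 t, el u e) \<in> l h" if "h \<le> K" "h \<noteq> h0" and u: "u = 1 \<or> u = 2" for h t u e
  proof -
    have "h \<in> g ` {..<K}" using h0 that(1,2) by blast
    then obtain i where i: "i < K" "h = g i" by blast
    \<comment> \<open>In this order \<open>c_t\<close> is below \<open>b_i\<close>, which is below
      \<open>a_i\<close> by the reversal, which is below the point.\<close>
    have "(el 0 t, el 4 (nm i)) \<in> l h" "(el 3 (nm i), el u e) \<in> l h"
      using ext[OF that(1)] i(1) u by (auto simp: std_dom_def std_below_def subset_iff)
    moreover have "(el 4 (nm i), el 3 (nm i)) \<in> l h" using g(2) i by simp
    ultimately show ?thesis using trans[OF that(1)] by blast
  qed
  have only: "(el u e, el 0 t) \<in> l h0" if u: "u = 1 \<or> u = 2" and n: "(el 0 t, el u e) \<notin> ?r" for t u e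
  proof -
    obtain h where h: "h \<le> K" "(el u e, el 0 t) \<in> l h"
      using reverse[OF _ _ n] u by (auto simp: std_dom_def)
    have "h = h0"
    proof (rule ccontr)
      assume "h \<noteq> h0"
      then have "el 0 t = el u e" using anti[OF h(1) _ h(2)] other[OF h(1) _ u] by blast
      with u show False by auto
    qed
    with h(2) show ?thesis by simp
  qed
  \<comment> \<open>If \<open>A e s\<close>, then \<open>x_e\<close> lies below \<open>c_s\<close>
    in \<open>l h0\<close>, while \<open>c_s\<close> stays below \<open>y_e\<close> because
    \<open>B e\<close> never holds; so \<open>x_e\<close> precedes \<open>y_e\<close>. If
    \<open>B e s\<close>, the roles are exchanged.\<close>
  let ?X = "{e. (el 1 e, el 2 e) \<in> l h0}"
  have "?X \<in> Sets M" unfolding l_def in_rel in_fiber using L by (intro D0_Sets D0_intros term_el)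
  moreover have "e \<in> ?X" if A: "A e s" for e s
  proof -
    have "(el 1 e, el 0 s) \<in> l h0"
      by (rule only) (use A in \<open>auto simp: std_below_def\<close>)
    moreover have "(el 0 s, el 2 e) \<in> l h0"
      using ext[OF h0K] disjoint[OF A] by (auto simp: std_dom_def std_below_def subset_iff)
    ultimately show ?thesis using trans[OF h0K] by blast
  qed
  moreover have "e \<notin> ?X" if B: "B e s" for e s
  proof
    assume e: "e \<in> ?X"
    have "(el 2 e, el 0 s) \<in> l h0"
      by (rule only) (use B in \<open>auto simp: std_below_def\<close>)
    moreover have "(el 0 s, el 1 e) \<in> ?r"
      using disjoint[of e _ s] B by (auto simp: std_dom_def std_below_def)
    then have "(el 0 s, el 1 e) \<in> l h0" using ext[OF h0K] by blast
    ultimately have "(el 2 e, el 1 e) \<in> l h0" using trans[OF h0K] by blast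
    then have "el 1 e = el 2 e" using anti[OF h0K] e by blast
    then show False by simp
  qed
  ultimately show ?thesis by blast
qed

text \<open>The counts meet here: two orders for \<open>Q\<close> and \<open>K - 1\<close> added
  ones make \<open>K + 1\<close>, one more than there are pairs.\<close>

lemma dim_separates:
  assumes "Q \<in> Sets M" "Q \<subseteq> std_set K" "\<And>t. el 0 t \<notin> Q" "K \<ge> 2"
    "\<And>i. i < K - 2 \<Longrightarrow> el 3 (nm i) \<notin> Q \<or> el 4 (nm i) \<notin> Q"
    and dim: "dim_le M (std_set K) (std_rel A B K) Q (Restr (std_rel A B K) Q) (nm (K - 1))"
    and disjoint: "\<And>x u v. A x u \<Longrightarrow> \<not> B x v"
  shows "\<exists>X\<in>Sets M. \<forall>x w. (A x w \<longrightarrow> x \<in> X) \<and> (B x w \<longrightarrow> x \<notin> X)"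
proof -
  obtain L where L: "L \<in> Sets M" "realization M Q (Restr (std_rel A B K) Q) (nm 2) L"
    using std_realization[OF assms(1-5)] by blast
  have "nm 2 \<noteq> \<zero>" using nm_inj[of 2 0] by simp
  then obtain L' where "L' \<in> Sets M" "realization M (std_set K) (std_rel A B K) (nm 2 \<oplus> nm (K - 1)) L'"
    using dim L unfolding dim_le_def by blast
  moreover have "nm 2 \<oplus> nm (K - 1) = nm (Suc K)"
    unfolding nm_add[symmetric] nm_inj using \<open>K \<ge> 2\<close> by simp
  ultimately show ?thesis using realization_separates disjoint by metis
qed

section \<open>Families of chains that leave two pairs intact\<close>

lemma finite_family_Sets:
  assumes "\<And>r. finite (S r)"
  shows "\<exists>C\<in>Sets M. \<forall>r<n. fiber M C (nm r) = S r \<union> (if r = 0 then range (el 0) else {})"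
proof
  let ?C = "{w. (\<exists>t. t \<sqsubseteq> w \<and> w = pair M (nm 0) (el 0 t)) \<or> (\<exists>r\<in>{..<n}. \<exists>s\<in>S r. w = pair M (nm r) s)}"
  show "?C \<in> Sets M"
    by (intro D0_Sets D0_or D0_ex_finite finite_lessThan assms D0_intros term_el)
  show "\<forall>r<n. fiber M ?C (nm r) = S r \<union> (if r = 0 then range (el 0) else {})"
  proof (intro allI impI set_eqI)
    fix r x assume "r < n"
    have t: "t \<sqsubseteq> pair M i (el 0 t)" for t i using el_ge pair_ge2 ar.order_trans by blast
    have "x \<in> fiber M ?C (nm r) \<longleftrightarrow>
      (\<exists>t. t \<sqsubseteq> pair M (nm r) x \<and> r = 0 \<and> x = el 0 t) \<or> (\<exists>q\<in>{..<n}. \<exists>s\<in>S q. r = q \<and> x = s)"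
      unfolding in_fiber mem_Collect_eq pair_inj nm_inj ..
    also have "\<dots> \<longleftrightarrow> x \<in> S r \<union> (if r = 0 then range (el 0) else {})"
      using t \<open>r < n\<close> by auto
    finally show "x \<in> fiber M ?C (nm r) \<longleftrightarrow> x \<in> S r \<union> (if r = 0 then range (el 0) else {})" .
  qed
qed

lemma in_remove_family_nm:
  "x \<in> remove_family M P C (nm n) \<longleftrightarrow> x \<in> P \<and> (\<forall>r<n. x \<notin> fiber M C (nm r))"
  unfolding remove_family_def less_nm by auto

text \<open>
  Removing \<open>c\<^sub>0, c\<^sub>1, \<dots>, b\<^sub>0\<close> and the chains \<open>a\<^bsub>2r - 1\<^esub> < b\<^bsub>2r\<^esub>\<close> leaves only two of the \<open>2n + 1\<close> pairs.
\<close>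

lemma DBc_imp_separation:
  assumes DBc: "DBc M (nm n)" and "n \<ge> 1"
  shows Sigma1_separation
  unfolding Sigma1_separation_def
proof (intro allI impI)
  fix A B assume A: "D0 (\<lambda>e. A (e 0) (e 1))" and B: "D0 (\<lambda>e. B (e 0) (e 1))"
    and disjoint: "\<forall>x u v. A x u \<longrightarrow> \<not> B x v"
  \<comment> \<open>The \<open>n\<close> chains break \<open>2n - 1\<close> pairs and two more
    remain; the increment \<open>2n\<close> equals \<open>K - 1\<close>.\<close>
  define K where "K = 2 * n + 1"
  obtain R where R: "R \<in> Sets M" "rel M R = std_rel A B K" using std_rel_Sets[OF A B] by blast
  define S where "S = (\<lambda>r. if r = 0 then {el 4 (nm 0)} else {el 3 (nm (2 * r - 1)), el 4 (nm (2 * r))})"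
  have "finite (S r)" for r by (simp add: S_def)
  then obtain C where C: "C \<in> Sets M"
    and fib: "\<And>r. r < n \<Longrightarrow> fiber M C (nm r) = S r \<union> (if r = 0 then range (el 0) else {})"
    using finite_family_Sets[of S n] by blast
  let ?Q = "remove_family M (std_set K) C (nm n)"
  have chain: "chain_in (std_set K) (rel M R) (fiber M C i)" if i: "i \<sqsubset> nm n" for i
  proof -
    obtain r where r: "r < n" "i = nm r" using i unfolding less_nm by blast
    show ?thesis
      unfolding r(2) R(2) fib[OF r(1)] chain_in_def Chains_def
      using r(1) ar.linear by (auto simp: S_def K_def std_dom_def std_below_def simp del: numeral_of.simps)
  qed
  have "dim_le M (std_set K) (rel M R) ?Q (Restr (rel M R) ?Q) (nm 2 \<otimes> nm n)"
    using DBc[unfolded DBc_def Let_def, rule_format, OF std_set_Sets R(1) C _ chain] partial_order_std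
    unfolding R(2) by blast
  moreover have "nm 2 \<otimes> nm n = nm (K - 1)" by (simp add: K_def nm_mult)
  ultimately have dim: "dim_le M (std_set K) (std_rel A B K) ?Q (Restr (std_rel A B K) ?Q) (nm (K - 1))"
    unfolding R(2) by simp
  show "\<exists>X\<in>Sets M. \<forall>x w. (A x w \<longrightarrow> x \<in> X) \<and> (B x w \<longrightarrow> x \<notin> X)"
  proof (rule dim_separates[OF _ _ _ _ _ dim])
    show "?Q \<in> Sets M" by (rule remove_family_Sets[OF std_set_Sets C])
    show "?Q \<subseteq> std_set K" by (auto simp: remove_family_def)
    show "K \<ge> 2" using \<open>n \<ge> 1\<close> by (simp add: K_def)
    show "el 0 t \<notin> ?Q" for t
    proof -
      have "0 < n" using \<open>n \<ge> 1\<close> by simp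
      moreover from this have "el 0 t \<in> fiber M C (nm 0)" using fib[of 0] by (simp del: numeral_of.simps)
      ultimately show ?thesis unfolding in_remove_family_nm by blast
    qed
    show "el 3 (nm i) \<notin> ?Q \<or> el 4 (nm i) \<notin> ?Q" if i: "i < K - 2" for i
    proof (cases "even i")
      case True
      then obtain r where "i = 2 * r" by (elim evenE)
      then have "r < n" "el 4 (nm i) \<in> fiber M C (nm r)" using i fib[of r] by (auto simp: K_def S_def)
      then show ?thesis unfolding in_remove_family_nm by blast
    next
      case False
      then obtain r where r: "i = 2 * r + 1" by (elim oddE)
      then have "Suc r < n" using i by (simp add: K_def)
      moreover from this have "el 3 (nm i) \<in> fiber M C (nm (Suc r))"
        using fib[of "Suc r"] r by (simp add: S_def del: numeral_of.simps)
      ultimately show ?thesis unfolding in_remove_family_nm by blast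
    qed
    show "\<And>x u v. A x u \<Longrightarrow> \<not> B x v" using disjoint by blast
  qed
qed

text \<open>Incomparable chains can break only one pair each: the infinite chain is accompanied by
  the singletons \<open>a_0, ..., a_(n-2)\<close>, all of them incomparable. This breaks
  \<open>n - 1\<close> of the \<open>n + 1\<close> pairs, and the increment is \<open>n\<close>
  because \<open>n \<ge> 2\<close>.\<close>

lemma DBi_imp_separation:
  assumes DBi: "DBi M (nm n)" and "n \<ge> 2"
  shows Sigma1_separation
  unfolding Sigma1_separation_def
proof (intro allI impI)
  fix A B assume A: "D0 (\<lambda>e. A (e 0) (e 1))" and B: "D0 (\<lambda>e. B (e 0) (e 1))"
    and disjoint: "\<forall>x u v. A x u \<longrightarrow> \<not> B x v"
  define K where "K = n + 1"
  obtain R where R: "R \<in> Sets M" "rel M R = std_rel A B K" using std_rel_Sets[OF A B] by blast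
  define S where "S = (\<lambda>r. if r = 0 then {} else {el 3 (nm (r - 1))})"
  have "finite (S r)" for r by (simp add: S_def)
  then obtain C where C: "C \<in> Sets M"
    and fib: "\<And>r. r < n \<Longrightarrow> fiber M C (nm r) = S r \<union> (if r = 0 then range (el 0) else {})"
    using finite_family_Sets[of S n] by blast
  let ?Q = "remove_family M (std_set K) C (nm n)"
  have chain: "chain_in (std_set K) (rel M R) (fiber M C i)" if i: "i \<sqsubset> nm n" for i
  proof -
    obtain r where r: "r < n" "i = nm r" using i unfolding less_nm by blast
    show ?thesis
      unfolding r(2) R(2) fib[OF r(1)] chain_in_def Chains_def
      using r(1) ar.linear by (auto simp: S_def K_def std_dom_def std_below_def simp del: numeral_of.simps)
  qed
  have inc: "incomparable (rel M R) (fiber M C i) (fiber M C j)"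
    if i: "i \<sqsubset> nm n" and j: "j \<sqsubset> nm n" and ij: "i \<noteq> j" for i j
  proof -
    obtain r where r: "r < n" "i = nm r" using i unfolding less_nm by blast
    obtain s where s: "s < n" "j = nm s" using j unfolding less_nm by blast
    have "r \<noteq> s" using ij r(2) s(2) by blast
    then show ?thesis
      unfolding r(2) s(2) R(2) fib[OF r(1)] fib[OF s(1)] incomparable_def
      by (auto simp: S_def std_below_def simp del: numeral_of.simps)
  qed
  have "dim_le M (std_set K) (rel M R) ?Q (Restr (rel M R) ?Q) (max2 M (nm n))"
    using DBi[unfolded DBi_def Let_def, rule_format, OF std_set_Sets R(1) C _ chain inc] partial_order_std
    unfolding R(2) by blast
  moreover have "max2 M (nm n) = nm (K - 1)" using \<open>n \<ge> 2\<close> by (simp add: max2_def K_def)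
  ultimately have dim: "dim_le M (std_set K) (std_rel A B K) ?Q (Restr (std_rel A B K) ?Q) (nm (K - 1))"
    unfolding R(2) by simp
  show "\<exists>X\<in>Sets M. \<forall>x w. (A x w \<longrightarrow> x \<in> X) \<and> (B x w \<longrightarrow> x \<notin> X)"
  proof (rule dim_separates[OF _ _ _ _ _ dim])
    show "?Q \<in> Sets M" by (rule remove_family_Sets[OF std_set_Sets C])
    show "?Q \<subseteq> std_set K" by (auto simp: remove_family_def)
    show "K \<ge> 2" using \<open>n \<ge> 2\<close> by (simp add: K_def)
    show "el 0 t \<notin> ?Q" for t
    proof -
      have "0 < n" using \<open>n \<ge> 2\<close> by simp
      moreover from this have "el 0 t \<in> fiber M C (nm 0)" using fib[of 0] by (simp del: numeral_of.simps)
      ultimately show ?thesis unfolding in_remove_family_nm by blast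
    qed
    show "el 3 (nm i) \<notin> ?Q \<or> el 4 (nm i) \<notin> ?Q" if i: "i < K - 2" for i
    proof -
      have "Suc i < n" using i by (simp add: K_def)
      moreover from this have "el 3 (nm i) \<in> fiber M C (nm (Suc i))"
        using fib[of "Suc i"] by (simp add: S_def del: numeral_of.simps)
      ultimately show ?thesis unfolding in_remove_family_nm by blast
    qed
    show "\<And>x u v. A x u \<Longrightarrow> \<not> B x v" using disjoint by blast
  qed
qed

lemma DBc_imp_WKL: "DBc M (nm n) \<Longrightarrow> n \<ge> 1 \<Longrightarrow> WKL M"
  using DBc_imp_separation separation_imp_WKL by blast

text \<open>For \<open>n = 1\<close> the increment is 2 instead of \<open>n\<close>, so the count of
  the general case fails and \<open>DBc\<close> takes over.\<close>

lemma DBi_imp_WKL: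
  assumes "DBi M (nm n)" "n \<ge> 1"
  shows "WKL M"
proof (cases "n = 1")
  case True
  then show ?thesis using assms DBi_1_iff DBc_imp_WKL by blast
next
  case False
  then have "n \<ge> 2" using assms(2) by simp
  then show ?thesis using DBi_imp_separation[OF assms(1)] separation_imp_WKL by blast
qed

end

theorem theorem1:
  fixes M :: "'a l2_structure"
  assumes "RCA0 M"
  shows "(\<forall>n::nat. n \<ge> 1 \<longrightarrow>
            (WKL M \<longleftrightarrow> DBi M (numeral_of M n)) \<and> (WKL M \<longleftrightarrow> DBc M (numeral_of M n))) \<and>
         (WKL M \<longleftrightarrow> (\<forall>n. DBi M n)) \<and>
         (WKL M \<longleftrightarrow> (\<forall>n. DBc M n))"
proof -
  interpret rca M using assms by (rule rca.intro)
  show ?thesis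
    using WKL_imp_DBi WKL_imp_DBc DBi_imp_WKL DBc_imp_WKL by blast
qed

end
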